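(* Let $N\ge 3$, $s\in(0,1)$, $\alpha\in(0,N)$, $\omega>0$ and $p>1$. Assume that either $p\le 1+\frac{\alpha}{N}$ or $p\ge\frac{N+\alpha}{N-2s}$. Then the equation $$(-\Delta)^s u+\omega u=(\mathcal K_\alpha*|u|^p)|u|^{p-2}u,\quad u\in H^s(\mathbb R^N),$$ does not admit nontrivial solutions $u\in C^2(\mathbb R^N)$.
   Context: Functions are real-valued and integrals are over $\mathbb R^N$. $\mathcal K_\alpha(x)=|x|^{\alpha-N}$. $(-\Delta)^{s}$ and $(-\Delta)^{s/2}$ are the Fourier multipliers with symbols $|\xi|^{2s}$ and $|\xi|^{s}$. $H^s(\mathbb R^N)=\{u\in L^2(\mathbb R^N):(-\Delta)^{s/2}u\in L^2(\mathbb R^N)\}$. A (weak) solution of the equation is $u\in H^s(\mathbb R^N)$ such that $\int(-\Delta)^{s/2}u\,(-\Delta)^{s/2}v+\omega\int uv=\int(\mathcal K_\alpha*|u|^p)|u|^{p-2}uv$ for all $v\in H^s(\mathbb R^N)$ (the integral on the right being, in particular, well defined). *)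

theory Defs
  imports "HOL-Analysis.Analysis"
begin

text \<open>
  Points of \<open>\<real>\<^sup>N\<close> are elements of \<open>real ^ 'n\<close> with \<open>N = CARD('n)\<close>. Elements of \<open>L\<^sup>2\<close> are represented
  by Borel functions; every class modulo null sets has such a representative.
\<close>

definition L2 :: "(real ^ 'n \<Rightarrow> 'b :: {real_normed_vector, second_countable_topology}) set" where
  "L2 = {f \<in> borel_measurable lborel. integrable lborel (\<lambda>x. (norm (f x))\<^sup>2)}"

definition fourier_integral :: "(real ^ 'n \<Rightarrow> real) \<Rightarrow> real ^ 'n \<Rightarrow> complex" where
  "fourier_integral f \<xi> =
     of_real ((2 * pi) powr (- real CARD('n) / 2)) *
     (\<integral>x. cis (- (x \<bullet> \<xi>)) * of_real (f x) \<partial>lborel)"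

text \<open>
  The Fourier transform on \<open>L\<^sup>2\<close> (unitary normalisation, no \<open>2\<pi>\<close> in the exponent, so that
  \<open>-\<Delta>\<close> has symbol \<open>|\<xi>|\<^sup>2\<close>): \<open>F\<close> is the \<open>L\<^sup>2\<close>-limit of the Fourier integrals of the truncations of
  \<open>f\<close> to balls. It is determined up to null sets, hence a relation. The extended integral is
  used so that convergence to zero cannot hold because of a non-integrable integrand.
\<close>

definition has_L2_fourier :: "(real ^ 'n \<Rightarrow> real) \<Rightarrow> (real ^ 'n \<Rightarrow> complex) \<Rightarrow> bool" where
  "has_L2_fourier f F \<longleftrightarrow> f \<in> L2 \<and> F \<in> L2 \<and>
     (\<lambda>n::nat. \<integral>\<^sup>+\<xi>. ennreal ((norm (fourier_integral (\<lambda>x. indicator (ball 0 (real n)) x * f x) \<xi>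
        - F \<xi>))\<^sup>2) \<partial>lborel) \<longlonglongrightarrow> 0"

definition has_frac_laplacian :: "real \<Rightarrow> (real ^ 'n \<Rightarrow> real) \<Rightarrow> (real ^ 'n \<Rightarrow> real) \<Rightarrow> bool" where
  "has_frac_laplacian t u g \<longleftrightarrow>
     (\<exists>U G. has_L2_fourier u U \<and> has_L2_fourier g G \<and>
        (AE \<xi> in lborel. G \<xi> = of_real (norm \<xi> powr (2 * t)) * U \<xi>))"

text \<open>A representative of \<open>(-\<Delta>)\<^sup>t u \<in> L\<^sup>2\<close>, meaningful only if one exists and then unique up to null sets.\<close>

definition frac_laplacian :: "real \<Rightarrow> (real ^ 'n \<Rightarrow> real) \<Rightarrow> real ^ 'n \<Rightarrow> real" where
  "frac_laplacian t u = (SOME g. has_frac_laplacian t u g)"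

definition sobolev_H :: "real \<Rightarrow> (real ^ 'n \<Rightarrow> real) set" where
  "sobolev_H s = {u \<in> L2. \<exists>g \<in> L2. has_frac_laplacian (s / 2) u g}"

definition riesz_kernel :: "real \<Rightarrow> real ^ 'n \<Rightarrow> real" where
  "riesz_kernel \<alpha> x = norm x powr (\<alpha> - real CARD('n))"

text \<open>\<open>K\<^sub>\<alpha> * f\<close> for \<open>f \<ge> 0\<close>, with values in \<open>[0, \<infinity>]\<close>.\<close>

definition riesz_conv :: "real \<Rightarrow> (real ^ 'n \<Rightarrow> real) \<Rightarrow> real ^ 'n \<Rightarrow> ennreal" where
  "riesz_conv \<alpha> f x = (\<integral>\<^sup>+y. ennreal (riesz_kernel \<alpha> (x - y) * f y) \<partial>lborel)"

text \<open>
  The finiteness clause says that the right-hand integral converges absolutely; in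
  particular the convolution is finite almost everywhere on the set where \<open>u v \<noteq> 0\<close>, so passing to
  \<open>enn2real\<close> loses nothing. At zeros of \<open>u\<close>, \<open>|u| powr (p - 2) * u\<close> is \<open>0\<close>, as it should be since \<open>p > 1\<close>.
\<close>

definition weak_solution ::
    "real \<Rightarrow> real \<Rightarrow> real \<Rightarrow> real \<Rightarrow> (real ^ 'n \<Rightarrow> real) \<Rightarrow> bool" where
  "weak_solution s \<alpha> \<omega> p u \<longleftrightarrow> u \<in> sobolev_H s \<and>
     (\<forall>v \<in> sobolev_H s.
        (\<integral>\<^sup>+x. riesz_conv \<alpha> (\<lambda>y. \<bar>u y\<bar> powr p) x *
            ennreal \<bar>\<bar>u x\<bar> powr (p - 2) * u x * v x\<bar> \<partial>lborel) < \<infinity> \<and>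
        (\<integral>x. frac_laplacian (s / 2) u x * frac_laplacian (s / 2) v x \<partial>lborel)
          + \<omega> * (\<integral>x. u x * v x \<partial>lborel)
        = (\<integral>x. enn2real (riesz_conv \<alpha> (\<lambda>y. \<bar>u y\<bar> powr p) x) *
            (\<bar>u x\<bar> powr (p - 2) * u x * v x) \<partial>lborel))"

definition C2 :: "(real ^ 'n \<Rightarrow> real) \<Rightarrow> bool" where
  "C2 u \<longleftrightarrow>
     (\<exists>(D :: real ^ 'n \<Rightarrow> (real ^ 'n) \<Rightarrow>\<^sub>L real)
        (H :: real ^ 'n \<Rightarrow> (real ^ 'n) \<Rightarrow>\<^sub>L ((real ^ 'n) \<Rightarrow>\<^sub>L real)).
        (\<forall>x. (u has_derivative blinfun_apply (D x)) (at x)) \<and>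
        (\<forall>x. (D has_derivative blinfun_apply (H x)) (at x)) \<and>
        continuous_on UNIV H)"

end

(*
  Testing the equation with v = X . grad u, where X is a compactly supported C^1 truncation of the
  identity vector field, and removing the truncation gives the Pohozaev identity
    (N - 2s) A + N omega B = (N + alpha) / p * D,
  where A is the squared L2 norm of (-Delta)^(s/2) u, B that of u, and D the double integral on the right.
  Testing with v = u gives A + omega B = D.  Outside the range 1 + alpha/N < p < (N + alpha)/(N - 2s) the
  two identities contradict A > 0 and B > 0.

  No regularity beyond C^2 is needed: such v are Lipschitz with compact support, hence lie in H^s, and by
  Plancherel's theorem the fractional Dirichlet form is a multiple of the Gagliardo double integral of
  (u x - u y)(v x - v y) / |x - y|^(N + 2s).  This term and the Choquard term then have the same shape, a
  double integral of X-derivatives of a symmetric function F x y against a power of |x - y|, and are treated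
  by one integration by parts.
*)
theory Submission
  imports Defs "HOL-Probability.Characteristic_Functions"
begin

section \<open>Affine and orthogonal changes of variables\<close>

text \<open>The obstacle is that membership of \<open>u\<close> in \<open>sobolev_H s\<close> gives
  no integrability of the gradient at infinity, so whatever survives R -> infinity must be
  controlled by \<open>u\<close> alone. Three majorants are available: u^2; (u x - u y)^2 / |x -
  y|^(N + 2s), integrable since u is in H^s; and |u x|^p |u y|^p / |x - y|^(N - \<alpha>),
  integrable by the finiteness clause with v = u. Integration by parts moves the derivative from u
  to X and to the kernel. The gradient of the kernel is one order more singular, but after
  symmetrisation it is paired with X x - X y, whose norm is at most 5 |x - y|, uniformly in the
  truncation radius R. Hence both limits, removing the regularisation of the kernel and R ->
  infinity, are dominated convergence with a constant multiple of these majorants. For a kernel |x -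
  y|^(-a) the two divergences contribute 2N in the limit and the kernel contributes -a. The number
  2N - a is N - 2s for a = N + 2s and N + \<alpha> for a = N - \<alpha>; the divisor p comes from
  differentiating |u|^p.\<close>

lemma nn_integral_lborel_affine:
  fixes f :: "'a::euclidean_space \<Rightarrow> ennreal" and t :: 'a
  assumes [measurable]: "f \<in> borel_measurable borel" and c: "c \<noteq> 0"
  shows "(\<integral>\<^sup>+x. f x \<partial>lborel) = ennreal (\<bar>c\<bar> ^ DIM('a)) * (\<integral>\<^sup>+x. f (t + c *\<^sub>R x) \<partial>lborel)"
  by (subst lborel_affine[OF c, of t])
     (simp add: nn_integral_density nn_integral_distr nn_integral_cmult)

lemma nn_integral_lborel_shift:
  fixes f :: "'a::euclidean_space \<Rightarrow> ennreal" and t :: 'a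
  assumes "f \<in> borel_measurable borel"
  shows "(\<integral>\<^sup>+x. f (t + x) \<partial>lborel) = (\<integral>\<^sup>+x. f x \<partial>lborel)"
  using nn_integral_lborel_affine[OF assms, of 1 t] by simp

lemma nn_integral_lborel_reflect:
  fixes f :: "'a::euclidean_space \<Rightarrow> ennreal" and t :: 'a
  assumes "f \<in> borel_measurable borel"
  shows "(\<integral>\<^sup>+x. f (t - x) \<partial>lborel) = (\<integral>\<^sup>+x. f x \<partial>lborel)"
  using nn_integral_lborel_affine[OF assms, of "-1" t] by simp

lemma lborel_integrable_affine:
  fixes f :: "'a::euclidean_space \<Rightarrow> 'b :: {banach, second_countable_topology}"
  assumes f: "integrable lborel f" and c: "c \<noteq> 0"
  shows "integrable lborel (\<lambda>x. f (t + c *\<^sub>R x))"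
proof -
  have [measurable]: "f \<in> borel_measurable borel" using f by (auto dest: borel_measurable_integrable)
  have "(\<integral>\<^sup>+x. norm (f x) \<partial>lborel) < \<infinity>" using f by (simp add: integrable_iff_bounded)
  then have "(\<integral>\<^sup>+x. norm (f (t + c *\<^sub>R x)) \<partial>lborel) < \<infinity>"
    using c by (subst (asm) nn_integral_lborel_affine[OF _ c, of _ t]) (auto simp: ennreal_mult_less_top)
  then show ?thesis by (simp add: integrable_iff_bounded)
qed

lemma lborel_integrable_affine_iff:
  fixes f :: "'a::euclidean_space \<Rightarrow> 'b :: {banach, second_countable_topology}"
  assumes c: "c \<noteq> 0"
  shows "integrable lborel (\<lambda>x. f (t + c *\<^sub>R x)) \<longleftrightarrow> integrable lborel f"
proof
  assume "integrable lborel (\<lambda>x. f (t + c *\<^sub>R x))"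
  from lborel_integrable_affine[OF this, of "1/c" "- (t /\<^sub>R c)"] show "integrable lborel f"
    using c by (simp add: scaleR_right_distrib scaleR_right_diff_distrib field_simps)
qed (use lborel_integrable_affine c in blast)

lemma lborel_integral_affine:
  fixes f :: "'a::euclidean_space \<Rightarrow> 'b :: {banach, second_countable_topology}"
  assumes c: "c \<noteq> 0"
  shows "(\<integral>x. f x \<partial>lborel) = \<bar>c\<bar> ^ DIM('a) *\<^sub>R (\<integral>x. f (t + c *\<^sub>R x) \<partial>lborel)"
proof cases
  assume f[measurable]: "integrable lborel f"
  then have [measurable]: "f \<in> borel_measurable borel" by (auto dest: borel_measurable_integrable)
  show ?thesis
    using c f lborel_integrable_affine[OF f c, of t]
    by (subst lborel_affine[OF c, of t]) (simp add: integral_density integral_distr)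
next
  assume "\<not> integrable lborel f"
  then show ?thesis
    using lborel_integrable_affine_iff[OF c, of f t] by (simp add: not_integrable_integral_eq)
qed

lemma lborel_integrable_shift_iff:
  fixes f :: "'a::euclidean_space \<Rightarrow> 'b :: {banach, second_countable_topology}"
  shows "integrable lborel (\<lambda>x. f (t + x)) \<longleftrightarrow> integrable lborel f"
  using lborel_integrable_affine_iff[of 1 f t] by simp

lemma lborel_integral_shift:
  fixes f :: "'a::euclidean_space \<Rightarrow> 'b :: {banach, second_countable_topology}"
  shows "(\<integral>x. f (t + x) \<partial>lborel) = (\<integral>x. f x \<partial>lborel)"
  using lborel_integral_affine[of 1 f t] by simp

lemma lborel_integral_reflect:
  fixes f :: "'a::euclidean_space \<Rightarrow> 'b :: {banach, second_countable_topology}"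
  shows "(\<integral>x. f (t - x) \<partial>lborel) = (\<integral>x. f x \<partial>lborel)"
  using lborel_integral_affine[of "-1" f t] by simp

text \<open>
  The image of Lebesgue measure under \<open>T\<close> is translation invariant. By Fubini's theorem two such measures
  are proportional, and these two agree on the unit ball. (The change-of-variables theorems of the library
  need a well-ordered index type.)
\<close>

lemma nn_integral_lborel_orthogonal:
  fixes T :: "'a::euclidean_space \<Rightarrow> 'a"
  assumes T: "orthogonal_transformation T" and [measurable]: "f \<in> borel_measurable borel"
  shows "(\<integral>\<^sup>+x. f (T x) \<partial>lborel) = (\<integral>\<^sup>+x. f x \<partial>lborel)"
proof -
  have lin: "linear T" and nT: "\<And>x. norm (T x) = norm x"
    using T by (auto simp: orthogonal_transformation)
  have [measurable]: "T \<in> borel_measurable borel"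
    using lin by (intro borel_measurable_continuous_onI linear_continuous_on)
       (simp add: linear_conv_bounded_linear)
  have surj: "T (inv T x) = x" for x
    using orthogonal_transformation_surj[OF T] by (simp add: surj_f_inv_f)
  define g :: "'a \<Rightarrow> ennreal" where "g x = indicator (ball 0 1) x" for x
  have [measurable]: "g \<in> borel_measurable borel" unfolding g_def[abs_def] by (rule borel_measurable_indicator) simp
  have gT: "g (T y) = g y" for y by (simp add: g_def nT indicator_def)
  have V: "(\<integral>\<^sup>+x. g x \<partial>lborel) = emeasure lborel (ball (0::'a) 1)" unfolding g_def by simp
  have "(\<integral>\<^sup>+x. f x \<partial>lborel) * (\<integral>\<^sup>+y. g y \<partial>lborel) = (\<integral>\<^sup>+y. g (T y) * (\<integral>\<^sup>+x. f x \<partial>lborel) \<partial>lborel)"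
    by (simp add: gT nn_integral_multc mult.commute)
  also have "\<dots> = (\<integral>\<^sup>+y. (\<integral>\<^sup>+x. g (T y) * f (T y + x) \<partial>lborel) \<partial>lborel)"
    by (simp add: nn_integral_cmult nn_integral_lborel_shift)
  also have "\<dots> = (\<integral>\<^sup>+x. (\<integral>\<^sup>+y. g (T y) * f (T y + x) \<partial>lborel) \<partial>lborel)"
    by (rule lborel_pair.Fubini') measurable
  also have "\<dots> = (\<integral>\<^sup>+x. (\<integral>\<^sup>+y. g (T y - x) * f (T y) \<partial>lborel) \<partial>lborel)"
  proof (rule nn_integral_cong)
    fix x
    \<comment> \<open>Translating \<open>y\<close> by \<open>inv T x\<close> translates
      \<open>T y\<close> by \<open>x\<close>, because \<open>T\<close> is linear and onto.\<close>
    show "(\<integral>\<^sup>+y. g (T y) * f (T y + x) \<partial>lborel) = (\<integral>\<^sup>+y. g (T y - x) * f (T y) \<partial>lborel)"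
      using nn_integral_lborel_shift[of "\<lambda>y. g (T y - x) * f (T y)" "inv T x"]
      by (simp add: linear_add[OF lin] surj add.commute)
  qed
  also have "\<dots> = (\<integral>\<^sup>+y. (\<integral>\<^sup>+x. g (T y - x) * f (T y) \<partial>lborel) \<partial>lborel)"
    by (rule lborel_pair.Fubini') measurable
  also have "\<dots> = (\<integral>\<^sup>+y. f (T y) \<partial>lborel) * (\<integral>\<^sup>+y. g y \<partial>lborel)"
    by (simp add: nn_integral_multc nn_integral_cmult nn_integral_lborel_reflect mult.commute)
  finally have "emeasure lborel (ball (0::'a) 1) * (\<integral>\<^sup>+x. f (T x) \<partial>lborel)
      = emeasure lborel (ball (0::'a) 1) * (\<integral>\<^sup>+x. f x \<partial>lborel)"
    by (simp add: V mult.commute)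
  moreover have "emeasure lborel (ball (0::'a) 1) \<noteq> 0"
    using content_ball_pos[of 1 "0::'a"] by (auto simp: measure_def)
  moreover have "emeasure lborel (ball (0::'a) 1) \<noteq> top"
    using emeasure_lborel_ball_finite[of "0::'a" 1] by simp
  ultimately show ?thesis by (simp add: ennreal_mult_cancel_left)
qed

section \<open>The Gaussian\<close>

text \<open>The standard normal density. Its value at 0 is also the normalising constant of
  \<open>fourier_integral\<close>, which makes the constants cancel in
  \<open>fourier_integral_gauss_weight\<close>.\<close>

definition gauss :: "'a::euclidean_space \<Rightarrow> real" where
  "gauss x = (2 * pi) powr (- real DIM('a) / 2) * exp (- (norm x)\<^sup>2 / 2)"

lemma sum_inner_power2: "(\<Sum>b\<in>Basis. (x \<bullet> b)\<^sup>2) = (norm (x::'a::euclidean_space))\<^sup>2"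
  unfolding power2_norm_eq_inner by (subst euclidean_inner[of x x]) (simp add: power2_eq_square)

lemma gauss_prod: "gauss (x::'a::euclidean_space) = (\<Prod>b\<in>Basis. std_normal_density (x \<bullet> b))"
proof -
  have "(\<Prod>b\<in>Basis. std_normal_density (x \<bullet> b)) = (1 / sqrt (2 * pi)) ^ DIM('a) * exp (\<Sum>b\<in>Basis. - (x \<bullet> b)\<^sup>2 / 2)"
    by (simp add: std_normal_density_def exp_sum prod_dividef power_divide)
  also have "(\<Sum>b\<in>Basis. - (x \<bullet> b)\<^sup>2 / 2) = - (norm x)\<^sup>2 / 2"
    by (simp add: sum_negf sum_divide_distrib[symmetric] sum_inner_power2)
  also have "(1 / sqrt (2 * pi)) ^ DIM('a) = (2 * pi) powr (- real DIM('a) / 2)"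
  proof -
    have "1 / sqrt (2 * pi) = (2 * pi) powr (- (1 / 2))"
      using powr_minus_divide[of "2 * pi" "1 / 2"] powr_half_sqrt[of "2 * pi"] by simp
    then show ?thesis by (simp add: powr_power)
  qed
  finally show ?thesis by (simp add: gauss_def)
qed

lemma
  fixes f :: "'a::euclidean_space \<Rightarrow> real \<Rightarrow> 'b::{real_normed_field,banach,second_countable_topology}"
  assumes int: "\<And>b. b \<in> Basis \<Longrightarrow> integrable lborel (f b)"
  shows lborel_integrable_prod: "integrable lborel (\<lambda>x. \<Prod>b\<in>Basis. f b (x \<bullet> b))"
    and lborel_integral_prod: "(\<integral>x. (\<Prod>b\<in>Basis. f b (x \<bullet> b)) \<partial>lborel) = (\<Prod>b\<in>Basis. \<integral>x. f b x \<partial>lborel)"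
proof -
  interpret product_sigma_finite "\<lambda>_::'a. lborel :: real measure" ..
  have [measurable]: "\<And>b. b \<in> Basis \<Longrightarrow> f b \<in> borel_measurable borel"
    using int by (auto dest: borel_measurable_integrable)
  have eq: "(\<lambda>g. \<Prod>b\<in>Basis. f b ((\<Sum>c\<in>Basis. g c *\<^sub>R c) \<bullet> b)) = (\<lambda>g. \<Prod>b\<in>Basis. f b (g b))"
    by (intro ext prod.cong) auto
  show "integrable lborel (\<lambda>x. \<Prod>b\<in>Basis. f b (x \<bullet> b))"
    by (subst lborel_eq, subst integrable_distr_eq) (simp_all add: eq product_integrable_prod int)
  show "(\<integral>x. (\<Prod>b\<in>Basis. f b (x \<bullet> b)) \<partial>lborel) = (\<Prod>b\<in>Basis. \<integral>x. f b x \<partial>lborel)"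
    by (subst lborel_eq, subst integral_distr) (simp_all add: eq product_integral_prod int)
qed

lemma integrable_gauss: "integrable lborel (gauss :: 'a::euclidean_space \<Rightarrow> real)"
  using lborel_integrable_prod[of "\<lambda>_::'a. std_normal_density"] integrable_normal_density[of 1 0]
  by (simp add: gauss_prod[abs_def])

lemma integral_gauss: "(\<integral>x. gauss x \<partial>(lborel :: 'a::euclidean_space measure)) = 1"
  using lborel_integral_prod[of "\<lambda>_::'a. std_normal_density"] integral_normal_density[of 1 0] integrable_normal_density[of 1 0]
  by (simp add: gauss_prod[abs_def])

lemma gauss_nonneg: "0 \<le> gauss x" by (simp add: gauss_def)

lemma borel_measurable_gauss[measurable]: "gauss \<in> borel_measurable borel"
  unfolding gauss_def by measurable

lemma borel_measurable_cis[measurable]: "cis \<in> borel_measurable borel"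
  by (intro borel_measurable_continuous_onI continuous_intros)

lemma cis_sum: "cis (\<Sum>b\<in>B. f b) = (\<Prod>b\<in>B. cis (f b))"
  by (induction B rule: infinite_finite_induct) (auto simp: cis_mult[symmetric])

text \<open>Both factors split over the coordinates, so this is a product of values of the
  characteristic function of the one-dimensional standard normal distribution.\<close>

lemma integral_cis_gauss:
  fixes w :: "'a::euclidean_space"
  shows "(\<integral>x. cis (w \<bullet> x) * of_real (gauss x) \<partial>lborel) = of_real (exp (- (norm w)\<^sup>2 / 2))"
proof -
  have int: "integrable lborel (\<lambda>x. cis (t * x) * of_real (std_normal_density x))" for t :: real
    by (rule Bochner_Integration.integrable_bound[OF integrable_normal_density[of 1 0]])
       (simp_all add: norm_mult normal_density_nonneg)
  have char: "(\<integral>x. cis (t * x) * of_real (std_normal_density x) \<partial>lborel) = of_real (exp (- t\<^sup>2 / 2))" for t :: real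
  proof -
    have "char std_normal_distribution t = (\<integral>x. cis (t * x) * of_real (std_normal_density x) \<partial>lborel)"
      unfolding char_def
      by (subst integral_density) (auto simp: normal_density_nonneg scaleR_conv_of_real mult.commute cis_conv_exp)
    then show ?thesis by (simp add: char_std_normal_distribution)
  qed
  have "(\<integral>x. cis (w \<bullet> x) * of_real (gauss x) \<partial>lborel)
     = (\<integral>x. (\<Prod>b\<in>Basis. cis ((w \<bullet> b) * (x \<bullet> b)) * of_real (std_normal_density (x \<bullet> b))) \<partial>lborel)"
    by (subst euclidean_inner) (simp add: cis_sum gauss_prod prod.distrib)
  also have "\<dots> = (\<Prod>b\<in>Basis. of_real (exp (- (w \<bullet> b)\<^sup>2 / 2)))"
    by (subst lborel_integral_prod[OF int]) (simp add: char)
  also have "\<dots> = of_real (exp (\<Sum>b\<in>Basis. - (w \<bullet> b)\<^sup>2 / 2))"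
    by (simp add: exp_sum)
  also have "(\<Sum>b\<in>Basis. - (w \<bullet> b)\<^sup>2 / 2) = - (norm w)\<^sup>2 / 2"
    by (simp add: sum_negf sum_divide_distrib[symmetric] sum_inner_power2)
  finally show ?thesis .
qed

section \<open>Limits and translations in \<open>L\<^sup>2\<close>\<close>

text \<open>Young's inequality with a free weight. As \<open>\<eta>\<close> tends to 0 the first
  factor tends to 1, so limits preserve norms exactly and not just up to a constant;
  \<open>\<eta> = 1\<close> gives the usual factor 2.\<close>

lemma norm_power2_le_add:
  fixes a b :: "'a::real_normed_vector"
  assumes "\<eta> > 0"
  shows "(norm a)\<^sup>2 \<le> (1 + \<eta>) * (norm b)\<^sup>2 + (1 + 1 / \<eta>) * (norm (a - b))\<^sup>2"
proof -
  have "norm a \<le> norm b + norm (a - b)" by (metis norm_triangle_sub)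
  then have "(norm a)\<^sup>2 \<le> (norm b + norm (a - b))\<^sup>2" by (intro power_mono) auto
  also have "\<dots> \<le> (1 + \<eta>) * (norm b)\<^sup>2 + (1 + 1 / \<eta>) * (norm (a - b))\<^sup>2"
  proof -
    have "0 \<le> (\<eta> * norm b - norm (a - b))\<^sup>2 / \<eta>" using assms by simp
    also have "\<dots> = \<eta> * (norm b)\<^sup>2 - 2 * norm b * norm (a - b) + (norm (a - b))\<^sup>2 / \<eta>"
      using assms by (simp add: power2_diff field_simps power2_eq_square)
    finally show ?thesis by (simp add: power2_sum algebra_simps)
  qed
  finally show ?thesis .
qed

abbreviation sq_integral :: "'a measure \<Rightarrow> ('a \<Rightarrow> 'b::real_normed_vector) \<Rightarrow> ennreal" where
  "sq_integral M f \<equiv> \<integral>\<^sup>+x. ennreal ((norm (f x))\<^sup>2) \<partial>M"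

lemma nn_integral_norm_power2_le:
  fixes f g :: "'a \<Rightarrow> 'b::{real_normed_vector, second_countable_topology}"
  assumes [measurable]: "f \<in> borel_measurable M" "g \<in> borel_measurable M" and "\<eta> > 0"
  shows "(sq_integral M f) \<le> ennreal (1 + \<eta>) * (sq_integral M g)
     + ennreal (1 + 1 / \<eta>) * (sq_integral M (\<lambda>x. f x - g x))"
proof -
  have "(sq_integral M f) \<le> (\<integral>\<^sup>+x. ennreal (1 + \<eta>) * (norm (g x))\<^sup>2 + ennreal (1 + 1 / \<eta>) * (norm (f x - g x))\<^sup>2 \<partial>M)"
    using assms(3) norm_power2_le_add[OF assms(3)]
    by (intro nn_integral_mono) (simp add: ennreal_mult[symmetric] ennreal_plus[symmetric] del: ennreal_plus)
  also have "\<dots> = ennreal (1 + \<eta>) * (sq_integral M g)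
     + ennreal (1 + 1 / \<eta>) * (sq_integral M (\<lambda>x. f x - g x))"
    by (subst nn_integral_add) (simp_all add: nn_integral_cmult)
  finally show ?thesis .
qed

lemma nn_integral_norm_diff_power2_le:
  fixes f g :: "'a \<Rightarrow> 'b::{real_normed_vector, second_countable_topology}"
  assumes [measurable]: "f \<in> borel_measurable M" "g \<in> borel_measurable M"
  shows "(sq_integral M (\<lambda>x. f x - g x)) \<le> 2 * (sq_integral M f) + 2 * (sq_integral M g)"
  using nn_integral_norm_power2_le[of "\<lambda>x. f x - g x" M f 1] by simp

text \<open>Applying the weighted inequality on both sides and letting n tend to infinity yields the
  factor (1 + \<open>\<eta>\<close>)^2; afterwards \<open>\<eta>\<close> tends to 0. Extended
  integrals over two unrelated spaces spare all finiteness checks when a function is compared with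
  its transform.\<close>

lemma nn_integral_power2_limit_le:
  fixes F :: "'a \<Rightarrow> 'b::{real_normed_vector, second_countable_topology}"
    and G :: "'c \<Rightarrow> 'd::{real_normed_vector, second_countable_topology}"
  assumes [measurable]: "F \<in> borel_measurable M" "\<And>n. Fn n \<in> borel_measurable M"
    "G \<in> borel_measurable N" "\<And>n. Gn n \<in> borel_measurable N"
  assumes F: "(\<lambda>n. sq_integral M (\<lambda>x. Fn n x - F x)) \<longlonglongrightarrow> 0"
    and G: "(\<lambda>n. sq_integral N (\<lambda>x. Gn n x - G x)) \<longlonglongrightarrow> 0"
    and eq: "\<And>n. (sq_integral M (\<lambda>x. Fn n x)) \<le> (sq_integral N (\<lambda>x. Gn n x))"
  shows "(sq_integral M F) \<le> (sq_integral N G)"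
proof (cases "(sq_integral N G) = \<infinity>")
  case False
  define A B where "A = (sq_integral M F)" and "B = (sq_integral N G)"
  define E E' where "E n = (sq_integral M (\<lambda>x. Fn n x - F x))"
    and "E' n = (sq_integral N (\<lambda>x. Gn n x - G x))" for n
  have *: "A \<le> ennreal (1 + \<eta>) * (ennreal (1 + \<eta>) * B)" if "\<eta> > 0" for \<eta>
  proof (rule LIMSEQ_le_const)
    show "(\<lambda>n. ennreal (1 + \<eta>) * (ennreal (1 + \<eta>) * B + ennreal (1 + 1 / \<eta>) * E' n) + ennreal (1 + 1 / \<eta>) * E n)
        \<longlonglongrightarrow> ennreal (1 + \<eta>) * (ennreal (1 + \<eta>) * B)"
    proof -
      have "(\<lambda>n. ennreal (1 + \<eta>) * (ennreal (1 + \<eta>) * B + ennreal (1 + 1 / \<eta>) * E' n) + ennreal (1 + 1 / \<eta>) * E n)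
        \<longlonglongrightarrow> ennreal (1 + \<eta>) * (ennreal (1 + \<eta>) * B + ennreal (1 + 1 / \<eta>) * 0) + ennreal (1 + 1 / \<eta>) * 0"
        using F G unfolding E_def E'_def by (intro tendsto_intros ennreal_tendsto_cmult) auto
      then show ?thesis by simp
    qed
    have "A \<le> ennreal (1 + \<eta>) * (ennreal (1 + \<eta>) * B + ennreal (1 + 1 / \<eta>) * E' n) + ennreal (1 + 1 / \<eta>) * E n" for n
    proof -
      have "A \<le> ennreal (1 + \<eta>) * (sq_integral M (\<lambda>x. Fn n x)) + ennreal (1 + 1 / \<eta>) * E n"
        unfolding A_def E_def norm_minus_commute[of "Fn n _"] using that by (intro nn_integral_norm_power2_le) auto
      also have "(sq_integral M (\<lambda>x. Fn n x)) \<le> (sq_integral N (\<lambda>x. Gn n x))" by (rule eq)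
      also have "\<dots> \<le> ennreal (1 + \<eta>) * B + ennreal (1 + 1 / \<eta>) * E' n"
        unfolding B_def E'_def using that by (intro nn_integral_norm_power2_le) auto
      finally show ?thesis by (simp add: add_right_mono mult_left_mono)
    qed
    then show "\<exists>N. \<forall>n\<ge>N. A \<le> ennreal (1 + \<eta>) * (ennreal (1 + \<eta>) * B + ennreal (1 + 1 / \<eta>) * E' n) + ennreal (1 + 1 / \<eta>) * E n"
      by blast
  qed
  obtain b where b: "B = ennreal b" "b \<ge> 0" using False unfolding B_def[symmetric] by (cases B) auto
  have "(\<lambda>n. ennreal ((1 + 1 / real (Suc n)) * ((1 + 1 / real (Suc n)) * b))) \<longlonglongrightarrow> ennreal ((1 + 0) * ((1 + 0) * b))"
    by (intro tendsto_intros tendsto_ennrealI LIMSEQ_Suc lim_1_over_n)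
  moreover have "A \<le> ennreal ((1 + 1 / real (Suc n)) * ((1 + 1 / real (Suc n)) * b))" for n
    using *[of "1 / real (Suc n)"] b by (simp add: ennreal_mult[symmetric] del: ennreal_plus of_nat_Suc)
  ultimately have "A \<le> ennreal ((1 + 0) * ((1 + 0) * b))"
    by (intro LIMSEQ_le_const) auto
  then show ?thesis using b unfolding A_def B_def by simp
qed simp

lemma nn_integral_power2_limit_eq:
  fixes F :: "'a \<Rightarrow> 'b::{real_normed_vector, second_countable_topology}"
    and G :: "'c \<Rightarrow> 'd::{real_normed_vector, second_countable_topology}"
  assumes "F \<in> borel_measurable M" "\<And>n. Fn n \<in> borel_measurable M"
    "G \<in> borel_measurable N" "\<And>n. Gn n \<in> borel_measurable N"
    "(\<lambda>n. sq_integral M (\<lambda>x. Fn n x - F x)) \<longlonglongrightarrow> 0"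
    "(\<lambda>n. sq_integral N (\<lambda>x. Gn n x - G x)) \<longlonglongrightarrow> 0"
    "\<And>n. (sq_integral M (\<lambda>x. Fn n x)) = (sq_integral N (\<lambda>x. Gn n x))"
  shows "(sq_integral M F) = (sq_integral N G)"
proof (rule antisym)
  show "(sq_integral M F) \<le> (sq_integral N G)"
    by (rule nn_integral_power2_limit_le[of F M Fn G N Gn]) (use assms in auto)
  show "(sq_integral N G) \<le> (sq_integral M F)"
    by (rule nn_integral_power2_limit_le[of G N Gn F M Fn]) (use assms in auto)
qed

lemma nn_integral_dominated_tendsto_0:
  fixes f :: "nat \<Rightarrow> 'a \<Rightarrow> real"
  assumes [measurable]: "\<And>n. f n \<in> borel_measurable M"
    and w: "integrable M w" and le: "\<And>n x. \<bar>f n x\<bar> \<le> w x" and lim: "AE x in M. (\<lambda>n. f n x) \<longlonglongrightarrow> 0"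
  shows "(\<lambda>n. \<integral>\<^sup>+x. f n x \<partial>M) \<longlonglongrightarrow> 0"
proof -
  have "(\<lambda>n. \<integral>\<^sup>+x. ennreal (f n x) \<partial>M) \<longlonglongrightarrow> (\<integral>\<^sup>+x. 0 \<partial>M)"
  proof (rule nn_integral_dominated_convergence)
    show "AE x in M. ennreal (f n x) \<le> ennreal (w x)" for n
      using le by (intro AE_I2 ennreal_leI) (meson abs_le_D1)
    show "(\<integral>\<^sup>+x. w x \<partial>M) < \<infinity>"
    proof -
      have "(\<integral>\<^sup>+x. w x \<partial>M) \<le> (\<integral>\<^sup>+x. norm (w x) \<partial>M)" by (intro nn_integral_mono ennreal_leI) auto
      also have "\<dots> < \<infinity>" using w by (simp add: integrable_iff_bounded)
      finally show ?thesis .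
    qed
    show "AE x in M. (\<lambda>n. ennreal (f n x)) \<longlonglongrightarrow> 0"
      using lim by eventually_elim (metis tendsto_ennrealI ennreal_0)
    show "(\<lambda>x. ennreal (w x)) \<in> borel_measurable M" using w by (auto dest: borel_measurable_integrable)
  qed auto
  then show ?thesis by simp
qed

section \<open>Density of continuous functions with compact support\<close>

definition clip :: "real \<Rightarrow> real \<Rightarrow> real" where "clip k t = max (- k) (min k t)"

lemma clip_le: "k \<ge> 0 \<Longrightarrow> \<bar>clip k t\<bar> \<le> k" "k \<ge> 0 \<Longrightarrow> \<bar>clip k t\<bar> \<le> \<bar>t\<bar>"
  by (auto simp: clip_def)

lemma clip_eq: "\<bar>t\<bar> \<le> k \<Longrightarrow> clip k t = t"
  by (auto simp: clip_def)

lemma continuous_on_clip[continuous_intros]: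
  "continuous_on S f \<Longrightarrow> continuous_on S (\<lambda>x. clip k (f x))"
  unfolding clip_def by (intro continuous_intros)

lemma borel_measurable_clip[measurable]: "clip k \<in> borel_measurable borel"
  unfolding clip_def by measurable

definition bump :: "real \<Rightarrow> 'a::real_normed_vector \<Rightarrow> real" where
  "bump k x = max 0 (min 1 (k + 1 - norm x))"

lemma bump_bounds: "0 \<le> bump k x" "bump k x \<le> 1" by (auto simp: bump_def)

lemma bump_eq: "norm x \<le> k \<Longrightarrow> bump k x = 1" "norm x \<ge> k + 1 \<Longrightarrow> bump k x = 0"
  by (auto simp: bump_def)

lemma continuous_on_bump[continuous_intros]: "continuous_on S (bump k)"
  unfolding bump_def by (intro continuous_intros)

lemma borel_measurable_bump[measurable]: "(bump k :: 'a::euclidean_space \<Rightarrow> real) \<in> borel_measurable borel"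
  by (intro borel_measurable_continuous_onI continuous_intros)

lemma integrable_indicator_cball: "integrable lborel (indicator (cball c r) :: 'a::euclidean_space \<Rightarrow> real)"
  by (rule integrable_real_indicator) (use emeasure_lborel_cball_finite[of c r] in auto)

text \<open>The function is first truncated in height by \<open>clip\<close> and in space by
  \<open>bump\<close>. Continuous functions converging to it almost everywhere are truncated in the
  same way; they stay continuous and have a common integrable bound, so dominated convergence
  applies.\<close>

lemma L2_approx_continuous:
  fixes f :: "'a::euclidean_space \<Rightarrow> real"
  assumes [measurable]: "f \<in> borel_measurable borel" and f2: "integrable lborel (\<lambda>x. (f x)\<^sup>2)" and "e > 0"
  obtains h r C where "continuous_on UNIV h" "\<And>x. norm x \<ge> r \<Longrightarrow> h x = 0" "\<And>x. \<bar>h x\<bar> \<le> C"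
    "(sq_integral lborel (\<lambda>x. h x - f x)) < ennreal e"
proof -
  define fk where "fk k x = clip (real k) (f x) * bump (real k) x" for k x
  have [measurable]: "fk k \<in> borel_measurable borel" for k unfolding fk_def by measurable
  have "(\<lambda>k. sq_integral lborel (\<lambda>x. fk k x - f x)) \<longlonglongrightarrow> 0"
  proof (rule nn_integral_dominated_tendsto_0[where w = "\<lambda>x. 4 * (f x)\<^sup>2"])
    fix k x
    have "\<bar>fk k x\<bar> \<le> \<bar>f x\<bar> * 1"
      unfolding fk_def abs_mult using bump_bounds[of "real k" x] by (intro mult_mono clip_le) auto
    then have "(norm (fk k x - f x))\<^sup>2 \<le> (2 * \<bar>f x\<bar>)\<^sup>2" by (intro power_mono) auto
    then show "\<bar>(norm (fk k x - f x))\<^sup>2\<bar> \<le> 4 * (f x)\<^sup>2" by (simp add: power2_eq_square)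
  next
    show "AE x in lborel. (\<lambda>k. (norm (fk k x - f x))\<^sup>2) \<longlonglongrightarrow> 0"
    proof (intro AE_I2)
      fix x
      obtain n :: nat where n: "real n \<ge> max \<bar>f x\<bar> (norm x)" using real_arch_simple by blast
      have "fk k x = f x" if "k \<ge> n" for k
        using n that of_nat_mono[OF that, where 'a = real] by (simp add: fk_def clip_eq bump_eq)
      then have "eventually (\<lambda>k. (norm (fk k x - f x))\<^sup>2 = 0) sequentially"
        by (auto intro!: eventually_sequentiallyI[of n])
      then show "(\<lambda>k. (norm (fk k x - f x))\<^sup>2) \<longlonglongrightarrow> 0" by (rule tendsto_eventually)
    qed
  qed (use f2 in auto)
  \<comment> \<open>Each of the two errors is doubled by
    \<open>nn_integral_norm_diff_power2_le\<close>; with e/8 for both the total is e/2.\<close>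
  then have "eventually (\<lambda>k. (sq_integral lborel (\<lambda>x. fk k x - f x)) < ennreal (e / 8)) sequentially"
    using \<open>e > 0\<close> by (intro order_tendstoD(2)) auto
  then obtain k where k: "(sq_integral lborel (\<lambda>x. fk k x - f x)) < ennreal (e / 8)"
    by (auto simp: eventually_sequentially)
  \<comment> \<open>Continuity enters here: a Lebesgue measurable function is an almost everywhere
    limit of continuous ones.\<close>
  have "f \<in> borel_measurable lebesgue" by (simp add: measurable_completion)
  from lebesgue_measurable_imp_measurable_on[OF this, of UNIV]
  obtain N g where N: "negligible N" and g: "\<And>n. continuous_on UNIV (g n)"
    and lim: "\<And>x. x \<notin> N \<Longrightarrow> (\<lambda>n. g n x) \<longlonglongrightarrow> f x"
    by (auto simp: measurable_on_def)
  define h where "h n x = clip (real k) (g n x) * bump (real k) x" for n x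
  have conth: "continuous_on UNIV (h n)" for n
    unfolding h_def by (intro continuous_intros g)
  then have [measurable]: "h n \<in> borel_measurable borel" for n by (rule borel_measurable_continuous_onI)
  have bh: "\<bar>h n x\<bar> \<le> real k * indicator (cball 0 (real k + 1)) x" for n x
  proof (cases "norm x \<le> real k + 1")
    case True
    have "\<bar>h n x\<bar> \<le> real k * 1"
      unfolding h_def abs_mult using bump_bounds[of "real k" x] by (intro mult_mono clip_le) auto
    then show ?thesis using True by simp
  qed (simp add: h_def bump_eq)
  have bf: "\<bar>fk k x\<bar> \<le> real k * indicator (cball 0 (real k + 1)) x" for x
  proof (cases "norm x \<le> real k + 1")
    case True
    have "\<bar>fk k x\<bar> \<le> real k * 1"
      unfolding fk_def abs_mult using bump_bounds[of "real k" x] by (intro mult_mono clip_le) auto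
    then show ?thesis using True by simp
  qed (simp add: fk_def bump_eq)
  have "(\<lambda>n. sq_integral lborel (\<lambda>x. h n x - fk k x)) \<longlonglongrightarrow> 0"
  proof (rule nn_integral_dominated_tendsto_0[where w = "\<lambda>x. 4 * (real k)\<^sup>2 * indicator (cball 0 (real k + 1)) x"])
    show "integrable lborel (\<lambda>x::'a. 4 * (real k)\<^sup>2 * indicator (cball 0 (real k + 1)) x)"
      by (intro integrable_mult_right integrable_indicator_cball)
    fix n x
    have "norm (h n x - fk k x) \<le> 2 * real k * indicator (cball 0 (real k + 1)) x"
      using bh[of n x] bf[of x] by simp
    then have "(norm (h n x - fk k x))\<^sup>2 \<le> (2 * real k * indicator (cball 0 (real k + 1)) x)\<^sup>2" by (intro power_mono) auto
    also have "\<dots> = 4 * (real k)\<^sup>2 * indicator (cball 0 (real k + 1)) x"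
      by (auto simp: power2_eq_square indicator_def)
    finally show "\<bar>(norm (h n x - fk k x))\<^sup>2\<bar> \<le> 4 * (real k)\<^sup>2 * indicator (cball 0 (real k + 1)) x" by simp
  next
    show "AE x in lborel. (\<lambda>n. (norm (h n x - fk k x))\<^sup>2) \<longlonglongrightarrow> 0"
    proof -
      have "AE x in lebesgue. x \<notin> N" using N AE_not_in negligible_iff_null_sets by blast
      then have "AE x in lebesgue. (\<lambda>n. (norm (h n x - fk k x))\<^sup>2) \<longlonglongrightarrow> 0"
      proof eventually_elim
        case (elim x)
        have "(\<lambda>n. (norm (h n x - fk k x))\<^sup>2) \<longlonglongrightarrow> (norm (clip (real k) (f x) * bump (real k) x - fk k x))\<^sup>2"
          unfolding h_def clip_def by (intro tendsto_intros lim elim)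
        then show ?case by (simp add: fk_def)
      qed
      then show ?thesis by (simp add: AE_completion_iff)
    qed
  qed auto
  then have "eventually (\<lambda>n. (sq_integral lborel (\<lambda>x. h n x - fk k x)) < ennreal (e / 8)) sequentially"
    using \<open>e > 0\<close> by (intro order_tendstoD(2)) auto
  then obtain n where n: "(sq_integral lborel (\<lambda>x. h n x - fk k x)) < ennreal (e / 8)"
    by (auto simp: eventually_sequentially)
  have "(sq_integral lborel (\<lambda>x. h n x - f x))
     \<le> 2 * (sq_integral lborel (\<lambda>x. h n x - fk k x)) + 2 * (sq_integral lborel (\<lambda>x. f x - fk k x))"
    using nn_integral_norm_diff_power2_le[of "\<lambda>x. h n x - fk k x" lborel "\<lambda>x. f x - fk k x"] by simp
  also have "\<dots> \<le> 2 * ennreal (e / 8) + 2 * ennreal (e / 8)"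
    using n k by (intro add_mono mult_left_mono) (simp_all add: power2_commute less_imp_le)
  also have "\<dots> = ennreal (e / 2)"
    using \<open>e > 0\<close> by (simp add: ennreal_plus[symmetric] ennreal_numeral[symmetric] ennreal_mult[symmetric] del: ennreal_plus ennreal_numeral)
  also have "\<dots> < ennreal e" using \<open>e > 0\<close> by (intro ennreal_lessI) auto
  finally have "(sq_integral lborel (\<lambda>x. h n x - f x)) < ennreal e" .
  moreover have "h n x = 0" if "norm x \<ge> real k + 1" for x
    using that by (simp add: h_def bump_eq)
  moreover have "\<bar>h n x\<bar> \<le> real k" for x
    using bh[of n x] by (cases "norm x \<le> real k + 1") auto
  ultimately show ?thesis
    using that[of "h n" "real k + 1" "real k"] conth by blast
qed

lemma power2_sum3_le: "(a + b + c)\<^sup>2 \<le> 3 * a\<^sup>2 + 3 * b\<^sup>2 + 3 * (c::real)\<^sup>2"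
proof -
  have "0 \<le> (a - b)\<^sup>2 + (b - c)\<^sup>2 + (a - c)\<^sup>2" by simp
  then show ?thesis by (simp add: power2_eq_square algebra_simps)
qed

text \<open>For a continuous function with compact support this is dominated convergence. Replacing
  \<open>f\<close> by such a function costs the same error at \<open>x\<close> and at the translated
  point, since Lebesgue measure is translation invariant.\<close>

lemma L2_translation_continuous:
  fixes f :: "'a::euclidean_space \<Rightarrow> real"
  assumes [measurable]: "f \<in> borel_measurable borel" and f2: "integrable lborel (\<lambda>x. (f x)\<^sup>2)" and z: "z \<longlonglongrightarrow> 0"
  shows "(\<lambda>n. \<integral>\<^sup>+x. (f (z n + x) - f x)\<^sup>2 \<partial>lborel) \<longlonglongrightarrow> 0"
proof (rule order_tendstoI)
  fix a :: ennreal assume "0 < a"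
  then obtain r where r: "r > 0" "ennreal r \<le> a"
    by (cases a) (auto intro: that[of 1])
  \<comment> \<open>The three squared errors carry the factor 3: twice 3r/24 plus 3r/12 is
    r/2.\<close>
  obtain h R C where h: "continuous_on UNIV h" and h0: "\<And>x. norm x \<ge> R \<Longrightarrow> h x = 0" and C: "\<And>x. \<bar>h x\<bar> \<le> C"
    and hf: "(sq_integral lborel (\<lambda>x. h x - f x)) < ennreal (r / 24)"
    using L2_approx_continuous[OF assms(1) f2, of "r / 24"] r by auto
  have [measurable]: "h \<in> borel_measurable borel" by (rule borel_measurable_continuous_onI[OF h])
  \<comment> \<open>A bound on the translations confines all translates of \<open>h\<close> to one
    ball, which gives the majorant.\<close>
  obtain b where b: "\<And>n. norm (z n) \<le> b" using z convergent_imp_Bseq[of z] by (auto simp: convergent_def Bseq_def)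
  have "(\<lambda>n. \<integral>\<^sup>+x. ennreal ((h (z n + x) - h x)\<^sup>2) \<partial>lborel) \<longlonglongrightarrow> 0"
  proof (rule nn_integral_dominated_tendsto_0[where w = "\<lambda>x. (2 * C)\<^sup>2 * indicator (cball 0 (R + b)) x"])
    show "integrable lborel (\<lambda>x::'a. (2 * C)\<^sup>2 * indicator (cball 0 (R + b)) x)"
      by (intro integrable_mult_right integrable_indicator_cball)
    fix n x
    show "\<bar>(h (z n + x) - h x)\<^sup>2\<bar> \<le> (2 * C)\<^sup>2 * indicator (cball 0 (R + b)) x"
    proof (cases "norm x \<le> R + b")
      case True
      have "\<bar>h (z n + x) - h x\<bar> \<le> 2 * C" using C[of x] C[of "z n + x"] by linarith
      then have "\<bar>h (z n + x) - h x\<bar>\<^sup>2 \<le> (2 * C)\<^sup>2" by (intro power_mono) auto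
      then show ?thesis using True by simp
    next
      case False
      have "norm x \<le> norm (z n + x) + norm (z n)" using norm_triangle_ineq4[of "z n + x" "z n"] by simp
      then have "norm (z n + x) \<ge> R" using False b[of n] by linarith
      moreover have "norm x \<ge> R" using False b[of n] norm_ge_zero[of "z n"] by linarith
      ultimately show ?thesis using False by (simp add: h0)
    qed
  next
    show "AE x in lborel. (\<lambda>n. (h (z n + x) - h x)\<^sup>2) \<longlonglongrightarrow> 0"
    proof (intro AE_I2)
      fix x
      have "(\<lambda>n. z n + x) \<longlonglongrightarrow> 0 + x" by (intro tendsto_intros z)
      then have "(\<lambda>n. h (z n + x)) \<longlonglongrightarrow> h x"
        using h by (intro continuous_on_tendsto_compose[OF h]) auto
      then have "(\<lambda>n. (h (z n + x) - h x)\<^sup>2) \<longlonglongrightarrow> (h x - h x)\<^sup>2" by (intro tendsto_intros)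
      then show "(\<lambda>n. (h (z n + x) - h x)\<^sup>2) \<longlonglongrightarrow> 0" by simp
    qed
  qed auto
  then have "eventually (\<lambda>n. (\<integral>\<^sup>+x. ennreal ((h (z n + x) - h x)\<^sup>2) \<partial>lborel) < ennreal (r / 12)) sequentially"
    using r by (intro order_tendstoD(2)) auto
  then show "eventually (\<lambda>n. (\<integral>\<^sup>+x. ennreal ((f (z n + x) - f x)\<^sup>2) \<partial>lborel) < a) sequentially"
  proof eventually_elim
    case (elim n)
    have "(\<integral>\<^sup>+x. ennreal ((f (z n + x) - f x)\<^sup>2) \<partial>lborel)
       \<le> (\<integral>\<^sup>+x. ennreal (3 * (h (z n + x) - f (z n + x))\<^sup>2 + 3 * (h (z n + x) - h x)\<^sup>2 + 3 * (h x - f x)\<^sup>2) \<partial>lborel)"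
    proof (intro nn_integral_mono ennreal_leI)
      fix x
      show "(f (z n + x) - f x)\<^sup>2 \<le> 3 * (h (z n + x) - f (z n + x))\<^sup>2 + 3 * (h (z n + x) - h x)\<^sup>2 + 3 * (h x - f x)\<^sup>2"
        using power2_sum3_le[of "f (z n + x) - h (z n + x)" "h (z n + x) - h x" "h x - f x"]
        by (simp add: power2_commute)
    qed
    also have "\<dots> = 3 * (\<integral>\<^sup>+x. ennreal ((h (z n + x) - f (z n + x))\<^sup>2) \<partial>lborel)
        + 3 * (\<integral>\<^sup>+x. ennreal ((h (z n + x) - h x)\<^sup>2) \<partial>lborel) + 3 * (\<integral>\<^sup>+x. ennreal ((h x - f x)\<^sup>2) \<partial>lborel)"
      by (simp add: nn_integral_add nn_integral_cmult ennreal_mult)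
    also have "(\<integral>\<^sup>+x. ennreal ((h (z n + x) - f (z n + x))\<^sup>2) \<partial>lborel) = (\<integral>\<^sup>+x. ennreal ((h x - f x)\<^sup>2) \<partial>lborel)"
      by (rule nn_integral_lborel_shift) measurable
    also have "3 * (\<integral>\<^sup>+x. ennreal ((h x - f x)\<^sup>2) \<partial>lborel)
        + 3 * (\<integral>\<^sup>+x. ennreal ((h (z n + x) - h x)\<^sup>2) \<partial>lborel) + 3 * (\<integral>\<^sup>+x. ennreal ((h x - f x)\<^sup>2) \<partial>lborel)
       \<le> 3 * ennreal (r / 24) + 3 * ennreal (r / 12) + 3 * ennreal (r / 24)"
      using hf elim by (intro add_mono mult_left_mono) (simp_all add: less_imp_le)
    also have "\<dots> = ennreal (r / 2)"
      using r by (simp add: ennreal_plus[symmetric] ennreal_numeral[symmetric] ennreal_mult[symmetric] del: ennreal_plus ennreal_numeral)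
    also have "\<dots> < ennreal r" using r by (intro ennreal_lessI) auto
    finally show ?case using r by simp
  qed
qed auto

section \<open>Plancherel's theorem\<close>

abbreviation lborel2 :: "('a::euclidean_space \<times> 'b::euclidean_space) measure" where
  "lborel2 \<equiv> lborel \<Otimes>\<^sub>M lborel"

lemma lborel_pair_integrableI:
  fixes F :: "'a::euclidean_space \<Rightarrow> 'b::euclidean_space \<Rightarrow> 'c::{banach, second_countable_topology}"
  assumes [measurable]: "case_prod F \<in> borel_measurable lborel2"
    and "(\<integral>\<^sup>+x. \<integral>\<^sup>+y. norm (F x y) \<partial>lborel \<partial>lborel) < \<infinity>"
  shows "integrable lborel2 (case_prod F)"
  using assms(2) lborel.nn_integral_fst[of "\<lambda>(x, y). ennreal (norm (F x y))" lborel]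
  by (simp add: integrable_iff_bounded case_prod_unfold)

lemma lborel_pair_integrableI_swap:
  fixes F :: "'a::euclidean_space \<Rightarrow> 'b::euclidean_space \<Rightarrow> 'c::{banach, second_countable_topology}"
  assumes [measurable]: "case_prod F \<in> borel_measurable lborel2"
    and "(\<integral>\<^sup>+y. \<integral>\<^sup>+x. norm (F x y) \<partial>lborel \<partial>lborel) < \<infinity>"
  shows "integrable lborel2 (case_prod F)"
  using assms(2) lborel_pair.nn_integral_snd[of "\<lambda>(x, y). ennreal (norm (F x y))"]
  by (simp add: integrable_iff_bounded case_prod_unfold)

lemma borel_measurable_fourier_integral[measurable]:
  fixes f :: "real^'n \<Rightarrow> real"
  assumes [measurable]: "f \<in> borel_measurable borel"
  shows "fourier_integral f \<in> borel_measurable borel"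
proof -
  have "(\<lambda>\<xi>. \<integral>x. cis (- (x \<bullet> \<xi>)) * complex_of_real (f x) \<partial>lborel) \<in> borel_measurable lborel"
    by (rule lborel.borel_measurable_lebesgue_integral) measurable
  then show ?thesis unfolding fourier_integral_def[abs_def] by simp
qed

lemma integrable_cis_mult:
  fixes f :: "'a::euclidean_space \<Rightarrow> real"
  assumes "integrable lborel f" and [measurable]: "g \<in> borel_measurable borel"
  shows "integrable lborel (\<lambda>x. cis (g x) * complex_of_real (f x))"
  by (rule Bochner_Integration.integrable_bound[OF assms(1)])
     (use assms(1) in \<open>auto simp: norm_mult dest: borel_measurable_integrable\<close>)

lemma norm_fourier_integral_le:
  fixes f :: "real^'n \<Rightarrow> real"
  shows "norm (fourier_integral f \<xi>) \<le> (2 * pi) powr (- real CARD('n) / 2) * (\<integral>x. \<bar>f x\<bar> \<partial>lborel)"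
proof -
  have "norm (\<integral>x. cis (- (x \<bullet> \<xi>)) * complex_of_real (f x) \<partial>lborel) \<le> (\<integral>x. norm (cis (- (x \<bullet> \<xi>)) * complex_of_real (f x)) \<partial>lborel)"
    by (rule integral_norm_bound)
  then show ?thesis
    unfolding fourier_integral_def by (simp add: norm_mult)
qed

lemma integrable_autocorrelation:
  fixes f :: "'a::euclidean_space \<Rightarrow> real"
  assumes f: "integrable lborel f"
  shows "integrable lborel2 (\<lambda>(z, y). f (z + y) * f y)"
proof (rule lborel_pair_integrableI_swap)
  have [measurable]: "f \<in> borel_measurable borel" using f by (auto dest: borel_measurable_integrable)
  show "(\<lambda>(z, y). f (z + y) * f y) \<in> borel_measurable lborel2" by measurable
  have "(\<integral>\<^sup>+y. \<integral>\<^sup>+z. ennreal (norm (f (z + y) * f y)) \<partial>lborel \<partial>lborel)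
      = (\<integral>\<^sup>+y. ennreal \<bar>f y\<bar> * (\<integral>\<^sup>+z. ennreal \<bar>f (y + z)\<bar> \<partial>lborel) \<partial>lborel)"
    by (simp add: abs_mult ennreal_mult nn_integral_cmult mult.commute add.commute)
  also have "\<dots> = (\<integral>\<^sup>+y. ennreal \<bar>f y\<bar> * (\<integral>\<^sup>+z. ennreal \<bar>f z\<bar> \<partial>lborel) \<partial>lborel)"
    by (intro nn_integral_cong arg_cong2[where f = "(*)"] refl nn_integral_lborel_shift) measurable
  also have "\<dots> = (\<integral>\<^sup>+z. ennreal \<bar>f z\<bar> \<partial>lborel) * (\<integral>\<^sup>+z. ennreal \<bar>f z\<bar> \<partial>lborel)"
    by (rule nn_integral_multc) measurable
  also have "\<dots> < \<infinity>" using f by (simp add: integrable_iff_bounded ennreal_mult_less_top)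
  finally show "(\<integral>\<^sup>+y. \<integral>\<^sup>+z. ennreal (norm (f (z + y) * f y)) \<partial>lborel \<partial>lborel) < \<infinity>" .
qed

text \<open>With x = z + y the exponential splits into one factor in x and one in y. Fubini's
  theorem then turns the double integral into a product of the transform and its complex
  conjugate.\<close>

lemma fourier_integral_norm_power2:
  fixes f :: "real^'n \<Rightarrow> real"
  assumes f: "integrable lborel f"
  shows "complex_of_real ((norm (fourier_integral f \<xi>))\<^sup>2) = complex_of_real (((2 * pi) powr (- real CARD('n) / 2))\<^sup>2) *
     (\<integral>z. cis (- (z \<bullet> \<xi>)) * complex_of_real (\<integral>y. f (z + y) * f y \<partial>lborel) \<partial>lborel)"
proof -
  have [measurable]: "f \<in> borel_measurable borel" using f by (auto dest: borel_measurable_integrable)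
  define F where "F = (\<integral>x. cis (- (x \<bullet> \<xi>)) * complex_of_real (f x) \<partial>lborel)"
  have int: "integrable lborel2 (\<lambda>(z, y). cis (- (z \<bullet> \<xi>)) * complex_of_real (f (z + y) * f y))"
    by (rule Bochner_Integration.integrable_bound[OF integrable_autocorrelation[OF f]])
       (auto simp: norm_mult)
  have "(\<integral>z. cis (- (z \<bullet> \<xi>)) * complex_of_real (\<integral>y. f (z + y) * f y \<partial>lborel) \<partial>lborel)
      = (\<integral>z. \<integral>y. cis (- (z \<bullet> \<xi>)) * complex_of_real (f (z + y) * f y) \<partial>lborel \<partial>lborel)"
    by (simp flip: integral_complex_of_real)
  also have "\<dots> = (\<integral>y. \<integral>z. cis (- (z \<bullet> \<xi>)) * complex_of_real (f (z + y) * f y) \<partial>lborel \<partial>lborel)"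
    by (rule lborel_pair.Fubini_integral[OF int, symmetric])
  also have "\<dots> = (\<integral>y. cis (y \<bullet> \<xi>) * complex_of_real (f y) * F \<partial>lborel)"
  proof (rule Bochner_Integration.integral_cong[OF refl])
    fix y
    have "(\<integral>z. cis (- (z \<bullet> \<xi>)) * complex_of_real (f (z + y) * f y) \<partial>lborel)
       = (\<integral>x. cis (- ((- y + x) \<bullet> \<xi>)) * complex_of_real (f (- y + x + y) * f y) \<partial>lborel)"
      by (rule lborel_integral_shift[symmetric])
    also have "\<dots> = (\<integral>x. (cis (y \<bullet> \<xi>) * complex_of_real (f y)) * (cis (- (x \<bullet> \<xi>)) * complex_of_real (f x)) \<partial>lborel)"
      by (intro Bochner_Integration.integral_cong refl)
         (simp add: inner_diff_left cis_mult[symmetric] cis_divide[symmetric] divide_inverse)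
    also have "\<dots> = cis (y \<bullet> \<xi>) * complex_of_real (f y) * F"
      unfolding F_def by simp
    finally show "(\<integral>z. cis (- (z \<bullet> \<xi>)) * complex_of_real (f (z + y) * f y) \<partial>lborel) = cis (y \<bullet> \<xi>) * complex_of_real (f y) * F" .
  qed
  also have "\<dots> = (\<integral>y. cis (y \<bullet> \<xi>) * complex_of_real (f y) \<partial>lborel) * F" by simp
  also have "(\<integral>y. cis (y \<bullet> \<xi>) * complex_of_real (f y) \<partial>lborel) = cnj F"
    unfolding F_def by (subst Bochner_Integration.integral_cnj[symmetric]) (simp add: cis_cnj)
  moreover have "(complex_of_real (cmod F))\<^sup>2 = F * cnj F" using complex_norm_square[of F] by simp
  ultimately show ?thesis
    unfolding fourier_integral_def F_def[symmetric]
    by (simp add: norm_mult power_mult_distrib mult.commute)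
qed

lemma integral_cis_gauss_scaled:
  fixes z :: "'a::euclidean_space"
  assumes "\<epsilon> > 0"
  shows "\<epsilon> ^ DIM('a) * (\<integral>\<xi>. cis (- (z \<bullet> \<xi>)) * complex_of_real (gauss (\<epsilon> *\<^sub>R \<xi>)) \<partial>lborel)
     = complex_of_real (gauss ((1 / \<epsilon>) *\<^sub>R z) / gauss (0::'a))"
proof -
  have "complex_of_real (exp (- (norm (- (1 / \<epsilon>) *\<^sub>R z))\<^sup>2 / 2)) = (\<integral>x. cis ((- (1 / \<epsilon>) *\<^sub>R z) \<bullet> x) * of_real (gauss x) \<partial>lborel)"
    by (rule integral_cis_gauss[symmetric])
  also have "\<dots> = \<bar>\<epsilon>\<bar> ^ DIM('a) *\<^sub>R (\<integral>x. cis ((- (1 / \<epsilon>) *\<^sub>R z) \<bullet> (0 + \<epsilon> *\<^sub>R x)) * of_real (gauss (0 + \<epsilon> *\<^sub>R x)) \<partial>lborel)"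
    using assms by (intro lborel_integral_affine) auto
  also have "\<dots> = \<epsilon> ^ DIM('a) * (\<integral>\<xi>. cis (- (z \<bullet> \<xi>)) * complex_of_real (gauss (\<epsilon> *\<^sub>R \<xi>)) \<partial>lborel)"
    using assms by (simp add: scaleR_conv_of_real)
  also have "exp (- (norm (- (1 / \<epsilon>) *\<^sub>R z))\<^sup>2 / 2) = gauss ((1 / \<epsilon>) *\<^sub>R z) / gauss (0::'a)"
    by (simp add: gauss_def)
  finally show ?thesis by simp
qed

text \<open>The Gaussian weight makes the double integral in \<open>\<xi>\<close> and
  \<open>z\<close> absolutely convergent, so the \<open>\<xi>\<close>-integral can be carried out
  first; the transform of a wide Gaussian is a narrow one. Division by \<open>gauss 0\<close>
  normalises the weight to 1 at the origin and removes one of the two normalising constants in the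
  squared transform.\<close>

lemma fourier_integral_gauss_weight:
  fixes f :: "real^'n \<Rightarrow> real"
  assumes f: "integrable lborel f" and e: "\<epsilon> > 0"
  defines "\<phi> \<equiv> \<lambda>z. \<integral>y. f (z + y) * f y \<partial>lborel"
  shows "(\<integral>\<xi>. (norm (fourier_integral f \<xi>))\<^sup>2 * (gauss (\<epsilon> *\<^sub>R \<xi>) / gauss (0 :: real^'n)) \<partial>lborel)
     = (\<integral>w. \<phi> (\<epsilon> *\<^sub>R w) * gauss w \<partial>lborel)"
proof -
  have [measurable]: "f \<in> borel_measurable borel" using f by (auto dest: borel_measurable_integrable)
  have \<phi>: "integrable lborel \<phi>"
    unfolding \<phi>_def by (rule lborel_pair.integrable_fst[OF integrable_autocorrelation[OF f]])
  then have [measurable]: "\<phi> \<in> borel_measurable borel" by (auto dest: borel_measurable_integrable)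
  define c where "c = gauss (0 :: real^'n)"
  have c: "c = (2 * pi) powr (- real CARD('n) / 2)" "c > 0" by (auto simp: c_def gauss_def)
  have ge: "integrable lborel (\<lambda>\<xi>::real^'n. gauss (\<epsilon> *\<^sub>R \<xi>))"
    using lborel_integrable_affine[OF integrable_gauss, of \<epsilon> "0::real^'n"] e by simp
  have int: "integrable lborel2 (\<lambda>(\<xi>::real^'n, z). cis (- (z \<bullet> \<xi>)) * complex_of_real (\<phi> z) * complex_of_real (gauss (\<epsilon> *\<^sub>R \<xi>)))"
  proof (rule lborel_pair_integrableI)
    have "(\<integral>\<^sup>+(x::real^'n). \<integral>\<^sup>+y. ennreal (norm (cis (- (y \<bullet> x)) * complex_of_real (\<phi> y) * complex_of_real (gauss (\<epsilon> *\<^sub>R x)))) \<partial>lborel \<partial>lborel)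
      = (\<integral>\<^sup>+(x::real^'n). (\<integral>\<^sup>+y. ennreal \<bar>\<phi> y\<bar> \<partial>lborel) * ennreal \<bar>gauss (\<epsilon> *\<^sub>R x)\<bar> \<partial>lborel)"
      by (simp add: norm_mult ennreal_mult nn_integral_multc)
    also have "\<dots> = (\<integral>\<^sup>+y. ennreal \<bar>\<phi> y\<bar> \<partial>lborel) * (\<integral>\<^sup>+(x::real^'n). ennreal \<bar>gauss (\<epsilon> *\<^sub>R x)\<bar> \<partial>lborel)"
      by (rule nn_integral_cmult) measurable
    also have "\<dots> < \<infinity>" using \<phi> ge by (simp add: integrable_iff_bounded ennreal_mult_less_top)
    finally show "(\<integral>\<^sup>+(x::real^'n). \<integral>\<^sup>+y. ennreal (norm (cis (- (y \<bullet> x)) * complex_of_real (\<phi> y) * complex_of_real (gauss (\<epsilon> *\<^sub>R x)))) \<partial>lborel \<partial>lborel) < \<infinity>" .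
  qed measurable
  have "complex_of_real (\<integral>\<xi>. (norm (fourier_integral f \<xi>))\<^sup>2 * (gauss (\<epsilon> *\<^sub>R \<xi>) / c) \<partial>lborel)
     = (\<integral>\<xi>. complex_of_real ((norm (fourier_integral f \<xi>))\<^sup>2) * complex_of_real (gauss (\<epsilon> *\<^sub>R \<xi>) / c) \<partial>lborel)"
    by (simp flip: integral_complex_of_real)
  also have "\<dots> = (\<integral>\<xi>. complex_of_real c * (\<integral>z. cis (- (z \<bullet> \<xi>)) * complex_of_real (\<phi> z) * complex_of_real (gauss (\<epsilon> *\<^sub>R \<xi>)) \<partial>lborel) \<partial>lborel)"
  proof (intro Bochner_Integration.integral_cong refl)
    fix \<xi>
    have P: "complex_of_real ((norm (fourier_integral f \<xi>))\<^sup>2) = complex_of_real (c\<^sup>2) * (\<integral>z. cis (- (z \<bullet> \<xi>)) * complex_of_real (\<phi> z) \<partial>lborel)"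
      unfolding \<phi>_def c(1) by (rule fourier_integral_norm_power2[OF f])
    show "complex_of_real ((norm (fourier_integral f \<xi>))\<^sup>2) * complex_of_real (gauss (\<epsilon> *\<^sub>R \<xi>) / c)
      = complex_of_real c * (\<integral>z. cis (- (z \<bullet> \<xi>)) * complex_of_real (\<phi> z) * complex_of_real (gauss (\<epsilon> *\<^sub>R \<xi>)) \<partial>lborel)"
      unfolding P using c(2) by (simp add: power2_eq_square)
  qed
  also have "\<dots> = complex_of_real c * (\<integral>z. \<integral>\<xi>. cis (- (z \<bullet> \<xi>)) * complex_of_real (\<phi> z) * complex_of_real (gauss (\<epsilon> *\<^sub>R \<xi>)) \<partial>lborel \<partial>lborel)"
    using lborel_pair.Fubini_integral[OF int] by simp
  also have "\<dots> = (\<integral>z. complex_of_real (\<phi> z) * (complex_of_real c * (\<integral>\<xi>. cis (- (z \<bullet> \<xi>)) * complex_of_real (gauss (\<epsilon> *\<^sub>R \<xi>)) \<partial>lborel)) \<partial>lborel)"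
    by (simp add: mult_ac flip: integral_mult_right_zero)
  also have "\<dots> = (\<integral>z. complex_of_real (\<phi> z * gauss ((1 / \<epsilon>) *\<^sub>R z) / \<epsilon> ^ CARD('n)) \<partial>lborel)"
  proof (intro Bochner_Integration.integral_cong refl)
    fix z
    show "complex_of_real (\<phi> z) * (complex_of_real c * (\<integral>\<xi>. cis (- (z \<bullet> \<xi>)) * complex_of_real (gauss (\<epsilon> *\<^sub>R \<xi>)) \<partial>lborel))
        = complex_of_real (\<phi> z * gauss ((1 / \<epsilon>) *\<^sub>R z) / \<epsilon> ^ CARD('n))"
      using integral_cis_gauss_scaled[OF e, of z] c e by (simp add: c_def[symmetric] field_simps)
  qed
  also have "\<dots> = complex_of_real (\<integral>z. \<phi> z * gauss ((1 / \<epsilon>) *\<^sub>R z) / \<epsilon> ^ CARD('n) \<partial>lborel)"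
    by (rule integral_complex_of_real)
  also have "(\<integral>z. \<phi> z * gauss ((1 / \<epsilon>) *\<^sub>R z) / \<epsilon> ^ CARD('n) \<partial>lborel) = (\<integral>w. \<phi> (\<epsilon> *\<^sub>R w) * gauss w \<partial>lborel)"
    using lborel_integral_affine[of \<epsilon> "\<lambda>z. \<phi> z * gauss ((1 / \<epsilon>) *\<^sub>R z)" 0] e by simp
  finally show ?thesis unfolding c_def by (simp only: of_real_eq_iff)
qed

lemma integrable_mult_L2:
  fixes f g :: "'a \<Rightarrow> real"
  assumes "integrable M (\<lambda>x. (f x)\<^sup>2)" "integrable M (\<lambda>x. (g x)\<^sup>2)" and [measurable]: "f \<in> borel_measurable M" "g \<in> borel_measurable M"
  shows "integrable M (\<lambda>x. f x * g x)"
proof (rule Bochner_Integration.integrable_bound[OF Bochner_Integration.integrable_add[OF assms(1,2)]])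
  show "AE x in M. norm (f x * g x) \<le> norm ((f x)\<^sup>2 + (g x)\<^sup>2)"
  proof (intro AE_I2)
    fix x
    have "2 * \<bar>f x\<bar> * \<bar>g x\<bar> \<le> \<bar>f x\<bar>\<^sup>2 + \<bar>g x\<bar>\<^sup>2" by (rule sum_squares_bound)
    moreover have "0 \<le> \<bar>f x\<bar> * \<bar>g x\<bar>" by simp
    ultimately have "\<bar>f x\<bar> * \<bar>g x\<bar> \<le> (f x)\<^sup>2 + (g x)\<^sup>2" unfolding power2_abs by linarith
    then show "norm (f x * g x) \<le> norm ((f x)\<^sup>2 + (g x)\<^sup>2)" by (simp add: abs_mult)
  qed
qed measurable

text \<open>Expanding the square of the increment. It reduces continuity of the autocorrelation at 0
  to continuity of translations in L2.\<close>

lemma autocorrelation_eq: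
  fixes f :: "'a::euclidean_space \<Rightarrow> real"
  assumes [measurable]: "f \<in> borel_measurable borel" and f2: "integrable lborel (\<lambda>x. (f x)\<^sup>2)"
  shows "(\<integral>y. f (z + y) * f y \<partial>lborel) = (\<integral>y. (f y)\<^sup>2 \<partial>lborel) - (1 / 2) * (\<integral>y. (f (z + y) - f y)\<^sup>2 \<partial>lborel)"
proof -
  have i: "integrable lborel (\<lambda>y. (f (z + y))\<^sup>2)" using f2 by (subst lborel_integrable_shift_iff)
  have j: "integrable lborel (\<lambda>y. f (z + y) * f y)" by (rule integrable_mult_L2) (use i f2 in auto)
  have "(\<integral>y. (f (z + y) - f y)\<^sup>2 \<partial>lborel) = (\<integral>y. (f (z + y))\<^sup>2 + (f y)\<^sup>2 - 2 * (f (z + y) * f y) \<partial>lborel)"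
    by (intro Bochner_Integration.integral_cong refl) (simp add: power2_diff)
  also have "\<dots> = (\<integral>y. (f (z + y))\<^sup>2 \<partial>lborel) + (\<integral>y. (f y)\<^sup>2 \<partial>lborel) - 2 * (\<integral>y. f (z + y) * f y \<partial>lborel)"
    using i j f2 by simp
  also have "(\<integral>y. (f (z + y))\<^sup>2 \<partial>lborel) = (\<integral>y. (f y)\<^sup>2 \<partial>lborel)" by (rule lborel_integral_shift)
  finally show ?thesis by (simp add: field_simps)
qed

text \<open>
  The squared modulus of the Fourier transform of \<open>f\<close> is the transform of the autocorrelation of \<open>f\<close>.
  Integrated against widening Gaussians it gives averages of the autocorrelation that concentrate at \<open>0\<close>,
  where the autocorrelation is continuous with value the integral of \<open>f\<^sup>2\<close>.
\<close>

theorem plancherel: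
  fixes f :: "real^'n \<Rightarrow> real"
  assumes f: "integrable lborel f" and f2: "integrable lborel (\<lambda>x. (f x)\<^sup>2)"
  shows "(sq_integral lborel (\<lambda>\<xi>. fourier_integral f \<xi>)) = (sq_integral lborel f)"
proof -
  have [measurable]: "f \<in> borel_measurable borel" using f by (auto dest: borel_measurable_integrable)
  define \<phi> where "\<phi> z = (\<integral>y. f (z + y) * f y \<partial>lborel)" for z
  define \<epsilon> where "\<epsilon> n = 1 / real (Suc n)" for n
  have e: "\<epsilon> n > 0" for n by (simp add: \<epsilon>_def)
  define c where "c = gauss (0 :: real^'n)"
  have c: "c > 0" by (auto simp: c_def gauss_def)
  define q where "q n \<xi> = gauss (\<epsilon> n *\<^sub>R \<xi>) / c" for n and \<xi> :: "real^'n"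
  have q: "q n \<xi> = exp (- (\<epsilon> n * norm \<xi>)\<^sup>2 / 2)" for n \<xi>
    using e[of n] by (simp add: q_def c_def gauss_def)
  have [measurable]: "q n \<in> borel_measurable borel" for n unfolding q_def by measurable
  have "integrable lborel \<phi>"
    unfolding \<phi>_def by (rule lborel_pair.integrable_fst[OF integrable_autocorrelation[OF f]])
  then have [measurable]: "\<phi> \<in> borel_measurable borel" by (auto dest: borel_measurable_integrable)
  \<comment> \<open>The weights increase to 1, so monotone convergence applies without knowing that
    the transform is square integrable, which is part of what is being proved.\<close>
  have L: "(\<lambda>n. \<integral>\<^sup>+\<xi>. ennreal ((norm (fourier_integral f \<xi>))\<^sup>2 * q n \<xi>) \<partial>lborel) \<longlonglongrightarrow> (sq_integral lborel (\<lambda>\<xi>. fourier_integral f \<xi>))"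
  proof (rule nn_integral_LIMSEQ)
    show "incseq (\<lambda>n \<xi>. ennreal ((norm (fourier_integral f \<xi>))\<^sup>2 * q n \<xi>))"
    proof (intro monoI le_funI ennreal_leI mult_left_mono)
      fix n m :: nat and \<xi> :: "real^'n" assume "n \<le> m"
      then have "\<epsilon> m \<le> \<epsilon> n" by (simp add: \<epsilon>_def frac_le)
      then have "(\<epsilon> m * norm \<xi>)\<^sup>2 \<le> (\<epsilon> n * norm \<xi>)\<^sup>2" using e[of m] by (intro power_mono mult_right_mono) auto
      then show "q n \<xi> \<le> q m \<xi>" by (simp add: q)
    qed simp
    show "(\<lambda>n. ennreal ((norm (fourier_integral f \<xi>))\<^sup>2 * q n \<xi>)) \<longlonglongrightarrow> ennreal ((norm (fourier_integral f \<xi>))\<^sup>2)" for \<xi>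
    proof -
      have "(\<lambda>n. (norm (fourier_integral f \<xi>))\<^sup>2 * q n \<xi>) \<longlonglongrightarrow> (norm (fourier_integral f \<xi>))\<^sup>2 * exp (- (0 * norm \<xi>)\<^sup>2 / 2)"
        unfolding q \<epsilon>_def by (intro tendsto_intros LIMSEQ_Suc lim_1_over_n) simp
      then show ?thesis by (intro tendsto_ennrealI) simp
    qed
  qed measurable
  have eq: "(\<integral>\<^sup>+\<xi>. ennreal ((norm (fourier_integral f \<xi>))\<^sup>2 * q n \<xi>) \<partial>lborel) = ennreal (\<integral>w. \<phi> (\<epsilon> n *\<^sub>R w) * gauss w \<partial>lborel)" for n
  proof -
    \<comment> \<open>For fixed \<open>n\<close> boundedness of the transform suffices, since the
      Gaussian is integrable.\<close>
    define M where "M = (2 * pi) powr (- real CARD('n) / 2) * (\<integral>x. \<bar>f x\<bar> \<partial>lborel)"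
    have "integrable lborel (\<lambda>\<xi>. M\<^sup>2 * (1 / c) * gauss (\<epsilon> n *\<^sub>R \<xi> :: real^'n))"
      using lborel_integrable_affine[OF integrable_gauss, of "\<epsilon> n" "0::real^'n"] e[of n]
      by (intro integrable_mult_right) simp
    then have "integrable lborel (\<lambda>\<xi>. (norm (fourier_integral f \<xi>))\<^sup>2 * q n \<xi>)"
    proof (rule Bochner_Integration.integrable_bound)
      show "AE \<xi> in lborel. norm ((norm (fourier_integral f \<xi>))\<^sup>2 * q n \<xi>) \<le> norm (M\<^sup>2 * (1 / c) * gauss (\<epsilon> n *\<^sub>R \<xi>))"
      proof (intro AE_I2)
        fix \<xi> :: "real^'n"
        have "(norm (fourier_integral f \<xi>))\<^sup>2 \<le> M\<^sup>2"
          unfolding M_def by (intro power_mono norm_fourier_integral_le) simp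
        then have "(norm (fourier_integral f \<xi>))\<^sup>2 * q n \<xi> \<le> M\<^sup>2 * q n \<xi>"
          by (intro mult_right_mono) (simp_all add: q)
        then show "norm ((norm (fourier_integral f \<xi>))\<^sup>2 * q n \<xi>) \<le> norm (M\<^sup>2 * (1 / c) * gauss (\<epsilon> n *\<^sub>R \<xi>))"
          using c by (simp add: q_def gauss_nonneg abs_mult)
      qed
    qed measurable
    then have "(\<integral>\<^sup>+\<xi>. ennreal ((norm (fourier_integral f \<xi>))\<^sup>2 * q n \<xi>) \<partial>lborel) = ennreal (\<integral>\<xi>. (norm (fourier_integral f \<xi>))\<^sup>2 * q n \<xi> \<partial>lborel)"
      by (intro nn_integral_eq_integral) (auto simp: q)
    then show ?thesis
      using fourier_integral_gauss_weight[OF f e, of n] unfolding q_def c_def \<phi>_def by simp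
  qed
  have bd: "\<bar>\<phi> z\<bar> \<le> (\<integral>y. (f y)\<^sup>2 \<partial>lborel)" for z
  proof -
    have i: "integrable lborel (\<lambda>y. (f (z + y))\<^sup>2)" using f2 by (subst lborel_integrable_shift_iff)
    have j: "integrable lborel (\<lambda>y. f (z + y) * f y)" by (rule integrable_mult_L2) (use i f2 in auto)
    have "\<bar>\<phi> z\<bar> \<le> (\<integral>y. \<bar>f (z + y) * f y\<bar> \<partial>lborel)" unfolding \<phi>_def by (rule integral_abs_bound)
    also have "\<dots> \<le> (\<integral>y. (1 / 2) * (f (z + y))\<^sup>2 + (1 / 2) * (f y)\<^sup>2 \<partial>lborel)"
    proof (rule integral_mono)
      fix y
      have "2 * \<bar>f (z + y)\<bar> * \<bar>f y\<bar> \<le> \<bar>f (z + y)\<bar>\<^sup>2 + \<bar>f y\<bar>\<^sup>2" by (rule sum_squares_bound)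
      then show "\<bar>f (z + y) * f y\<bar> \<le> (1 / 2) * (f (z + y))\<^sup>2 + (1 / 2) * (f y)\<^sup>2" by (simp add: abs_mult)
    qed (use i j f2 in auto)
    also have "\<dots> = (\<integral>y. (f y)\<^sup>2 \<partial>lborel)"
      using i f2 lborel_integral_shift[of "\<lambda>y. (f y)\<^sup>2" z] by simp
    finally show ?thesis .
  qed
  have lim\<phi>: "(\<lambda>n. \<phi> (z n)) \<longlonglongrightarrow> (\<integral>y. (f y)\<^sup>2 \<partial>lborel)" if z: "z \<longlonglongrightarrow> 0" for z :: "nat \<Rightarrow> real^'n"
  proof -
    have "(\<lambda>n. enn2real (\<integral>\<^sup>+y. (f (z n + y) - f y)\<^sup>2 \<partial>lborel)) \<longlonglongrightarrow> enn2real 0"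
      using tendsto_enn2real[of _ 0] L2_translation_continuous[OF _ f2 z] by simp
    then have "(\<lambda>n. (\<integral>y. (f (z n + y) - f y)\<^sup>2 \<partial>lborel)) \<longlonglongrightarrow> 0"
      by (simp add: integral_eq_nn_integral)
    then have "(\<lambda>n. (\<integral>y. (f y)\<^sup>2 \<partial>lborel) - (1 / 2) * (\<integral>y. (f (z n + y) - f y)\<^sup>2 \<partial>lborel)) \<longlonglongrightarrow> (\<integral>y. (f y)\<^sup>2 \<partial>lborel) - (1 / 2) * 0"
      by (intro tendsto_intros)
    then show ?thesis unfolding \<phi>_def by (subst autocorrelation_eq) (use f2 in auto)
  qed
  have "(\<lambda>n. \<integral>w. \<phi> (\<epsilon> n *\<^sub>R w) * gauss w \<partial>lborel) \<longlonglongrightarrow> (\<integral>w. (\<integral>y. (f y)\<^sup>2 \<partial>lborel) * gauss (w :: real^'n) \<partial>lborel)"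
  proof (rule integral_dominated_convergence)
    show "integrable lborel (\<lambda>w::real^'n. (\<integral>y. (f y)\<^sup>2 \<partial>lborel) * gauss w)"
      by (intro integrable_mult_right integrable_gauss)
    show "AE w in lborel. norm (\<phi> (\<epsilon> n *\<^sub>R w) * gauss w) \<le> (\<integral>y. (f y)\<^sup>2 \<partial>lborel) * gauss w" for n
      using bd by (intro AE_I2) (auto simp: abs_mult gauss_nonneg intro!: mult_right_mono)
    show "AE w in lborel. (\<lambda>n. \<phi> (\<epsilon> n *\<^sub>R w) * gauss w) \<longlonglongrightarrow> (\<integral>y. (f y)\<^sup>2 \<partial>lborel) * gauss w"
    proof (intro AE_I2 tendsto_mult lim\<phi> tendsto_const)
      fix w :: "real^'n"
      have "(\<lambda>n. \<epsilon> n *\<^sub>R w) \<longlonglongrightarrow> 0 *\<^sub>R w" unfolding \<epsilon>_def by (intro tendsto_intros LIMSEQ_Suc lim_1_over_n)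
      then show "(\<lambda>n. \<epsilon> n *\<^sub>R w) \<longlonglongrightarrow> 0" by simp
    qed
  qed measurable
  then have "(\<lambda>n. ennreal (\<integral>w. \<phi> (\<epsilon> n *\<^sub>R w) * gauss w \<partial>lborel)) \<longlonglongrightarrow> ennreal (\<integral>y. (f y)\<^sup>2 \<partial>lborel)"
    by (intro tendsto_ennrealI) (simp add: integral_gauss)
  with L have "(sq_integral lborel (\<lambda>\<xi>. fourier_integral f \<xi>)) = ennreal (\<integral>y. (f y)\<^sup>2 \<partial>lborel)"
    unfolding eq by (rule LIMSEQ_unique)
  then show ?thesis using f2 by (simp add: nn_integral_eq_integral)
qed

section \<open>The \<open>L\<^sup>2\<close> Fourier transform\<close>

lemma
  assumes "f \<in> L2"
  shows L2_measurable: "f \<in> borel_measurable borel" and L2_integrable: "integrable lborel (\<lambda>x. (norm (f x))\<^sup>2)"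
  using assms by (auto simp: L2_def)

lemma L2_real_integrable: "f \<in> L2 \<Longrightarrow> integrable lborel (\<lambda>x. (f x :: real)\<^sup>2)"
  using L2_integrable[of f] by simp

lemma L2_I:
  assumes "f \<in> borel_measurable borel" "(sq_integral lborel f) < \<infinity>"
  shows "f \<in> L2"
  using assms by (simp add: L2_def integrable_iff_bounded)

lemma L2_nn_integral_finite: "f \<in> L2 \<Longrightarrow> (sq_integral lborel f) < \<infinity>"
  using L2_integrable[of f] by (simp add: integrable_iff_bounded)

lemma L2_diff:
  assumes "f \<in> L2" "g \<in> L2"
  shows "(\<lambda>x. f x - g x) \<in> L2"
proof (rule L2_I)
  note [measurable] = assms[THEN L2_measurable]
  show "(\<lambda>x. f x - g x) \<in> borel_measurable borel" by measurable
  have "(sq_integral lborel (\<lambda>x. f x - g x)) \<le> 2 * (sq_integral lborel f) + 2 * (sq_integral lborel g)"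
    by (rule nn_integral_norm_diff_power2_le) measurable
  also have "\<dots> < \<infinity>" using assms[THEN L2_nn_integral_finite] by (simp add: ennreal_mult_less_top)
  finally show "(sq_integral lborel (\<lambda>x. f x - g x)) < \<infinity>" .
qed

lemma L2_uminus: "f \<in> L2 \<Longrightarrow> (\<lambda>x. - f x) \<in> L2"
  by (simp add: L2_def)

abbreviation trunc :: "nat \<Rightarrow> (real^'n \<Rightarrow> real) \<Rightarrow> real^'n \<Rightarrow> real" where
  "trunc n f \<equiv> \<lambda>x. indicator (ball 0 (real n)) x * f x"

lemma borel_measurable_indicator_ball[measurable]:
  "(\<lambda>x. indicator (ball c r) x :: real) \<in> borel_measurable borel"
  by (rule borel_measurable_indicator) simp

lemma integrable_trunc:
  assumes "f \<in> L2"
  shows "integrable lborel (trunc n f)" and "integrable lborel (\<lambda>x. (trunc n f x)\<^sup>2)" "trunc n f \<in> L2"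
proof -
  note [measurable] = L2_measurable[OF assms]
  have m[measurable]: "trunc n f \<in> borel_measurable borel" by measurable
  note f2 = L2_real_integrable[OF assms]
  have "integrable lborel (\<lambda>x. indicator (cball 0 (real n)) x + (f x)\<^sup>2)"
    by (intro Bochner_Integration.integrable_add integrable_indicator_cball f2)
  then show "integrable lborel (trunc n f)"
  proof (rule Bochner_Integration.integrable_bound)
    have "\<bar>t\<bar> \<le> 1 + t\<^sup>2" for t :: real
      using sum_squares_bound[of 1 "\<bar>t\<bar>"] by simp
    then show "AE x in lborel. norm (trunc n f x) \<le> norm (indicator (cball 0 (real n)) x + (f x)\<^sup>2)"
      by (intro AE_I2) (auto simp: indicator_def)
  qed simp
  show "integrable lborel (\<lambda>x. (trunc n f x)\<^sup>2)"
    by (rule Bochner_Integration.integrable_bound[OF f2]) (auto simp: indicator_def)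
  then show "trunc n f \<in> L2" by (simp add: L2_def)
qed

lemma trunc_tendsto:
  fixes f :: "real^'n \<Rightarrow> real"
  assumes "f \<in> L2"
  shows "(\<lambda>n. sq_integral lborel (\<lambda>x. trunc n f x - f x)) \<longlonglongrightarrow> 0"
proof (rule nn_integral_dominated_tendsto_0[OF _ L2_real_integrable[OF assms]])
  note [measurable] = L2_measurable[OF assms]
  show "(\<lambda>x. (norm (trunc n f x - f x))\<^sup>2) \<in> borel_measurable lborel" for n by measurable
  show "\<bar>(norm (trunc n f x - f x))\<^sup>2\<bar> \<le> (f x)\<^sup>2" for n and x :: "real^'n" by (auto simp: indicator_def)
  show "AE x in lborel. (\<lambda>n. (norm (trunc n f x - f x))\<^sup>2) \<longlonglongrightarrow> 0"
  proof (intro AE_I2)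
    fix x :: "real^'n"
    obtain k :: nat where k: "norm x < real k" using reals_Archimedean2 by blast
    have "eventually (\<lambda>n. (norm (trunc n f x - f x))\<^sup>2 = 0) sequentially"
      using k by (intro eventually_sequentiallyI[of k]) (auto simp: indicator_def)
    then show "(\<lambda>n. (norm (trunc n f x - f x))\<^sup>2) \<longlonglongrightarrow> 0" by (rule tendsto_eventually)
  qed
qed

lemma has_L2_fourier_L2: "has_L2_fourier f F \<Longrightarrow> f \<in> L2" "has_L2_fourier f F \<Longrightarrow> F \<in> L2"
  by (auto simp: has_L2_fourier_def)

lemma has_L2_fourier_plancherel:
  fixes f :: "real^'n \<Rightarrow> real"
  assumes "has_L2_fourier f F"
  shows "(sq_integral lborel F) = (sq_integral lborel f)"
proof -
  have f: "f \<in> L2" and F: "F \<in> L2" using has_L2_fourier_L2[OF assms] .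
  note [measurable] = L2_measurable[OF f] L2_measurable[OF F]
  show ?thesis
  proof (rule nn_integral_power2_limit_eq[where Fn = "\<lambda>n. fourier_integral (trunc n f)" and Gn = "\<lambda>n. trunc n f"])
    show "(\<lambda>n. sq_integral lborel (\<lambda>x. fourier_integral (trunc n f) x - F x)) \<longlonglongrightarrow> 0"
      using assms by (simp add: has_L2_fourier_def)
    show "(sq_integral lborel (\<lambda>x. fourier_integral (trunc n f) x)) = (sq_integral lborel (\<lambda>x. trunc n f x))" for n
      by (rule plancherel[OF integrable_trunc(1,2)[OF f]])
    show "fourier_integral (trunc n f) \<in> borel_measurable lborel" for n
      by measurable
  qed (use trunc_tendsto[OF f] in auto)
qed

lemma fourier_integral_diff:
  assumes "integrable lborel f" "integrable lborel g"
  shows "fourier_integral (\<lambda>x. f x - g x) \<xi> = fourier_integral f \<xi> - fourier_integral g \<xi>"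
  using integrable_cis_mult[OF assms(1), of "\<lambda>x. - (x \<bullet> \<xi>)"] integrable_cis_mult[OF assms(2), of "\<lambda>x. - (x \<bullet> \<xi>)"]
  by (simp add: fourier_integral_def right_diff_distrib)

lemma fourier_integral_uminus: "fourier_integral (\<lambda>x. - f x) \<xi> = - fourier_integral f \<xi>"
  by (simp add: fourier_integral_def)

lemma fourier_integral_shift:
  "fourier_integral (\<lambda>x. f (x - z)) \<xi> = cis (- (z \<bullet> \<xi>)) * fourier_integral f \<xi>"
proof -
  have "(\<integral>x. cis (- (x \<bullet> \<xi>)) * complex_of_real (f (x - z)) \<partial>lborel) = (\<integral>x. cis (- ((z + x) \<bullet> \<xi>)) * complex_of_real (f (z + x - z)) \<partial>lborel)"
    by (rule lborel_integral_shift[symmetric])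
  also have "\<dots> = (\<integral>x. cis (- (z \<bullet> \<xi>)) * (cis (- (x \<bullet> \<xi>)) * complex_of_real (f x)) \<partial>lborel)"
    by (intro Bochner_Integration.integral_cong refl) (simp add: inner_add_left cis_mult[symmetric] minus_add_distrib[symmetric] cis_mult)
  finally show ?thesis by (simp add: fourier_integral_def)
qed

text \<open>Plancherel's theorem for \<open>trunc n f - f\<close> turns the convergence demanded by
  the definition into convergence of the truncations.\<close>

lemma has_L2_fourier_integral:
  fixes f :: "real^'n \<Rightarrow> real"
  assumes f: "integrable lborel f" and f2: "f \<in> L2"
  shows "has_L2_fourier f (fourier_integral f)"
proof -
  note [measurable] = L2_measurable[OF f2]
  have "fourier_integral f \<in> L2"
    using L2_nn_integral_finite[OF f2]
    by (intro L2_I) (simp_all add: plancherel[OF f L2_real_integrable[OF f2]])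
  moreover have "(sq_integral lborel (\<lambda>\<xi>. fourier_integral (trunc n f) \<xi> - fourier_integral f \<xi>))
      = (sq_integral lborel (\<lambda>x. trunc n f x - f x))" for n
    using plancherel[of "\<lambda>x. trunc n f x - f x"] f integrable_trunc(1)[OF f2, of n]
      L2_real_integrable[OF L2_diff[OF integrable_trunc(3)[OF f2, of n] f2]]
    by (simp add: fourier_integral_diff)
  ultimately show ?thesis
    using f2 trunc_tendsto[OF f2] by (simp add: has_L2_fourier_def)
qed

lemma has_L2_fourier_uminus:
  assumes "has_L2_fourier f F"
  shows "has_L2_fourier (\<lambda>x. - f x) (\<lambda>\<xi>. - F \<xi>)"
proof -
  have "norm (fourier_integral (\<lambda>x. indicator (ball 0 (real n)) x * - f x) \<xi> - - F \<xi>)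
      = norm (fourier_integral (trunc n f) \<xi> - F \<xi>)" for n \<xi>
    by (simp add: fourier_integral_uminus norm_minus_commute)
  then show ?thesis
    using assms by (auto simp: has_L2_fourier_def L2_uminus)
qed

lemma tendsto_0_le_ennreal:
  fixes f g :: "nat \<Rightarrow> ennreal"
  assumes "g \<longlonglongrightarrow> 0" "\<And>n. f n \<le> g n"
  shows "f \<longlonglongrightarrow> 0"
  using assms by (intro tendsto_sandwich[of "\<lambda>_. 0" f sequentially g 0]) auto

lemma has_L2_fourier_diff:
  fixes f :: "real^'n \<Rightarrow> real"
  assumes f: "has_L2_fourier f F" and g: "has_L2_fourier g G"
  shows "has_L2_fourier (\<lambda>x. f x - g x) (\<lambda>\<xi>. F \<xi> - G \<xi>)"
proof -
  note L = has_L2_fourier_L2[OF f] has_L2_fourier_L2[OF g]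
  note [measurable] = L[THEN L2_measurable]
  define E where "E f F n = (sq_integral lborel (\<lambda>\<xi>. fourier_integral (trunc n f) \<xi> - F \<xi>))"
    for f :: "real^'n \<Rightarrow> real" and F n
  have "(\<lambda>n. 2 * E f F n + 2 * E g G n) \<longlonglongrightarrow> 2 * 0 + 2 * 0"
    using f g unfolding E_def has_L2_fourier_def by (intro tendsto_intros ennreal_tendsto_cmult) auto
  then have "(\<lambda>n. 2 * E f F n + 2 * E g G n) \<longlonglongrightarrow> 0" by simp
  moreover have "E (\<lambda>x. f x - g x) (\<lambda>\<xi>. F \<xi> - G \<xi>) n \<le> 2 * E f F n + 2 * E g G n" for n
  proof -
    have "fourier_integral (trunc n (\<lambda>x. f x - g x)) \<xi> - (F \<xi> - G \<xi>)
       = (fourier_integral (trunc n f) \<xi> - F \<xi>) - (fourier_integral (trunc n g) \<xi> - G \<xi>)" for \<xi>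
      using fourier_integral_diff[OF integrable_trunc(1)[OF L(1)] integrable_trunc(1)[OF L(3)], of n n \<xi>]
      by (simp add: right_diff_distrib)
    then have "E (\<lambda>x. f x - g x) (\<lambda>\<xi>. F \<xi> - G \<xi>) n = (sq_integral lborel (\<lambda>\<xi>. (fourier_integral (trunc n f) \<xi> - F \<xi>) - (fourier_integral (trunc n g) \<xi> - G \<xi>)))"
      by (simp only: E_def)
    also have "\<dots> \<le> 2 * E f F n + 2 * E g G n" unfolding E_def
      by (rule nn_integral_norm_diff_power2_le) simp_all
    finally show ?thesis .
  qed
  ultimately have "E (\<lambda>x. f x - g x) (\<lambda>\<xi>. F \<xi> - G \<xi>) \<longlonglongrightarrow> 0" by (rule tendsto_0_le_ennreal)
  then show ?thesis
    using L by (simp add: has_L2_fourier_def L2_diff E_def[abs_def])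
qed

lemma has_L2_fourier_add:
  assumes "has_L2_fourier f F" "has_L2_fourier g G"
  shows "has_L2_fourier (\<lambda>x. f x + g x) (\<lambda>\<xi>. F \<xi> + G \<xi>)"
  using has_L2_fourier_diff[OF assms(1) has_L2_fourier_uminus[OF assms(2)]] by simp

text \<open>Translation by \<open>z\<close> multiplies the transform by
  \<open>cis (- (z \<bullet> \<xi>))\<close>. Plancherel's theorem gives the equality for the
  truncations, and both sides pass to the limit. Integrated over \<open>z\<close> against a power
  weight, it produces the Gagliardo form.\<close>

lemma has_L2_fourier_increment:
  fixes f :: "real^'n \<Rightarrow> real"
  assumes fF: "has_L2_fourier f F"
  shows "(sq_integral lborel (\<lambda>\<xi>. (1 - cis (- (z \<bullet> \<xi>))) * F \<xi>)) = (sq_integral lborel (\<lambda>x. f x - f (x - z)))"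
proof -
  have f: "f \<in> L2" and F: "F \<in> L2" using has_L2_fourier_L2[OF fF] .
  note [measurable] = L2_measurable[OF f] L2_measurable[OF F]
  define g where "g n = trunc n f" for n
  have g: "integrable lborel (g n)" "g n \<in> L2" for n unfolding g_def using integrable_trunc[OF f] by auto
  then have [measurable]: "g n \<in> borel_measurable borel" for n by (auto dest: L2_measurable)
  have shiftL2: "(\<lambda>x. h (x - z)) \<in> L2" if "h \<in> L2" for h :: "real^'n \<Rightarrow> real"
  proof -
    note [measurable] = L2_measurable[OF that]
    have "(\<lambda>x. h (x - z)) \<in> borel_measurable borel" by measurable
    then show ?thesis
      using that lborel_integrable_shift_iff[of "\<lambda>x. (h x)\<^sup>2" "- z"] by (simp add: L2_def)
  qed
  show ?thesis
  proof (rule nn_integral_power2_limit_eq[where Fn = "\<lambda>n \<xi>. (1 - cis (- (z \<bullet> \<xi>))) * fourier_integral (g n) \<xi>"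
        and Gn = "\<lambda>n x. g n x - g n (x - z)"])
    show "(\<lambda>n. sq_integral lborel (\<lambda>\<xi>. (1 - cis (- (z \<bullet> \<xi>))) * fourier_integral (g n) \<xi> - (1 - cis (- (z \<bullet> \<xi>))) * F \<xi>)) \<longlonglongrightarrow> 0"
    proof (rule tendsto_0_le_ennreal)
      \<comment> \<open>The multiplier has modulus at most 2, hence the factor 4 on squared
        norms.\<close>
      have "(\<lambda>n. 4 * (sq_integral lborel (\<lambda>\<xi>. fourier_integral (g n) \<xi> - F \<xi>))) \<longlonglongrightarrow> 4 * 0"
        using fF unfolding has_L2_fourier_def g_def by (intro ennreal_tendsto_cmult) auto
      then show "(\<lambda>n. 4 * (sq_integral lborel (\<lambda>\<xi>. fourier_integral (g n) \<xi> - F \<xi>))) \<longlonglongrightarrow> 0" by simp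
      fix n
      have "(sq_integral lborel (\<lambda>\<xi>. (1 - cis (- (z \<bullet> \<xi>))) * fourier_integral (g n) \<xi> - (1 - cis (- (z \<bullet> \<xi>))) * F \<xi>))
        \<le> (\<integral>\<^sup>+\<xi>. ennreal (4 * (norm (fourier_integral (g n) \<xi> - F \<xi>))\<^sup>2) \<partial>lborel)"
      proof (intro nn_integral_mono ennreal_leI)
        fix \<xi>
        have "norm (1 - cis (- (z \<bullet> \<xi>))) \<le> norm (1::complex) + norm (cis (- (z \<bullet> \<xi>)))" by (rule norm_triangle_ineq4)
        then have "norm (1 - cis (- (z \<bullet> \<xi>))) * norm (fourier_integral (g n) \<xi> - F \<xi>) \<le> 2 * norm (fourier_integral (g n) \<xi> - F \<xi>)"
          by (intro mult_right_mono) auto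
        then have "(norm (1 - cis (- (z \<bullet> \<xi>))) * norm (fourier_integral (g n) \<xi> - F \<xi>))\<^sup>2 \<le> (2 * norm (fourier_integral (g n) \<xi> - F \<xi>))\<^sup>2"
          by (intro power_mono) auto
        then show "(norm ((1 - cis (- (z \<bullet> \<xi>))) * fourier_integral (g n) \<xi> - (1 - cis (- (z \<bullet> \<xi>))) * F \<xi>))\<^sup>2
            \<le> 4 * (norm (fourier_integral (g n) \<xi> - F \<xi>))\<^sup>2"
          by (simp add: right_diff_distrib[symmetric] norm_mult power_mult_distrib)
      qed
      also have "\<dots> = 4 * (sq_integral lborel (\<lambda>\<xi>. fourier_integral (g n) \<xi> - F \<xi>))"
        by (simp add: ennreal_mult nn_integral_cmult)
      finally show "(sq_integral lborel (\<lambda>\<xi>. (1 - cis (- (z \<bullet> \<xi>))) * fourier_integral (g n) \<xi> - (1 - cis (- (z \<bullet> \<xi>))) * F \<xi>))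
        \<le> 4 * (sq_integral lborel (\<lambda>\<xi>. fourier_integral (g n) \<xi> - F \<xi>))" .
    qed
    show "(\<lambda>n. sq_integral lborel (\<lambda>x. g n x - g n (x - z) - (f x - f (x - z)))) \<longlonglongrightarrow> 0"
    proof (rule tendsto_0_le_ennreal)
      have "(\<lambda>n. 4 * (sq_integral lborel (\<lambda>x. g n x - f x))) \<longlonglongrightarrow> 4 * 0"
        using trunc_tendsto[OF f] unfolding g_def by (intro ennreal_tendsto_cmult) auto
      then show "(\<lambda>n. 4 * (sq_integral lborel (\<lambda>x. g n x - f x))) \<longlonglongrightarrow> 0" by simp
      fix n
      have "(sq_integral lborel (\<lambda>x. g n x - g n (x - z) - (f x - f (x - z))))
          = (sq_integral lborel (\<lambda>x. (g n x - f x) - (g n (x - z) - f (x - z))))"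
        by (simp add: algebra_simps)
      also have "\<dots> \<le> 2 * (sq_integral lborel (\<lambda>x. g n x - f x)) + 2 * (sq_integral lborel (\<lambda>x. g n (x - z) - f (x - z)))"
        by (rule nn_integral_norm_diff_power2_le) simp_all
      also have "(sq_integral lborel (\<lambda>x. g n (x - z) - f (x - z))) = (sq_integral lborel (\<lambda>x. g n x - f x))"
        using nn_integral_lborel_shift[of "\<lambda>x. ennreal ((norm (g n x - f x))\<^sup>2)" "- z"] by simp
      also have "2 * (sq_integral lborel (\<lambda>x. g n x - f x)) + 2 * (sq_integral lborel (\<lambda>x. g n x - f x)) = 4 * (sq_integral lborel (\<lambda>x. g n x - f x))"
        by (simp flip: distrib_right)
      finally show "(sq_integral lborel (\<lambda>x. g n x - g n (x - z) - (f x - f (x - z)))) \<le> 4 * (sq_integral lborel (\<lambda>x. g n x - f x))" .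
    qed
    fix n
    have i: "integrable lborel (\<lambda>x. g n (x - z))"
      using lborel_integrable_shift_iff[of "g n" "- z"] g(1) by simp
    have "(1 - cis (- (z \<bullet> \<xi>))) * fourier_integral (g n) \<xi> = fourier_integral (\<lambda>x. g n x - g n (x - z)) \<xi>" for \<xi>
      by (simp add: fourier_integral_diff[OF g(1) i] fourier_integral_shift left_diff_distrib)
    then show "(sq_integral lborel (\<lambda>\<xi>. (1 - cis (- (z \<bullet> \<xi>))) * fourier_integral (g n) \<xi>)) = (sq_integral lborel (\<lambda>x. g n x - g n (x - z)))"
      using plancherel[of "\<lambda>x. g n x - g n (x - z)"] i g(1)[of n] L2_real_integrable[OF L2_diff[OF g(2) shiftL2[OF g(2)]], of n n] by simp
  qed simp_all
qed

section \<open>The Gagliardo form of the fractional Laplacian\<close>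

text \<open>
  With \<open>q \<rho>\<close> equal to the weight at radius \<open>\<rho>\<close> divided by \<open>\<rho>\<close>, the weight at \<open>z\<close> is at most a constant times
  the integral of \<open>q\<close> over \<open>[|z|, 2|z|]\<close>; Tonelli's theorem then leaves one-dimensional integrals.
\<close>

lemma nn_integral_radial_weight_finite:
  fixes m t :: real
  assumes "0 < t" "t < m"
  shows "(\<integral>\<^sup>+(z::'a::euclidean_space). min 1 (norm z powr m) * norm z powr (- (real DIM('a) + t)) \<partial>lborel) < \<infinity>"
proof -
  define a where "a = real DIM('a) + t"
  define q where "q \<rho> = min 1 (\<rho> powr m) * \<rho> powr (- a - 1)" for \<rho> :: real
  have [measurable]: "q \<in> borel_measurable borel" unfolding q_def by measurable
  have q0: "q \<rho> \<ge> 0" for \<rho> by (simp add: q_def)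
  \<comment> \<open>Chosen so that \<open>C * (2 * r) powr (- a - 1) * r\<close> equals
    \<open>r powr (- a)\<close>: the smallest power on [r, 2r] times the length of that
    interval.\<close>
  define C where "C = 2 powr (a + 1)"
  have a: "a > 0" using assms by (simp add: a_def)
  have le: "ennreal (min 1 (norm z powr m) * norm z powr (- a))
      \<le> ennreal C * (\<integral>\<^sup>+\<rho>. ennreal (q \<rho>) * indicator {norm z..2 * norm z} \<rho> \<partial>lborel)" for z :: 'a
  proof (cases "z = 0")
    case False
    define r where "r = norm z"
    have r: "r > 0" using False by (simp add: r_def)
    \<comment> \<open>A lower bound of \<open>q\<close> on [r, 2r]: the truncated power increases
      and is taken at r, the negative power decreases and is taken at 2r.\<close>
    define b where "b = min 1 (r powr m) * (2 * r) powr (- a - 1)"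
    have "C * (2 * r) powr (- a - 1) * r = (2 powr (a + 1) * 2 powr (- a - 1)) * (r powr (- a - 1) * r powr 1)"
      using r by (simp add: C_def powr_mult)
    also have "\<dots> = r powr (- a)" by (simp only: powr_add[symmetric]) simp
    finally have "min 1 (r powr m) * r powr (- a) = C * (b * r)"
      by (simp add: b_def mult_ac)
    moreover have "b \<ge> 0" "C \<ge> 0" by (simp_all add: b_def C_def)
    ultimately have "ennreal (min 1 (r powr m) * r powr (- a)) = ennreal C * (ennreal b * ennreal r)"
      using r by (simp only: ennreal_mult[symmetric] mult_nonneg_nonneg less_imp_le)
    also have "ennreal b * ennreal r = (\<integral>\<^sup>+\<rho>. ennreal b * indicator {r..2 * r} \<rho> \<partial>lborel)"
      using r by (simp add: nn_integral_cmult)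
    also have "\<dots> \<le> (\<integral>\<^sup>+\<rho>. ennreal (q \<rho>) * indicator {r..2 * r} \<rho> \<partial>lborel)"
    proof (intro nn_integral_mono)
      fix \<rho>
      show "ennreal b * indicator {r..2 * r} \<rho> \<le> ennreal (q \<rho>) * indicator {r..2 * r} \<rho>"
      proof (cases "\<rho> \<in> {r..2*r}")
        case True
        have "min 1 (r powr m) \<le> min 1 (\<rho> powr m)"
          using True r assms by (intro min.mono powr_mono2) auto
        moreover have "(2 * r) powr (- a - 1) \<le> \<rho> powr (- a - 1)"
          using True r a by (intro powr_mono2') auto
        ultimately have "b \<le> q \<rho>" unfolding b_def q_def by (intro mult_mono) auto
        then show ?thesis by (intro mult_right_mono ennreal_leI) auto
      qed simp
    qed
    finally show ?thesis unfolding r_def by (simp add: mult_left_mono)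
  qed simp
  have "(\<integral>\<^sup>+(z::'a). ennreal (min 1 (norm z powr m) * norm z powr (- a)) \<partial>lborel)
     \<le> (\<integral>\<^sup>+(z::'a). ennreal C * (\<integral>\<^sup>+\<rho>. ennreal (q \<rho>) * indicator {norm z..2 * norm z} \<rho> \<partial>lborel) \<partial>lborel)"
    by (intro nn_integral_mono le)
  also have "\<dots> = ennreal C * (\<integral>\<^sup>+(z::'a). \<integral>\<^sup>+\<rho>. ennreal (q \<rho>) * (if norm z \<le> \<rho> \<and> \<rho> \<le> 2 * norm z then 1 else 0) \<partial>lborel \<partial>lborel)"
  proof -
    have "(\<integral>\<^sup>+\<rho>. ennreal (q \<rho>) * indicator {norm z..2 * norm z} \<rho> \<partial>lborel)
        = (\<integral>\<^sup>+\<rho>. ennreal (q \<rho>) * (if norm z \<le> \<rho> \<and> \<rho> \<le> 2 * norm z then 1 else 0) \<partial>lborel)" for z :: 'a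
      by (intro nn_integral_cong) (auto simp: indicator_def)
    then show ?thesis by (simp only:) (rule nn_integral_cmult, measurable)
  qed
  finally have bound: "(\<integral>\<^sup>+(z::'a). ennreal (min 1 (norm z powr m) * norm z powr (- a)) \<partial>lborel)
     \<le> ennreal C * (\<integral>\<^sup>+(z::'a). \<integral>\<^sup>+\<rho>. ennreal (q \<rho>) * (if norm z \<le> \<rho> \<and> \<rho> \<le> 2 * norm z then 1 else 0) \<partial>lborel \<partial>lborel)" .
  have "(\<integral>\<^sup>+(z::'a). \<integral>\<^sup>+\<rho>. ennreal (q \<rho>) * (if norm z \<le> \<rho> \<and> \<rho> \<le> 2 * norm z then 1 else 0) \<partial>lborel \<partial>lborel)
     = (\<integral>\<^sup>+\<rho>. \<integral>\<^sup>+(z::'a). ennreal (q \<rho>) * (if norm z \<le> \<rho> \<and> \<rho> \<le> 2 * norm z then 1 else 0) \<partial>lborel \<partial>lborel)"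
    by (rule lborel_pair.Fubini') measurable
  also have "\<dots> \<le> (\<integral>\<^sup>+\<rho>. ennreal (unit_ball_vol (real DIM('a))) *
      (indicator {0..1} \<rho> * ennreal (\<rho> powr (m - t - 1)) + indicator {1..} \<rho> * ennreal (\<rho> powr (- t - 1))) \<partial>lborel)"
  proof (intro nn_integral_mono)
    fix \<rho> :: real
    have "(\<integral>\<^sup>+(z::'a). ennreal (q \<rho>) * (if norm z \<le> \<rho> \<and> \<rho> \<le> 2 * norm z then 1 else 0) \<partial>lborel)
       \<le> (\<integral>\<^sup>+(z::'a). ennreal (q \<rho>) * indicator (cball 0 \<rho>) z \<partial>lborel)"
      by (intro nn_integral_mono mult_left_mono) auto
    also have "\<dots> = ennreal (q \<rho>) * emeasure lborel (cball (0::'a) \<rho>)"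
      by (rule nn_integral_cmult_indicator) simp
    also have "\<dots> \<le> ennreal (unit_ball_vol (real DIM('a))) *
      (indicator {0..1} \<rho> * ennreal (\<rho> powr (m - t - 1)) + indicator {1..} \<rho> * ennreal (\<rho> powr (- t - 1)))"
    proof (cases "\<rho> > 0")
      case True
      \<comment> \<open>The points \<open>z\<close> that contribute lie in a ball of volume
        proportional to \<open>\<rho> ^ DIM('a)\<close>. What remains behaves like
        \<open>\<rho> powr (m - t - 1)\<close> near 0, integrable since t < m, and like
        \<open>\<rho> powr (- t - 1)\<close> at infinity, integrable since t > 0.\<close>
      have e: "q \<rho> * \<rho> ^ DIM('a) = min 1 (\<rho> powr m) * \<rho> powr (- t - 1)"
        using True by (simp add: q_def a_def powr_diff powr_minus powr_add field_simps flip: powr_realpow)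
      have "min 1 (\<rho> powr m) * \<rho> powr (- t - 1) \<le> indicator {0..1} \<rho> * \<rho> powr (m - t - 1) + indicator {1..} \<rho> * \<rho> powr (- t - 1)"
      proof (cases "\<rho> \<le> 1")
        case le: True
        have "min 1 (\<rho> powr m) * \<rho> powr (- t - 1) \<le> \<rho> powr m * \<rho> powr (- t - 1)" by (intro mult_right_mono) auto
        also have "\<dots> = \<rho> powr (m - t - 1)" by (simp flip: powr_add) (simp add: algebra_simps)
        finally show ?thesis using True le by (simp add: indicator_def)
      qed (use True in \<open>auto simp: mult_le_cancel_right1\<close>)
      then have "ennreal (q \<rho> * \<rho> ^ DIM('a)) \<le> indicator {0..1} \<rho> * ennreal (\<rho> powr (m - t - 1)) + indicator {1..} \<rho> * ennreal (\<rho> powr (- t - 1))"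
      proof -
        assume le: "min 1 (\<rho> powr m) * \<rho> powr (- t - 1) \<le> indicator {0..1} \<rho> * \<rho> powr (m - t - 1) + indicator {1..} \<rho> * \<rho> powr (- t - 1)"
        have "indicator {0..1} \<rho> * ennreal (\<rho> powr (m - t - 1)) + indicator {1..} \<rho> * ennreal (\<rho> powr (- t - 1))
            = ennreal (indicator {0..1} \<rho> * \<rho> powr (m - t - 1) + indicator {1..} \<rho> * \<rho> powr (- t - 1))"
          by (simp add: ennreal_mult ennreal_indicator)
        then show ?thesis using le unfolding e by (simp only:) (rule ennreal_leI)
      qed
      then have "ennreal (unit_ball_vol (real DIM('a))) * ennreal (q \<rho> * \<rho> ^ DIM('a)) \<le> ennreal (unit_ball_vol (real DIM('a))) *
      (indicator {0..1} \<rho> * ennreal (\<rho> powr (m - t - 1)) + indicator {1..} \<rho> * ennreal (\<rho> powr (- t - 1)))"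
        by (intro mult_left_mono) auto
      moreover have "ennreal (q \<rho>) * emeasure lborel (cball (0::'a) \<rho>) = ennreal (unit_ball_vol (real DIM('a))) * ennreal (q \<rho> * \<rho> ^ DIM('a))"
        using True q0[of \<rho>] by (simp add: emeasure_cball ennreal_mult mult_ac)
      ultimately show ?thesis by simp
    next
      case False
      then have "q \<rho> = 0 \<or> cball (0::'a) \<rho> = {}" by (auto simp: q_def)
      then show ?thesis by auto
    qed
    finally show "(\<integral>\<^sup>+(z::'a). ennreal (q \<rho>) * (if norm z \<le> \<rho> \<and> \<rho> \<le> 2 * norm z then 1 else 0) \<partial>lborel)
      \<le> ennreal (unit_ball_vol (real DIM('a))) *
      (indicator {0..1} \<rho> * ennreal (\<rho> powr (m - t - 1)) + indicator {1..} \<rho> * ennreal (\<rho> powr (- t - 1)))" .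
  qed
  also have "\<dots> = ennreal (unit_ball_vol (real DIM('a))) *
      ((\<integral>\<^sup>+\<rho>. indicator {0..1} \<rho> * ennreal (\<rho> powr (m - t - 1)) \<partial>lborel) + (\<integral>\<^sup>+\<rho>. indicator {1..} \<rho> * ennreal (\<rho> powr (- t - 1)) \<partial>lborel))"
    by (subst nn_integral_cmult) (auto simp: nn_integral_add)
  also have "\<dots> < \<infinity>"
  proof -
    have "((\<lambda>\<rho>. \<rho> powr (m - t - 1)) has_integral (1 powr (m - t - 1 + 1) / (m - t - 1 + 1))) {0..1}"
      using assms by (intro has_integral_powr_from_0) auto
    then have 1: "(\<integral>\<^sup>+\<rho>. indicator {0..1} \<rho> * ennreal (\<rho> powr (m - t - 1)) \<partial>lborel) < \<infinity>"
      using nn_integral_has_integral_lebesgue'[of "{0..1}" "\<lambda>\<rho>. \<rho> powr (m - t - 1)"] by (simp add: mult.commute)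
    have "((\<lambda>\<rho>. \<rho> powr (- t - 1)) has_integral - (1 powr (- t - 1 + 1)) / (- t - 1 + 1)) {1..}"
      using assms by (intro has_integral_powr_to_inf) auto
    then have 2: "(\<integral>\<^sup>+\<rho>. indicator {1..} \<rho> * ennreal (\<rho> powr (- t - 1)) \<partial>lborel) < \<infinity>"
      using nn_integral_has_integral_lebesgue'[of "{1..}" "\<lambda>\<rho>. \<rho> powr (- t - 1)"] by (simp add: mult.commute)
    show ?thesis using 1 2 by (simp add: ennreal_mult_less_top)
  qed
  finally have "ennreal C * (\<integral>\<^sup>+(z::'a). \<integral>\<^sup>+\<rho>. ennreal (q \<rho>) * (if norm z \<le> \<rho> \<and> \<rho> \<le> 2 * norm z then 1 else 0) \<partial>lborel \<partial>lborel) < \<infinity>"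
    by (simp add: ennreal_mult_less_top)
  with bound show ?thesis unfolding a_def by (rule le_less_trans)
qed

text \<open>The vector \<open>axis undefined 1\<close> is an arbitrary unit vector; by rotation
  invariance its choice does not affect the value. The type argument supplies the dimension.\<close>

definition levy_const :: "('n::finite) itself \<Rightarrow> real \<Rightarrow> real" where
  "levy_const _ t = enn2real (\<integral>\<^sup>+z. ennreal ((1 - cos (z \<bullet> axis undefined 1)) * norm z powr (- (real CARD('n) + t))) \<partial>(lborel :: (real^'n) measure))"

lemma one_minus_cos_le: "1 - cos x \<le> 2 * min 1 (x\<^sup>2)" for x :: real
proof -
  have "sin (x / 2) ^ 2 \<le> (x / 2)\<^sup>2"
    using abs_sin_x_le_abs_x[of "x / 2"] by (metis abs_ge_zero power2_abs power_mono)
  moreover have "cos x = 1 - 2 * (sin (x / 2))\<^sup>2" using cos_double_sin[of "x / 2"] by simp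
  moreover have "(x / 2)\<^sup>2 \<le> x\<^sup>2" by (simp add: power_divide)
  moreover have "1 - cos x \<le> 2" using cos_ge_minus_one[of x] by linarith
  ultimately show ?thesis by (auto simp: min_def)
qed

text \<open>The integral is invariant under rotations of \<open>\<xi>\<close> and homogeneous of
  degree t in it, so everything reduces to one unit vector. There it is finite because 1 - cos is
  bounded and vanishes to second order at 0 (this needs 0 < t < 2), and positive because the
  integrand is positive near that vector.\<close>

lemma
  fixes t :: real
  assumes t: "0 < t" "t < 2"
  shows levy_const_pos: "levy_const TYPE('n::finite) t > 0"
    and nn_integral_one_minus_cos: "(\<integral>\<^sup>+z. ennreal ((1 - cos (z \<bullet> \<xi>)) * norm z powr (- (real CARD('n) + t))) \<partial>lborel)
      = ennreal (levy_const TYPE('n) t * norm (\<xi> :: real^'n) powr t)"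
proof -
  define a where "a = real CARD('n) + t"
  define e :: "real^'n" where "e = axis undefined 1"
  have e: "norm e = 1" using norm_axis_1[of undefined] by (simp add: e_def)
  define J where "J \<xi> = (\<integral>\<^sup>+z. ennreal ((1 - cos (z \<bullet> \<xi>)) * norm z powr (- a)) \<partial>lborel)" for \<xi> :: "real^'n"
  have "J e \<le> (\<integral>\<^sup>+(z::real^'n). ennreal (2 * (min 1 (norm z powr 2) * norm z powr (- a))) \<partial>lborel)"
    unfolding J_def
  proof (intro nn_integral_mono ennreal_leI)
    fix z :: "real^'n"
    have "1 - cos (z \<bullet> e) \<le> 2 * min 1 ((z \<bullet> e)\<^sup>2)" by (rule one_minus_cos_le)
    also have "(z \<bullet> e)\<^sup>2 \<le> (norm z)\<^sup>2"
      using Cauchy_Schwarz_ineq2[of z e] e by (metis abs_ge_zero mult.right_neutral power2_abs power_mono)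
    finally have "1 - cos (z \<bullet> e) \<le> 2 * min 1 (norm z powr 2)" by (cases "z = 0") auto
    then show "(1 - cos (z \<bullet> e)) * norm z powr (- a) \<le> 2 * (min 1 (norm z powr 2) * norm z powr (- a))"
      by (metis mult.assoc mult_right_mono powr_ge_zero)
  qed
  also have "\<dots> < \<infinity>"
    using nn_integral_radial_weight_finite[OF t, where 'a = "real^'n"]
    by (simp add: ennreal_mult nn_integral_cmult a_def ennreal_mult_less_top)
  finally have fin: "J e < \<infinity>" .
  have "J e \<noteq> 0"
  proof
    assume "J e = 0"
    then have "AE z in lborel. ennreal ((1 - cos (z \<bullet> e)) * norm z powr (- a)) = 0"
      unfolding J_def by (subst (asm) nn_integral_0_iff_AE) auto
    \<comment> \<open>On this ball \<open>z \<bullet> e\<close> lies between 0 and 2, hence inside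
      (0, pi), where cos is less than 1. A vanishing integral would make the ball a null
      set.\<close>
    then have "AE z in lborel. z \<notin> ball e (1 / 2)"
    proof eventually_elim
      case (elim z)
      show ?case
      proof
        assume z: "z \<in> ball e (1 / 2)"
        have "\<bar>(z - e) \<bullet> e\<bar> \<le> norm (z - e)" using Cauchy_Schwarz_ineq2[of "z - e" e] e by simp
        also have "\<dots> < 1 / 2" using z by (simp add: dist_norm norm_minus_commute)
        finally have "\<bar>z \<bullet> e - 1\<bar> < 1 / 2" using e by (simp add: inner_diff_left dot_square_norm)
        then have b: "0 < z \<bullet> e" "z \<bullet> e < 2" by linarith+
        then have "cos (z \<bullet> e) < cos 0" using pi_gt3 by (intro cos_monotone_0_pi) auto
        moreover have "z \<noteq> 0" using b by auto
        ultimately show False using elim by (auto simp: ennreal_eq_0_iff mult_le_0_iff)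
      qed
    qed
    then have "emeasure lborel (ball e (1 / 2)) = 0" by (subst (asm) AE_iff_null_sets[symmetric]) auto
    then show False using content_ball_pos[of "1 / 2" e] by (simp add: measure_def)
  qed
  then have k: "levy_const TYPE('n) t > 0" "ennreal (levy_const TYPE('n) t) = J e"
    using fin by (auto simp: levy_const_def J_def e_def a_def enn2real_positive_iff less_top zero_less_iff_neq_zero)
  show "levy_const TYPE('n) t > 0" by (rule k)
  have "J \<xi> = J e * ennreal (norm \<xi> powr t)"
  proof (cases "\<xi> = 0")
    case False
    define r where "r = norm \<xi>"
    have r: "r > 0" using False by (simp add: r_def)
    obtain T :: "real^'n \<Rightarrow> real^'n" where T: "orthogonal_transformation T" "T (r *\<^sub>R e) = \<xi>"
      by (rule orthogonal_transformation_exists[of "r *\<^sub>R e" \<xi>]) (use e r in \<open>auto simp: r_def\<close>)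
    have "J \<xi> = (\<integral>\<^sup>+z. ennreal ((1 - cos (T z \<bullet> \<xi>)) * norm (T z) powr (- a)) \<partial>lborel)"
      unfolding J_def by (rule nn_integral_lborel_orthogonal[OF T(1), symmetric]) measurable
    also have "\<dots> = (\<integral>\<^sup>+z. ennreal ((1 - cos (r * (z \<bullet> e))) * norm z powr (- a)) \<partial>lborel)"
    proof -
      have "T z \<bullet> T (r *\<^sub>R e) = r * (z \<bullet> e)" for z
        using T(1) by (simp add: orthogonal_transformation_def)
      then show ?thesis
        unfolding T(2)[symmetric] by (simp add: orthogonal_transformation_norm[OF T(1)])
    qed
    \<comment> \<open>Substituting r z for z produces r^N from the volume and r^(-a) from the
      weight, together r^(-t).\<close>
    also have "\<dots> = ennreal (r powr t) * J e"
    proof -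
      have "J e = ennreal (\<bar>r\<bar> ^ DIM(real^'n)) * (\<integral>\<^sup>+z. ennreal ((1 - cos ((0 + r *\<^sub>R z) \<bullet> e)) * norm (0 + r *\<^sub>R z) powr (- a)) \<partial>lborel)"
        unfolding J_def by (rule nn_integral_lborel_affine) (use r in auto)
      also have "\<dots> = ennreal (r ^ CARD('n)) * (\<integral>\<^sup>+z. ennreal (r powr (- a)) * ennreal ((1 - cos (r * (z \<bullet> e))) * norm z powr (- a)) \<partial>lborel)"
        using r by (simp add: powr_mult ennreal_mult'[symmetric] mult_ac)
      also have "\<dots> = ennreal (r ^ CARD('n)) * ennreal (r powr (- a)) * (\<integral>\<^sup>+z. ennreal ((1 - cos (r * (z \<bullet> e))) * norm z powr (- a)) \<partial>lborel)"
        by (simp add: nn_integral_cmult mult.assoc)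
      also have "ennreal (r ^ CARD('n)) * ennreal (r powr (- a)) = ennreal (r powr (- t))"
        using r by (simp add: ennreal_mult[symmetric] a_def flip: powr_realpow powr_add)
      finally have "ennreal (r powr t) * J e = (ennreal (r powr t) * ennreal (r powr (- t))) * (\<integral>\<^sup>+z. ennreal ((1 - cos (r * (z \<bullet> e))) * norm z powr (- a)) \<partial>lborel)"
        by (simp add: mult.assoc)
      also have "ennreal (r powr t) * ennreal (r powr (- t)) = 1"
        using r by (simp add: ennreal_mult[symmetric] flip: powr_add)
      finally show ?thesis by simp
    qed
    finally show ?thesis by (simp add: r_def mult.commute)
  qed (simp add: J_def)
  then show "(\<integral>\<^sup>+z. ennreal ((1 - cos (z \<bullet> \<xi>)) * norm z powr (- (real CARD('n) + t))) \<partial>lborel)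
      = ennreal (levy_const TYPE('n) t * norm \<xi> powr t)"
    using k by (simp add: J_def a_def ennreal_mult less_imp_le)
qed

lemma norm_one_minus_cis: "(norm (1 - cis x))\<^sup>2 = 2 * (1 - cos x)"
proof -
  have "(norm (1 - cis x))\<^sup>2 = (1 - cos x)\<^sup>2 + (sin x)\<^sup>2" by (simp add: cmod_power2)
  also have "\<dots> = 1 - 2 * cos x + ((cos x)\<^sup>2 + (sin x)\<^sup>2)" by (simp add: power2_diff)
  also have "(cos x)\<^sup>2 + (sin x)\<^sup>2 = 1" by simp
  finally show ?thesis by simp
qed

text \<open>The polarised Gagliardo integrand, on pairs because Fubini and exchange of the variables
  are used on the product measure. On the diagonal it is 0.\<close>

definition gagliardo :: "real \<Rightarrow> (real^'n \<Rightarrow> real) \<Rightarrow> (real^'n \<Rightarrow> real) \<Rightarrow> ((real^'n) \<times> (real^'n)) \<Rightarrow> real" where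
  "gagliardo s u v = (\<lambda>(x, y). (u x - u y) * (v x - v y) * norm (x - y) powr (- (real CARD('n) + 2 * s)))"

lemma borel_measurable_gagliardo[measurable]:
  fixes u v :: "real^'n \<Rightarrow> real"
  assumes [measurable]: "u \<in> borel_measurable borel" "v \<in> borel_measurable borel"
  shows "gagliardo s u v \<in> borel_measurable lborel2"
  unfolding gagliardo_def by measurable

text \<open>With y = x - z the inner integral is the squared norm of an increment of
  \<open>u\<close>, which Plancherel's theorem expresses by the transform of \<open>u\<close>.
  Everything is nonnegative, so the \<open>z\<close>-integral may be done first; it turns 1 - cos
  into a multiple of the squared symbol. The factor 2 comes from |1 - cis t|^2 = 2 (1 - cos
  t).\<close>

lemma frac_laplacian_norm:
  fixes u :: "real^'n \<Rightarrow> real"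
  assumes s: "0 < s" "s < 1" and ug: "has_frac_laplacian (s / 2) u g"
  shows "(\<integral>\<^sup>+p. gagliardo s u u p \<partial>lborel2) = ennreal (2 * levy_const TYPE('n) (2 * s)) * (sq_integral lborel g)"
proof -
  obtain U G where U: "has_L2_fourier u U" and G: "has_L2_fourier g G"
    and GU: "AE \<xi> in lborel. G \<xi> = of_real (norm \<xi> powr s) * U \<xi>"
    using ug by (auto simp: has_frac_laplacian_def)
  note [measurable] = has_L2_fourier_L2[OF U, THEN L2_measurable] has_L2_fourier_L2[OF G, THEN L2_measurable]
  define w where "w z = norm z powr (- (real CARD('n) + 2 * s))" for z :: "real^'n"
  define k where "k = levy_const TYPE('n) (2 * s)"
  have k: "k > 0" unfolding k_def by (rule levy_const_pos) (use s in auto)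
  have [measurable]: "w \<in> borel_measurable borel" unfolding w_def by measurable
  have w: "w z \<ge> 0" for z by (simp add: w_def)
  have "(\<integral>\<^sup>+p. gagliardo s u u p \<partial>lborel2) = (\<integral>\<^sup>+x. \<integral>\<^sup>+y. gagliardo s u u (x, y) \<partial>lborel \<partial>lborel)"
    by (rule lborel.nn_integral_fst[symmetric]) measurable
  also have "\<dots> = (\<integral>\<^sup>+x. \<integral>\<^sup>+z. ennreal ((u x - u (x - z))\<^sup>2 * w z) \<partial>lborel \<partial>lborel)"
  proof (rule nn_integral_cong)
    fix x
    show "(\<integral>\<^sup>+y. gagliardo s u u (x, y) \<partial>lborel) = (\<integral>\<^sup>+z. ennreal ((u x - u (x - z))\<^sup>2 * w z) \<partial>lborel)"
      using nn_integral_lborel_reflect[of "\<lambda>y. ennreal (gagliardo s u u (x, y))" x]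
      by (simp add: gagliardo_def w_def power2_eq_square)
  qed
  also have "\<dots> = (\<integral>\<^sup>+z. \<integral>\<^sup>+x. ennreal ((u x - u (x - z))\<^sup>2 * w z) \<partial>lborel \<partial>lborel)"
    by (rule lborel_pair.Fubini'[symmetric]) measurable
  also have "\<dots> = (\<integral>\<^sup>+z. ennreal (w z) * (sq_integral lborel (\<lambda>x. u x - u (x - z))) \<partial>lborel)"
    by (simp add: ennreal_mult w nn_integral_multc mult.commute[of _ "ennreal (w _)"] nn_integral_cmult)
  also have "\<dots> = (\<integral>\<^sup>+z. ennreal (w z) * (sq_integral lborel (\<lambda>\<xi>. (1 - cis (- (z \<bullet> \<xi>))) * U \<xi>)) \<partial>lborel)"
    by (simp only: has_L2_fourier_increment[OF U])
  also have "\<dots> = (\<integral>\<^sup>+z. (\<integral>\<^sup>+\<xi>. ennreal (2 * (norm (U \<xi>))\<^sup>2) * ennreal ((1 - cos (z \<bullet> \<xi>)) * w z) \<partial>lborel) \<partial>lborel)"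
  proof (rule nn_integral_cong)
    fix z
    have "ennreal (w z) * (sq_integral lborel (\<lambda>\<xi>. (1 - cis (- (z \<bullet> \<xi>))) * U \<xi>))
        = (\<integral>\<^sup>+\<xi>. ennreal (w z) * (norm ((1 - cis (- (z \<bullet> \<xi>))) * U \<xi>))\<^sup>2 \<partial>lborel)"
      by (rule nn_integral_cmult[symmetric]) measurable
    also have "\<dots> = (\<integral>\<^sup>+\<xi>. ennreal (2 * (norm (U \<xi>))\<^sup>2) * ennreal ((1 - cos (z \<bullet> \<xi>)) * w z) \<partial>lborel)"
      using w by (intro nn_integral_cong) (simp add: norm_mult power_mult_distrib norm_one_minus_cis mult_ac flip: ennreal_mult)
    finally show "ennreal (w z) * (sq_integral lborel (\<lambda>\<xi>. (1 - cis (- (z \<bullet> \<xi>))) * U \<xi>))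
      = (\<integral>\<^sup>+\<xi>. ennreal (2 * (norm (U \<xi>))\<^sup>2) * ennreal ((1 - cos (z \<bullet> \<xi>)) * w z) \<partial>lborel)" .
  qed
  also have "\<dots> = (\<integral>\<^sup>+\<xi>. (\<integral>\<^sup>+z. ennreal (2 * (norm (U \<xi>))\<^sup>2) * ennreal ((1 - cos (z \<bullet> \<xi>)) * w z) \<partial>lborel) \<partial>lborel)"
    by (rule lborel_pair.Fubini') measurable
  also have "\<dots> = (\<integral>\<^sup>+\<xi>. ennreal (2 * (norm (U \<xi>))\<^sup>2) * ennreal (k * norm \<xi> powr (2 * s)) \<partial>lborel)"
    using nn_integral_one_minus_cos[of "2 * s", where 'n = 'n] s unfolding w_def k_def
    by (subst nn_integral_cmult) simp_all
  also have "\<dots> = (\<integral>\<^sup>+\<xi>. ennreal (2 * k) * ennreal ((norm (G \<xi>))\<^sup>2) \<partial>lborel)"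
  proof (rule nn_integral_cong_AE)
    show "AE \<xi> in lborel. ennreal (2 * (norm (U \<xi>))\<^sup>2) * ennreal (k * norm \<xi> powr (2 * s)) = ennreal (2 * k) * ennreal ((norm (G \<xi>))\<^sup>2)"
      using GU
    proof eventually_elim
      case (elim \<xi>)
      have "(norm \<xi> powr s)\<^sup>2 = norm \<xi> powr (2 * s)" by (simp add: power2_eq_square flip: powr_add)
      then have "2 * (norm (U \<xi>))\<^sup>2 * (k * norm \<xi> powr (2 * s)) = 2 * k * (norm (G \<xi>))\<^sup>2"
        by (simp add: elim norm_mult power_mult_distrib)
      then show ?case using k by (simp flip: ennreal_mult)
    qed
  qed
  also have "\<dots> = ennreal (2 * k) * (sq_integral lborel G)"
    by (rule nn_integral_cmult) measurable
  also have "(sq_integral lborel G) = (sq_integral lborel g)"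
    by (rule has_L2_fourier_plancherel[OF G])
  finally show ?thesis unfolding k_def .
qed

lemma has_frac_laplacian_L2:
  assumes "has_frac_laplacian t u g"
  shows "u \<in> L2" "g \<in> L2"
  using assms by (auto simp: has_frac_laplacian_def dest: has_L2_fourier_L2)

lemma has_frac_laplacian_add:
  assumes "has_frac_laplacian t u g" "has_frac_laplacian t v h"
  shows "has_frac_laplacian t (\<lambda>x. u x + v x) (\<lambda>x. g x + h x)"
proof -
  obtain U G where U: "has_L2_fourier u U" and G: "has_L2_fourier g G"
    and GU: "AE \<xi> in lborel. G \<xi> = of_real (norm \<xi> powr (2 * t)) * U \<xi>"
    using assms(1) by (auto simp: has_frac_laplacian_def)
  obtain V H where V: "has_L2_fourier v V" and H: "has_L2_fourier h H"
    and HV: "AE \<xi> in lborel. H \<xi> = of_real (norm \<xi> powr (2 * t)) * V \<xi>"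
    using assms(2) by (auto simp: has_frac_laplacian_def)
  have "AE \<xi> in lborel. G \<xi> + H \<xi> = of_real (norm \<xi> powr (2 * t)) * (U \<xi> + V \<xi>)"
    using GU HV by eventually_elim (simp add: distrib_left)
  then show ?thesis
    unfolding has_frac_laplacian_def using has_L2_fourier_add[OF U V] has_L2_fourier_add[OF G H] by blast
qed

lemma gagliardo_norm:
  fixes u :: "real^'n \<Rightarrow> real"
  assumes s: "0 < s" "s < 1" and ug: "has_frac_laplacian (s / 2) u g"
  shows "integrable lborel2 (gagliardo s u u)"
    and "(\<integral>p. gagliardo s u u p \<partial>lborel2) = 2 * levy_const TYPE('n) (2 * s) * (\<integral>x. (g x)\<^sup>2 \<partial>lborel)"
proof -
  define k where "k = 2 * levy_const TYPE('n) (2 * s)"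
  have k: "k > 0" unfolding k_def using levy_const_pos[of "2 * s", where 'n = 'n] s by simp
  note L = has_frac_laplacian_L2[OF ug]
  note [measurable] = L[THEN L2_measurable]
  have nonneg: "gagliardo s u u p \<ge> 0" for p by (cases p) (simp add: gagliardo_def)
  have eq: "(\<integral>\<^sup>+p. gagliardo s u u p \<partial>lborel2) = ennreal (k * (\<integral>x. (g x)\<^sup>2 \<partial>lborel))"
    using frac_laplacian_norm[OF assms] L2_real_integrable[OF L(2)] k
    by (simp add: nn_integral_eq_integral k_def ennreal_mult)
  then show "integrable lborel2 (gagliardo s u u)"
    using nonneg by (intro integrableI_nonneg) auto
  then show "(\<integral>p. gagliardo s u u p \<partial>lborel2) = 2 * levy_const TYPE('n) (2 * s) * (\<integral>x. (g x)\<^sup>2 \<partial>lborel)"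
    using eq k nonneg by (simp add: nn_integral_eq_integral k_def)
qed

text \<open>Polarisation of \<open>gagliardo_norm\<close>, with
  \<open>has_frac_laplacian_add\<close> for the sum. This converts the left side of the weak
  equation into a double integral.\<close>

lemma gagliardo_inner:
  fixes u v :: "real^'n \<Rightarrow> real"
  assumes s: "0 < s" "s < 1" and ug: "has_frac_laplacian (s / 2) u g" and vh: "has_frac_laplacian (s / 2) v h"
  shows "integrable lborel2 (gagliardo s u v)"
    and "(\<integral>p. gagliardo s u v p \<partial>lborel2) = 2 * levy_const TYPE('n) (2 * s) * (\<integral>x. g x * h x \<partial>lborel)"
proof -
  define k where "k = 2 * levy_const TYPE('n) (2 * s)"
  note L = has_frac_laplacian_L2[OF ug] has_frac_laplacian_L2[OF vh]
  note [measurable] = L[THEN L2_measurable]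
  note I = L[THEN L2_real_integrable]
  note N = gagliardo_norm[OF s ug] gagliardo_norm[OF s vh] gagliardo_norm[OF s has_frac_laplacian_add[OF ug vh]]
  have gh: "integrable lborel (\<lambda>x. g x * h x)" by (rule integrable_mult_L2) (use I in auto)
  have eq: "gagliardo s u v = (\<lambda>p. (1 / 2) * (gagliardo s (\<lambda>x. u x + v x) (\<lambda>x. u x + v x) p - gagliardo s u u p - gagliardo s v v p))"
    by (auto simp: gagliardo_def fun_eq_iff algebra_simps)
  show "integrable lborel2 (gagliardo s u v)"
    unfolding eq using N by (intro integrable_mult_right Bochner_Integration.integrable_diff)
  have "(\<integral>p. gagliardo s u v p \<partial>lborel2) = (1 / 2) * (k * (\<integral>x. (g x + h x)\<^sup>2 \<partial>lborel) - k * (\<integral>x. (g x)\<^sup>2 \<partial>lborel) - k * (\<integral>x. (h x)\<^sup>2 \<partial>lborel))"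
    unfolding eq using N by (simp add: k_def)
  also have "(\<integral>x. (g x + h x)\<^sup>2 \<partial>lborel) = (\<integral>x. (g x)\<^sup>2 + (h x)\<^sup>2 + 2 * (g x * h x) \<partial>lborel)"
    by (simp add: power2_sum mult.assoc)
  also have "\<dots> = (\<integral>x. (g x)\<^sup>2 \<partial>lborel) + (\<integral>x. (h x)\<^sup>2 \<partial>lborel) + 2 * (\<integral>x. g x * h x \<partial>lborel)"
    using I gh by simp
  finally show "(\<integral>p. gagliardo s u v p \<partial>lborel2) = 2 * levy_const TYPE('n) (2 * s) * (\<integral>x. g x * h x \<partial>lborel)"
    by (simp add: k_def algebra_simps)
qed

section \<open>Lipschitz functions with compact support\<close>

lemma norm_one_minus_cis_le: "norm (1 - cis x) \<le> 2 * min 1 \<bar>x\<bar>"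
proof (rule power2_le_imp_le)
  have "(norm (1 - cis x))\<^sup>2 \<le> 2 * (2 * min 1 (x\<^sup>2))"
    using one_minus_cos_le[of x] by (simp add: norm_one_minus_cis)
  also have "min 1 (x\<^sup>2) = (min 1 \<bar>x\<bar>)\<^sup>2"
  proof (cases "\<bar>x\<bar> \<le> 1")
    case True
    then show ?thesis by (simp add: min_absorb2 abs_square_le_1)
  next
    case False
    then have "1 \<le> x\<^sup>2" using power_mono[of 1 "\<bar>x\<bar>" 2] by simp
    then show ?thesis using False by (simp add: min_def)
  qed
  finally show "(norm (1 - cis x))\<^sup>2 \<le> (2 * min 1 \<bar>x\<bar>)\<^sup>2" by (simp add: power_mult_distrib)
qed simp

text \<open>For order s < 1 the first-order bound on 1 - cis already makes the integrand absolutely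
  integrable, with no principal value. The real part is \<open>nn_integral_one_minus_cos\<close>;
  the imaginary part is the integral of an odd function.\<close>

lemma integral_one_minus_cis:
  fixes \<xi> :: "real^'n" and s :: real
  assumes s: "0 < s" "s < 1"
  shows "(\<integral>z. (1 - cis (- (z \<bullet> \<xi>))) * of_real (norm z powr (- (real CARD('n) + s))) \<partial>lborel)
      = of_real (levy_const TYPE('n) s * norm \<xi> powr s)"
proof -
  define w where "w z = norm z powr (- (real CARD('n) + s))" for z :: "real^'n"
  have [measurable]: "w \<in> borel_measurable borel" unfolding w_def by measurable
  have w: "w z \<ge> 0" for z by (simp add: w_def)
  have "integrable lborel (\<lambda>z::real^'n. min 1 (norm z powr 1) * w z)"
    using nn_integral_radial_weight_finite[of s 1, where 'a = "real^'n"] s w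
    by (intro integrableI_nonneg) (auto simp: w_def)
  then have W: "integrable lborel (\<lambda>z::real^'n. (2 * (1 + norm \<xi>)) * (min 1 (norm z) * w z))"
    by (intro integrable_mult_right) simp
  have int: "integrable lborel (\<lambda>z. (1 - cis (- (z \<bullet> \<xi>))) * of_real (w z))"
  proof (rule Bochner_Integration.integrable_bound[OF W])
    show "AE z in lborel. norm ((1 - cis (- (z \<bullet> \<xi>))) * complex_of_real (w z)) \<le> norm ((2 * (1 + norm \<xi>)) * (min 1 (norm z) * w z))"
    proof (intro AE_I2)
      fix z
      have "norm (1 - cis (- (z \<bullet> \<xi>))) \<le> 2 * min 1 \<bar>z \<bullet> \<xi>\<bar>" using norm_one_minus_cis_le[of "- (z \<bullet> \<xi>)"] by simp
      also have "min 1 \<bar>z \<bullet> \<xi>\<bar> \<le> (1 + norm \<xi>) * min 1 (norm z)"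
      proof -
        have "\<bar>z \<bullet> \<xi>\<bar> \<le> norm z * norm \<xi>" by (rule Cauchy_Schwarz_ineq2)
        then have "\<bar>z \<bullet> \<xi>\<bar> \<le> (1 + norm \<xi>) * norm z" by (simp add: algebra_simps add_increasing)
        then show ?thesis using norm_ge_zero[of \<xi>] by (auto simp: min_def simp del: norm_ge_zero)
      qed
      finally have "norm (1 - cis (- (z \<bullet> \<xi>))) \<le> (2 * (1 + norm \<xi>)) * min 1 (norm z)" by (simp only: mult.assoc)
      then have "norm (1 - cis (- (z \<bullet> \<xi>))) * w z \<le> (2 * (1 + norm \<xi>)) * min 1 (norm z) * w z"
        using w by (intro mult_right_mono)
      then show "norm ((1 - cis (- (z \<bullet> \<xi>))) * complex_of_real (w z)) \<le> norm ((2 * (1 + norm \<xi>)) * (min 1 (norm z) * w z))"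
        using w[of z] by (simp add: norm_mult abs_mult mult.assoc)
    qed
  qed measurable
  define I where "I = (\<integral>z. (1 - cis (- (z \<bullet> \<xi>))) * of_real (w z) \<partial>lborel)"
  have "Re I = (\<integral>z. Re ((1 - cis (- (z \<bullet> \<xi>))) * of_real (w z)) \<partial>lborel)"
    unfolding I_def by (rule integral_Re[OF int, symmetric])
  also have "\<dots> = (\<integral>z. (1 - cos (z \<bullet> \<xi>)) * w z \<partial>lborel)" by simp
  also have "\<dots> = enn2real (\<integral>\<^sup>+z. ennreal ((1 - cos (z \<bullet> \<xi>)) * w z) \<partial>lborel)"
    using w by (intro integral_eq_nn_integral) auto
  also have "\<dots> = levy_const TYPE('n) s * norm \<xi> powr s"
    using nn_integral_one_minus_cos[of s \<xi>] levy_const_pos[of s, where 'n = 'n] s by (simp add: w_def)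
  finally have re: "Re I = levy_const TYPE('n) s * norm \<xi> powr s" .
  have "Im I = (\<integral>z. Im ((1 - cis (- (z \<bullet> \<xi>))) * of_real (w z)) \<partial>lborel)"
    unfolding I_def by (rule integral_Im[OF int, symmetric])
  also have "\<dots> = (\<integral>z. sin (z \<bullet> \<xi>) * w z \<partial>lborel)" by simp
  finally have im: "Im I = (\<integral>z. sin (z \<bullet> \<xi>) * w z \<partial>lborel)" .
  also have "\<dots> = (\<integral>z. sin ((0 - z) \<bullet> \<xi>) * w (0 - z) \<partial>lborel)"
    by (rule lborel_integral_reflect[symmetric])
  also have "\<dots> = - (\<integral>z. sin (z \<bullet> \<xi>) * w z \<partial>lborel)" by (simp add: w_def)
  finally have "Im I = 0" using im by simp
  with re have "I = of_real (levy_const TYPE('n) s * norm \<xi> powr s)" by (simp add: complex_eq_iff)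
  then show ?thesis unfolding I_def w_def .
qed

text \<open>
  The fractional Laplacian of order \<open>s < 1\<close> of such a function is given by an absolutely convergent singular
  integral, which is bounded and integrable.
\<close>

lemma sobolev_H_compact_lipschitz:
  fixes v :: "real^'n \<Rightarrow> real"
  assumes s: "0 < s" "s < 1" and L: "\<And>x y. \<bar>v x - v y\<bar> \<le> L * norm (x - y)"
    and R: "\<And>x. norm x \<ge> R \<Longrightarrow> v x = 0" "R > 0"
  shows "v \<in> sobolev_H s"
proof -
  \<comment> \<open>That L is nonnegative follows from the Lipschitz condition at two distinct
    points.\<close>
  have "L * norm (axis undefined 1 :: real^'n) \<ge> 0"
    using order_trans[OF abs_ge_zero L[of "axis undefined 1" 0]] by simp
  then have L0: "L \<ge> 0" by simp
  define M where "M = L * (2 * R)"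
  have M0: "M \<ge> 0" using L0 R(2) by (simp add: M_def)
  have M: "\<bar>v x\<bar> \<le> M * indicator (cball 0 R) x" for x
  proof (cases "norm x \<le> R")
    case True
    \<comment> \<open>A point of norm R, where \<open>v\<close> vanishes, lies within 2R of every
      point of the ball; this explains \<open>M\<close>.\<close>
    have "v (R *\<^sub>R axis undefined 1) = 0" using R by (intro R(1)) simp
    then have "\<bar>v x\<bar> \<le> L * norm (x - R *\<^sub>R axis undefined 1)" using L[of x "R *\<^sub>R axis undefined 1"] by simp
    also have "norm (x - R *\<^sub>R axis undefined 1) \<le> norm x + norm (R *\<^sub>R (axis undefined 1 :: real^'n))" by (rule norm_triangle_ineq4)
    also have "\<dots> \<le> 2 * R" using True R(2) by simp
    finally show ?thesis using L0 True by (simp add: M_def mult_left_mono)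
  qed (simp add: R(1))
  have M': "\<bar>v x\<bar> \<le> M" for x using M[of x] M0 by (cases "norm x \<le> R") auto
  have "continuous_on UNIV v"
  proof (rule continuous_on_subset[OF lipschitz_on_continuous_on])
    show "L-lipschitz_on UNIV v" using L L0 by (auto simp: lipschitz_on_def dist_norm)
  qed simp
  then have [measurable]: "v \<in> borel_measurable borel" by (rule borel_measurable_continuous_onI)
  have vint: "integrable lborel v"
    by (rule Bochner_Integration.integrable_bound[OF integrable_mult_right[OF integrable_indicator_cball, of M 0 R]])
       (use M M0 in \<open>auto simp: abs_mult\<close>)
  have vL2: "v \<in> L2"
  proof -
    have "integrable lborel (\<lambda>x. (v x)\<^sup>2)"
    proof (rule Bochner_Integration.integrable_bound[OF integrable_mult_right[OF vint, of M]])
      show "AE x in lborel. norm ((v x)\<^sup>2) \<le> norm (M * v x)"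
        using mult_right_mono[OF M' abs_ge_zero] M0
        by (intro AE_I2) (simp only: power2_eq_square abs_mult real_norm_def abs_of_nonneg)
    qed measurable
    then show ?thesis by (simp add: L2_def)
  qed
  \<comment> \<open>The exponent is N + s, not N + 2s as in \<open>gagliardo\<close>: this is the
    kernel of the operator with symbol |\<xi>|^s itself, not that of its squared norm.\<close>
  define w where "w z = norm z powr (- (real CARD('n) + s))" for z :: "real^'n"
  have [measurable]: "w \<in> borel_measurable borel" unfolding w_def by measurable
  have w: "w z \<ge> 0" for z by (simp add: w_def)
  define K where "K = 2 * M + L"
  have K0: "K \<ge> 0" using M0 L0 by (simp add: K_def)
  define W where "W z = min 1 (norm z) * w z" for z
  have [measurable]: "W \<in> borel_measurable borel" unfolding W_def by measurable
  have W0: "W z \<ge> 0" for z using w by (simp add: W_def)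
  have Wfin: "(\<integral>\<^sup>+z. ennreal (W z) \<partial>lborel) < \<infinity>"
    using nn_integral_radial_weight_finite[of s 1, where 'a = "real^'n"] s by (simp add: W_def w_def)
  then have Wint: "integrable lborel W" using W0 by (intro integrableI_nonneg) auto
  define F where "F x z = (v x - v (x - z)) * w z" for x z
  have FK: "\<bar>v x - v (x - z)\<bar> \<le> K * min 1 (norm z)" for x z
  proof -
    have "\<bar>v x - v (x - z)\<bar> \<le> 2 * M" using M'[of x] M'[of "x - z"] by linarith
    moreover have "\<bar>v x - v (x - z)\<bar> \<le> L * norm z" using L[of x "x - z"] by simp
    moreover have "0 \<le> 2 * M * norm z" using M0 by simp
    moreover have "K * norm z = 2 * M * norm z + L * norm z" by (simp add: K_def algebra_simps)
    ultimately have "\<bar>v x - v (x - z)\<bar> \<le> K * norm z" "\<bar>v x - v (x - z)\<bar> \<le> K"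
      using L0 unfolding K_def by linarith+
    then show ?thesis by (simp add: min_def)
  qed
  have F: "\<bar>F x z\<bar> \<le> K * W z" for x z
    using mult_right_mono[OF FK[of x z] w[of z]] w[of z] by (simp add: F_def W_def abs_mult mult.assoc)
  \<comment> \<open>For fixed \<open>z\<close> the increment lives on two balls of radius R, so
    integrating over \<open>x\<close> costs only a constant and leaves the integrable weight
    \<open>W\<close>.\<close>
  have F': "\<bar>F x z\<bar> \<le> K * W z * (indicator (cball 0 R) x + indicator (cball 0 R) (x - z))" for x z
  proof (cases "norm x \<le> R \<or> norm (x - z) \<le> R")
    case True
    then have "1 \<le> (indicator (cball 0 R) x + indicator (cball 0 R) (x - z) :: real)" by (auto simp: indicator_def)
    then have "K * W z * 1 \<le> K * W z * (indicator (cball 0 R) x + indicator (cball 0 R) (x - z))"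
      using K0 W0 by (intro mult_left_mono) auto
    then show ?thesis using F[of x z] by simp
  next
    case False
    then show ?thesis using R(1)[of x] R(1)[of "x - z"] by (simp add: F_def)
  qed
  have Fm: "(\<lambda>(x, z). F x z) \<in> borel_measurable lborel2" unfolding F_def by measurable
  have Fint: "integrable lborel2 (\<lambda>(x, z). F x z)"
  proof (rule lborel_pair_integrableI_swap[OF Fm])
    define V where "V = emeasure lborel (cball (0::real^'n) R)"
    have "(\<integral>\<^sup>+z. \<integral>\<^sup>+x. ennreal (norm (F x z)) \<partial>lborel \<partial>lborel)
        \<le> (\<integral>\<^sup>+z. ennreal (K * W z) * (V + V) \<partial>lborel)"
    proof (rule nn_integral_mono)
      have m[measurable]: "(\<lambda>x. indicator (cball c R) x :: ennreal) \<in> borel_measurable lborel" for c :: "real^'n"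
        by (rule borel_measurable_indicator) simp
      fix z
      have "(\<integral>\<^sup>+x. ennreal (norm (F x z)) \<partial>lborel) \<le> (\<integral>\<^sup>+x. ennreal (K * W z) * (indicator (cball 0 R) x + indicator (cball z R) x) \<partial>lborel)"
      proof (rule nn_integral_mono)
        fix x
        have "ennreal (norm (F x z)) \<le> ennreal (K * W z * (indicator (cball 0 R) x + indicator (cball 0 R) (x - z)))"
          using F'[of x z] by (intro ennreal_leI) simp
        also have "\<dots> = ennreal (K * W z) * (indicator (cball 0 R) x + indicator (cball z R) x)"
          using K0 W0[of z] by (subst ennreal_mult) (auto simp: indicator_def dist_norm norm_minus_commute)
        finally show "ennreal (norm (F x z)) \<le> ennreal (K * W z) * (indicator (cball 0 R) x + indicator (cball z R) x)" .
      qed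
      also have "\<dots> = ennreal (K * W z) * (V + emeasure lborel (cball z R))"
        by (subst nn_integral_cmult, measurable, subst nn_integral_add) (measurable, simp_all add: V_def)
      also have "emeasure lborel (cball z R) = V"
        using R(2) by (simp add: V_def emeasure_cball)
      finally show "(\<integral>\<^sup>+x. ennreal (norm (F x z)) \<partial>lborel) \<le> ennreal (K * W z) * (V + V)" .
    qed
    also have "\<dots> = ennreal K * (\<integral>\<^sup>+z. ennreal (W z) \<partial>lborel) * (V + V)"
      using K0 W0 by (simp add: nn_integral_multc nn_integral_cmult ennreal_mult)
    also have "\<dots> < \<infinity>"
      using Wfin emeasure_lborel_cball_finite[of "0::real^'n" R] by (simp add: ennreal_mult_less_top V_def)
    finally show "(\<integral>\<^sup>+z. \<integral>\<^sup>+x. ennreal (norm (F x z)) \<partial>lborel \<partial>lborel) < \<infinity>" .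
  qed
  define k where "k = levy_const TYPE('n) s"
  have k: "k > 0" unfolding k_def by (rule levy_const_pos) (use s in auto)
  \<comment> \<open>The candidate for the fractional Laplacian; dividing by \<open>k\<close>
    normalises its symbol to exactly |\<xi>|^s.\<close>
  define g where "g x = (1 / k) * (\<integral>z. F x z \<partial>lborel)" for x
  have gint: "integrable lborel g"
    unfolding g_def by (intro integrable_mult_right lborel_pair.integrable_fst Fint)
  then have [measurable]: "g \<in> borel_measurable borel" by (auto dest: borel_measurable_integrable)
  define B where "B = (1 / k) * (K * (\<integral>z. W z \<partial>lborel))"
  have B: "\<bar>g x\<bar> \<le> B" for x
  proof -
    have "\<bar>\<integral>z. F x z \<partial>lborel\<bar> \<le> (\<integral>z. K * W z \<partial>lborel)"
    proof (rule order_trans[OF integral_abs_bound])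
      show "(\<integral>z. \<bar>F x z\<bar> \<partial>lborel) \<le> (\<integral>z. K * W z \<partial>lborel)"
        using F K0 W0 by (intro integral_mono' integrable_mult_right Wint) auto
    qed
    then show ?thesis using k by (simp add: g_def B_def abs_mult divide_right_mono)
  qed
  have gL2: "g \<in> L2"
  proof -
    have "integrable lborel (\<lambda>x. (g x)\<^sup>2)"
    proof (rule Bochner_Integration.integrable_bound[OF integrable_mult_right[OF gint, of B]])
      have "0 \<le> B" using B[of 0] by linarith
      then show "AE x in lborel. norm ((g x)\<^sup>2) \<le> norm (B * g x)"
        using mult_right_mono[OF B abs_ge_zero]
        by (intro AE_I2) (simp only: power2_eq_square abs_mult real_norm_def abs_of_nonneg)
    qed measurable
    then show ?thesis by (simp add: L2_def)
  qed
  \<comment> \<open>Because \<open>g\<close> is integrable, its transform is a pointwise integral.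
    After exchanging the order, the \<open>x\<close>-integral gives the multiplier of an increment
    and the \<open>z\<close>-integral is \<open>integral_one_minus_cis\<close>.\<close>
  have "fourier_integral g \<xi> = of_real (norm \<xi> powr s) * fourier_integral v \<xi>" for \<xi>
  proof -
    define c where "c = (2 * pi) powr (- real CARD('n) / 2)"
    have int: "integrable lborel2 (\<lambda>(x, z). cis (- (x \<bullet> \<xi>)) * complex_of_real (F x z))"
      by (rule Bochner_Integration.integrable_bound[OF Fint]) (use Fm in \<open>auto simp: norm_mult case_prod_unfold\<close>)
    have "fourier_integral g \<xi> = of_real (1 / k) * of_real c * (\<integral>x. \<integral>z. cis (- (x \<bullet> \<xi>)) * complex_of_real (F x z) \<partial>lborel \<partial>lborel)"
      by (simp add: fourier_integral_def g_def c_def flip: integral_complex_of_real)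
    also have "\<dots> = of_real (1 / k) * of_real c * (\<integral>z. \<integral>x. cis (- (x \<bullet> \<xi>)) * complex_of_real (F x z) \<partial>lborel \<partial>lborel)"
      using lborel_pair.Fubini_integral[OF int] by simp
    also have "\<dots> = of_real (1 / k) * (\<integral>z. of_real c * (\<integral>x. cis (- (x \<bullet> \<xi>)) * complex_of_real (F x z) \<partial>lborel) \<partial>lborel)"
      by simp
    also have "\<dots> = of_real (1 / k) * (\<integral>z. (1 - cis (- (z \<bullet> \<xi>))) * of_real (w z) * fourier_integral v \<xi> \<partial>lborel)"
    proof (rule arg_cong2[where f = "(*)", OF refl Bochner_Integration.integral_cong[OF refl]])
      fix z
      have i: "integrable lborel (\<lambda>x. v (x - z))" using lborel_integrable_shift_iff[of v "- z"] vint by simp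
      have "of_real c * (\<integral>x. cis (- (x \<bullet> \<xi>)) * complex_of_real (F x z) \<partial>lborel)
          = of_real (w z) * fourier_integral (\<lambda>x. v x - v (x - z)) \<xi>"
        by (simp add: F_def fourier_integral_def c_def mult_ac flip: integral_mult_left_zero integral_mult_right_zero)
      also have "fourier_integral (\<lambda>x. v x - v (x - z)) \<xi> = (1 - cis (- (z \<bullet> \<xi>))) * fourier_integral v \<xi>"
        by (simp add: fourier_integral_diff[OF vint i] fourier_integral_shift left_diff_distrib)
      finally show "of_real c * (\<integral>x. cis (- (x \<bullet> \<xi>)) * complex_of_real (F x z) \<partial>lborel)
          = (1 - cis (- (z \<bullet> \<xi>))) * of_real (w z) * fourier_integral v \<xi>" by simp
    qed
    also have "\<dots> = of_real (1 / k) * ((\<integral>z. (1 - cis (- (z \<bullet> \<xi>))) * of_real (w z) \<partial>lborel) * fourier_integral v \<xi>)"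
      by simp
    also have "\<dots> = of_real (norm \<xi> powr s) * fourier_integral v \<xi>"
      unfolding w_def integral_one_minus_cis[OF s] using k by (simp add: k_def)
    finally show ?thesis .
  qed
  then have "has_frac_laplacian (s / 2) v g"
    unfolding has_frac_laplacian_def
    using has_L2_fourier_integral[OF vint vL2] has_L2_fourier_integral[OF gint gL2] by auto
  then show ?thesis using vL2 gL2 by (auto simp: sobolev_H_def)
qed

section \<open>Integration by parts\<close>

lemma integrable_continuous_compact_support:
  fixes f :: "'a::euclidean_space \<Rightarrow> real"
  assumes "continuous_on UNIV f" "\<And>x. norm x \<ge> R \<Longrightarrow> f x = 0"
  shows "integrable lborel f"
proof -
  have "integrable lborel (\<lambda>x. indicator (cball 0 R) x *\<^sub>R f x)"
    using assms(1) by (intro borel_integrable_compact) (auto intro: continuous_on_subset)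
  also have "(\<lambda>x. indicator (cball 0 R) x *\<^sub>R f x) = f"
    using assms(2) by (auto simp: fun_eq_iff indicator_def)
  finally show ?thesis .
qed

lemma bounded_continuous_compact_support:
  fixes f :: "'a::euclidean_space \<Rightarrow> 'b::real_normed_vector"
  assumes "continuous_on UNIV f" "\<And>x. norm x \<ge> R \<Longrightarrow> f x = 0"
  obtains C where "C \<ge> 0" "\<And>x. norm (f x) \<le> C"
proof -
  have "compact (f ` cball 0 R)"
    using assms(1) by (intro compact_continuous_image) (auto intro: continuous_on_subset)
  then obtain C where C: "\<And>y. y \<in> f ` cball 0 R \<Longrightarrow> norm y \<le> C" by (meson bounded_iff compact_imp_bounded)
  show ?thesis
  proof (rule that[of "max 0 C"])
    show "norm (f x) \<le> max 0 C" for x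
    proof (cases "norm x \<le> R")
      case True
      then show ?thesis using C[of "f x"] by auto
    qed (simp add: assms(2))
  qed simp
qed

text \<open>Difference quotients of an integrable function have integral 0 by translation
  invariance. They converge to the directional derivative and are dominated through the Lipschitz
  bound on a common ball.\<close>

lemma integral_gradient_eq_0:
  fixes f :: "'a::euclidean_space \<Rightarrow> real"
  assumes f: "\<And>x. (f has_derivative (\<lambda>h. g x \<bullet> h)) (at x)" and g: "continuous_on UNIV g"
    and f0: "\<And>x. norm x \<ge> R \<Longrightarrow> f x = 0" and g0: "\<And>x. norm x \<ge> R \<Longrightarrow> g x = 0"
  shows "(\<integral>x. g x \<bullet> b \<partial>lborel) = 0"
proof -
  obtain C where C: "C \<ge> 0" "\<And>x. norm (g x) \<le> C" using bounded_continuous_compact_support[OF g g0] by blast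
  have cf: "continuous_on UNIV f" using f by (meson continuous_at_imp_continuous_on has_derivative_continuous)
  then have [measurable]: "f \<in> borel_measurable borel" by (rule borel_measurable_continuous_onI)
  have [measurable]: "g \<in> borel_measurable borel" using g by (rule borel_measurable_continuous_onI)
  have fint: "integrable lborel f" by (rule integrable_continuous_compact_support[OF cf f0])
  define t where "t n = 1 / real (Suc n)" for n
  have t: "t n > 0" "t n \<le> 1" for n by (auto simp: t_def)
  have lip: "\<bar>f y - f x\<bar> \<le> C * norm (y - x)" for x y
  proof -
    have "norm (f y - f x) \<le> C * norm (y - x)"
    proof (rule differentiable_bound[of UNIV f "\<lambda>x h. g x \<bullet> h"])
      show "onorm (\<lambda>h. g x \<bullet> h) \<le> C" for x
        by (rule onorm_le) (metis C(2) Cauchy_Schwarz_ineq2 mult_right_mono norm_ge_zero order_trans real_norm_def)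
    qed (use f in auto)
    then show ?thesis by simp
  qed
  have "(\<lambda>n. \<integral>x. (f (t n *\<^sub>R b + x) - f x) / t n \<partial>lborel) \<longlonglongrightarrow> (\<integral>x. g x \<bullet> b \<partial>lborel)"
  proof (rule integral_dominated_convergence)
    show "integrable lborel (\<lambda>x::'a. C * norm b * indicator (cball 0 (\<bar>R\<bar> + norm b)) x)"
      by (intro integrable_mult_right integrable_indicator_cball)
    show "AE x in lborel. norm ((f (t n *\<^sub>R b + x) - f x) / t n) \<le> C * norm b * indicator (cball 0 (\<bar>R\<bar> + norm b)) x" for n
    proof (intro AE_I2)
      fix x
      show "norm ((f (t n *\<^sub>R b + x) - f x) / t n) \<le> C * norm b * indicator (cball 0 (\<bar>R\<bar> + norm b)) x"
      proof (cases "norm x \<le> \<bar>R\<bar> + norm b")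
        case True
        have "\<bar>f (t n *\<^sub>R b + x) - f x\<bar> \<le> C * (t n * norm b)" using lip[of "t n *\<^sub>R b + x" x] t[of n] by simp
        then show ?thesis using True t[of n] by (simp add: field_simps)
      next
        case False
        have "norm x \<le> norm (t n *\<^sub>R b + x) + norm (t n *\<^sub>R b)"
          using norm_triangle_ineq4[of "t n *\<^sub>R b + x" "t n *\<^sub>R b"] by simp
        moreover have "norm (t n *\<^sub>R b) \<le> norm b" using t[of n] by (simp add: mult_left_le_one_le)
        ultimately have "R \<le> norm (t n *\<^sub>R b + x)" "R \<le> norm x" using False norm_ge_zero[of b] by linarith+
        then show ?thesis using False by (simp add: f0)
      qed
    qed
    show "AE x in lborel. (\<lambda>n. (f (t n *\<^sub>R b + x) - f x) / t n) \<longlonglongrightarrow> g x \<bullet> b"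
    proof (intro AE_I2)
      fix x
      have "((\<lambda>h. f (x + h *\<^sub>R b)) has_derivative (\<lambda>h. g x \<bullet> (h *\<^sub>R b))) (at 0)"
      proof -
        have A: "((\<lambda>h. x + h *\<^sub>R b) has_derivative (\<lambda>h. h *\<^sub>R b)) (at 0)" by (auto intro!: derivative_eq_intros)
        have B: "(f has_derivative (\<lambda>h. g x \<bullet> h)) (at (x + 0 *\<^sub>R b))" using f by simp
        from has_derivative_compose[OF A B] show ?thesis .
      qed
      then have "((\<lambda>h. f (x + h *\<^sub>R b)) has_real_derivative (g x \<bullet> b)) (at 0)"
        by (simp add: has_field_derivative_def mult_commute_abs)
      then have "((\<lambda>h. (f (x + h *\<^sub>R b) - f x) / h) \<longlongrightarrow> g x \<bullet> b) (at 0)" by (simp add: DERIV_def)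
      moreover have "filterlim t (at 0) sequentially"
        unfolding filterlim_at using LIMSEQ_Suc[OF lim_1_over_n] t(1)
        by (auto simp: t_def[abs_def] intro!: always_eventually)
      ultimately have "(\<lambda>n. (f (x + t n *\<^sub>R b) - f x) / t n) \<longlonglongrightarrow> g x \<bullet> b" by (rule filterlim_compose)
      then show "(\<lambda>n. (f (t n *\<^sub>R b + x) - f x) / t n) \<longlonglongrightarrow> g x \<bullet> b" by (simp add: add.commute)
    qed
  qed measurable
  moreover have "(\<integral>x. (f (t n *\<^sub>R b + x) - f x) / t n \<partial>lborel) = 0" for n
    using fint lborel_integrable_shift_iff[of f "t n *\<^sub>R b"] lborel_integral_shift[of f "t n *\<^sub>R b"] by simp
  ultimately have "(\<lambda>n. 0) \<longlonglongrightarrow> (\<integral>x. g x \<bullet> b \<partial>lborel)" by (simp only:)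
  then show ?thesis by (simp add: LIMSEQ_const_iff)
qed

section \<open>The truncated dilation field\<close>

text \<open>
  The square makes the truncation \<open>C\<^sup>1\<close>. By scaling, the Lipschitz constant and the divergence
  \<open>radial_div R\<close> of \<open>radial_field R\<close> are bounded independently of \<open>R\<close>.
\<close>

definition cutoff :: "real \<Rightarrow> 'a::euclidean_space \<Rightarrow> real" where
  "cutoff R x = max 0 (1 - (norm x / R)\<^sup>2)"

definition radial_field :: "real \<Rightarrow> 'a::euclidean_space \<Rightarrow> 'a" where
  "radial_field R x = (cutoff R x)\<^sup>2 *\<^sub>R x"

definition radial_div :: "real \<Rightarrow> 'a::euclidean_space \<Rightarrow> real" where
  "radial_div R x = real DIM('a) * (cutoff R x)\<^sup>2 - 4 * cutoff R x * (norm x / R)\<^sup>2"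

lemma cutoff_bounds: "0 \<le> cutoff R x" "cutoff R x \<le> 1"
  by (auto simp: cutoff_def)

text \<open>Either both factors are at most 1 or the cutoff vanishes. This is the source of the
  bounds on the divergence and on the Lipschitz constant that do not involve R.\<close>

lemma cutoff_norm_le: "cutoff R x * (norm x / R)\<^sup>2 \<le> 1"
proof (cases "(norm x / R)\<^sup>2 \<le> 1")
  case True
  then show ?thesis using cutoff_bounds[of R x] by (intro mult_le_one) auto
qed (simp add: cutoff_def)

lemma cutoff_eq_0: "R > 0 \<Longrightarrow> norm x \<ge> R \<Longrightarrow> cutoff R x = 0"
  by (simp add: cutoff_def one_le_power le_divide_eq)

lemma continuous_on_cutoff[continuous_intros]: "continuous_on S (cutoff R)"
  unfolding cutoff_def by (cases "R = 0") (auto intro!: continuous_intros)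

lemma has_derivative_cutoff_power2:
  fixes x :: "'a::euclidean_space"
  assumes "R > 0"
  shows "((\<lambda>x. (cutoff R x)\<^sup>2) has_derivative (\<lambda>h. - (4 / R\<^sup>2 * cutoff R x) * (x \<bullet> h))) (at x)"
proof -
  have max: "((\<lambda>t. (max 0 t)\<^sup>2) has_real_derivative 2 * max 0 t) (at t)" for t :: real
  proof (cases t "0::real" rule: linorder_cases)
    case less
    have "((\<lambda>t. 0) has_real_derivative 2 * max 0 t) (at t)" using less by simp
    then show ?thesis
      by (rule has_field_derivative_transform_within_open[of _ _ _ "{..<0}"]) (use less in auto)
  next
    case greater
    have "((\<lambda>t. t\<^sup>2) has_real_derivative 2 * max 0 t) (at t)" using greater by (auto intro!: derivative_eq_intros)
    then show ?thesis
      by (rule has_field_derivative_transform_within_open[of _ _ _ "{0<..}"]) (use greater in auto)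
  next
    case equal
    have "((\<lambda>h. (max 0 (0 + h))\<^sup>2 / h) \<longlongrightarrow> 0) (at (0::real))"
    proof (rule Lim_null_comparison)
      show "eventually (\<lambda>h. norm ((max 0 (0 + h))\<^sup>2 / h) \<le> \<bar>h\<bar>) (at (0::real))"
        by (intro always_eventually) (auto simp: max_def power2_eq_square)
      show "((\<lambda>h. \<bar>h\<bar>) \<longlongrightarrow> 0) (at (0::real))" by (rule tendsto_rabs_zero) simp
    qed
    then show ?thesis using equal by (simp add: DERIV_def)
  qed
  have "((\<lambda>x. 1 - (norm x / R)\<^sup>2) has_derivative (\<lambda>h. - (2 / R\<^sup>2) * (x \<bullet> h))) (at x)"
  proof -
    have "((\<lambda>x. 1 - c * (x \<bullet> x)) has_derivative (\<lambda>h. - (2 * c) * (x \<bullet> h))) (at x)" for c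
      by (auto intro!: derivative_eq_intros simp: inner_commute)
    from this[of "1 / R\<^sup>2"] show ?thesis by (simp add: power_divide power2_norm_eq_inner)
  qed
  from DERIV_compose_FDERIV[OF max this] show ?thesis
    by (simp add: cutoff_def mult_ac)
qed

lemma radial_field_eq_0: "R > 0 \<Longrightarrow> norm x \<ge> R \<Longrightarrow> radial_field R x = 0"
  by (simp add: radial_field_def cutoff_eq_0)

lemma continuous_on_radial_field[continuous_intros]: "continuous_on S (radial_field R)"
  unfolding radial_field_def by (intro continuous_intros)

lemma continuous_on_radial_div[continuous_intros]: "continuous_on S (radial_div R)"
  unfolding radial_div_def by (cases "R = 0") (auto intro!: continuous_intros)

lemma borel_measurable_radial_field[measurable]: "radial_field R \<in> borel_measurable borel" "radial_div R \<in> borel_measurable borel"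
  by (auto intro!: borel_measurable_continuous_onI continuous_intros)

lemma norm_radial_field_le: "norm (radial_field R x) \<le> norm x"
  using cutoff_bounds[of R x] by (simp add: radial_field_def power_le_one mult_left_le_one_le)

lemma radial_div_bound: "\<bar>radial_div R (x::'a::euclidean_space)\<bar> \<le> real DIM('a) + 4"
proof -
  have "(cutoff R x)\<^sup>2 \<le> 1" using cutoff_bounds[of R x] by (simp add: power_le_one)
  then have "real DIM('a) * (cutoff R x)\<^sup>2 \<le> real DIM('a)" "0 \<le> real DIM('a) * (cutoff R x)\<^sup>2"
    by (simp_all add: mult_left_le)
  moreover have "0 \<le> cutoff R x * (norm x / R)\<^sup>2" using cutoff_bounds[of R x] by simp
  moreover have "4 * cutoff R x * (norm x / R)\<^sup>2 = 4 * (cutoff R x * (norm x / R)\<^sup>2)" by simp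
  ultimately show ?thesis using cutoff_norm_le[of R x] unfolding radial_div_def abs_le_iff by linarith
qed

text \<open>The constant is 1 + 4: the derivative of the identity factor contributes at most 1, and
  the gradient of the squared cutoff times the position vector at most 4 by
  \<open>cutoff_norm_le\<close>.\<close>

lemma radial_field_lipschitz:
  fixes x y :: "'a::euclidean_space"
  assumes R: "R > 0"
  shows "norm (radial_field R x - radial_field R y) \<le> 5 * norm (x - y)"
proof (rule differentiable_bound[of UNIV "radial_field R" "\<lambda>x h. (cutoff R x)\<^sup>2 *\<^sub>R h + (- (4 / R\<^sup>2 * cutoff R x) * (x \<bullet> h)) *\<^sub>R x"])
  show "(radial_field R has_derivative (\<lambda>h. (cutoff R x)\<^sup>2 *\<^sub>R h + (- (4 / R\<^sup>2 * cutoff R x) * (x \<bullet> h)) *\<^sub>R x)) (at x within UNIV)" for x :: 'a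
  proof -
    define c where "c x = (cutoff R x)\<^sup>2" for x :: 'a
    have "(c has_derivative (\<lambda>h. - (4 / R\<^sup>2 * cutoff R x) * (x \<bullet> h))) (at x)"
      unfolding c_def by (rule has_derivative_cutoff_power2[OF R])
    then have "((\<lambda>x. c x *\<^sub>R x) has_derivative (\<lambda>h. c x *\<^sub>R h + (- (4 / R\<^sup>2 * cutoff R x) * (x \<bullet> h)) *\<^sub>R x)) (at x)"
      by (auto intro!: derivative_eq_intros)
    then show ?thesis by (simp add: c_def radial_field_def[abs_def])
  qed
  show "onorm (\<lambda>h. (cutoff R x)\<^sup>2 *\<^sub>R h + (- (4 / R\<^sup>2 * cutoff R x) * (x \<bullet> h)) *\<^sub>R x) \<le> 5" for x :: 'a
  proof (rule onorm_le)
    fix h :: 'a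
    have "norm ((cutoff R x)\<^sup>2 *\<^sub>R h + (- (4 / R\<^sup>2 * cutoff R x) * (x \<bullet> h)) *\<^sub>R x)
       \<le> norm ((cutoff R x)\<^sup>2 *\<^sub>R h) + norm ((- (4 / R\<^sup>2 * cutoff R x) * (x \<bullet> h)) *\<^sub>R x)" by (rule norm_triangle_ineq)
    also have "norm ((cutoff R x)\<^sup>2 *\<^sub>R h) \<le> norm h"
      using cutoff_bounds[of R x] by (simp add: power_le_one mult_left_le_one_le)
    also have "norm ((- (4 / R\<^sup>2 * cutoff R x) * (x \<bullet> h)) *\<^sub>R x) \<le> 4 * norm h"
    proof -
      have "norm ((- (4 / R\<^sup>2 * cutoff R x) * (x \<bullet> h)) *\<^sub>R x) = 4 / R\<^sup>2 * cutoff R x * \<bar>x \<bullet> h\<bar> * norm x"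
        using cutoff_bounds[of R x] R by (simp add: abs_mult)
      also have "\<dots> \<le> 4 / R\<^sup>2 * cutoff R x * (norm x * norm h) * norm x"
        using cutoff_bounds[of R x] R by (intro mult_right_mono mult_left_mono Cauchy_Schwarz_ineq2) auto
      also have "\<dots> = 4 * norm h * (cutoff R x * (norm x / R)\<^sup>2)"
        using R by (simp add: power2_eq_square field_simps)
      also have "\<dots> \<le> 4 * norm h * 1" by (intro mult_left_mono cutoff_norm_le) auto
      finally show ?thesis by simp
    qed
    finally show "norm ((cutoff R x)\<^sup>2 *\<^sub>R h + (- (4 / R\<^sup>2 * cutoff R x) * (x \<bullet> h)) *\<^sub>R x) \<le> 5 * norm h" by simp
  qed
qed auto

lemma cutoff_tendsto: "(\<lambda>n. cutoff (real (Suc n)) x) \<longlonglongrightarrow> 1"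
proof -
  have "(\<lambda>n. max 0 (1 - (norm x * (1 / real (Suc n)))\<^sup>2)) \<longlonglongrightarrow> max 0 (1 - (norm x * 0)\<^sup>2)"
    by (intro tendsto_intros LIMSEQ_Suc lim_1_over_n)
  then show ?thesis by (simp add: cutoff_def)
qed

lemma radial_field_tendsto: "(\<lambda>n. radial_field (real (Suc n)) x) \<longlonglongrightarrow> x"
proof -
  have "(\<lambda>n. radial_field (real (Suc n)) x) \<longlonglongrightarrow> 1\<^sup>2 *\<^sub>R x"
    unfolding radial_field_def by (intro tendsto_intros cutoff_tendsto)
  then show ?thesis by simp
qed

lemma radial_div_tendsto: "(\<lambda>n. radial_div (real (Suc n)) x) \<longlonglongrightarrow> real DIM('a)" for x :: "'a::euclidean_space"
proof -
  have "(\<lambda>n. real DIM('a) * (cutoff (real (Suc n)) x)\<^sup>2 - 4 * cutoff (real (Suc n)) x * (norm x * (1 / real (Suc n)))\<^sup>2)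
      \<longlonglongrightarrow> real DIM('a) * 1\<^sup>2 - 4 * 1 * (norm x * 0)\<^sup>2"
    by (intro tendsto_intros cutoff_tendsto LIMSEQ_Suc lim_1_over_n)
  then show ?thesis by (simp add: radial_div_def)
qed

text \<open>The divergence of the compactly supported field \<open>H x * k x\<close> times
  \<open>radial_field R x\<close> integrates to 0, one coordinate at a time by
  \<open>integral_gradient_eq_0\<close>; the product rule then yields the three terms.\<close>

lemma integration_by_parts_radial_field:
  fixes H k :: "'a::euclidean_space \<Rightarrow> real"
  assumes R: "R > 0"
    and H: "\<And>x. (H has_derivative (\<lambda>h. G x \<bullet> h)) (at x)" and G: "continuous_on UNIV G"
    and k: "\<And>x. (k has_derivative (\<lambda>h. k' x \<bullet> h)) (at x)" and k': "continuous_on UNIV k'"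
  shows "(\<integral>x. (G x \<bullet> radial_field R x) * k x \<partial>lborel) = - (\<integral>x. H x * (radial_div R x * k x + k' x \<bullet> radial_field R x) \<partial>lborel)"
proof -
  have cH: "continuous_on UNIV H" using H by (meson continuous_at_imp_continuous_on has_derivative_continuous)
  have ck: "continuous_on UNIV k" using k by (meson continuous_at_imp_continuous_on has_derivative_continuous)
  \<comment> \<open>The full gradient of the \<open>b\<close>-component of that field; only its own
    \<open>b\<close>-derivative enters the divergence.\<close>
  define g where "g b x = (k x * (radial_field R x \<bullet> b)) *\<^sub>R G x + (H x * (radial_field R x \<bullet> b)) *\<^sub>R k' x
     + (H x * k x) *\<^sub>R ((cutoff R x)\<^sup>2 *\<^sub>R b - (x \<bullet> b * (4 / R\<^sup>2 * cutoff R x)) *\<^sub>R x)" for b x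
  have cg: "continuous_on UNIV (g b)" for b
    unfolding g_def by (intro continuous_intros cH ck G k')
  have g0: "g b x = 0" if "norm x \<ge> R" for b x
    using that R by (simp add: g_def radial_field_eq_0 cutoff_eq_0)
  have z: "(\<integral>x. g b x \<bullet> b \<partial>lborel) = 0" for b
  proof (rule integral_gradient_eq_0[of "\<lambda>x. H x * k x * (radial_field R x \<bullet> b)"])
    show "((\<lambda>x. H x * k x * (radial_field R x \<bullet> b)) has_derivative (\<lambda>h. g b x \<bullet> h)) (at x)" for x
    proof -
      define c where "c x = (cutoff R x)\<^sup>2" for x :: 'a
      have "(c has_derivative (\<lambda>h. - (4 / R\<^sup>2 * cutoff R x) * (x \<bullet> h))) (at x)"
        unfolding c_def by (rule has_derivative_cutoff_power2[OF R])
      then have "((\<lambda>x. H x * k x * (c x * (x \<bullet> b))) has_derivative (\<lambda>h. g b x \<bullet> h)) (at x)"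
        by (auto intro!: derivative_eq_intros H k
            simp: g_def inner_add_left inner_diff_left radial_field_def algebra_simps inner_commute c_def[symmetric])
      then show ?thesis by (simp add: radial_field_def c_def)
    qed
  qed (use cg g0 R in \<open>auto simp: radial_field_eq_0\<close>)
  have int: "integrable lborel (\<lambda>x. g b x \<bullet> b)" for b
    by (rule integrable_continuous_compact_support[where R = R]) (use cg g0 in \<open>auto intro!: continuous_intros\<close>)
  have i1: "integrable lborel (\<lambda>x. (G x \<bullet> radial_field R x) * k x)"
    by (rule integrable_continuous_compact_support[where R = R]) (use G ck R in \<open>auto intro!: continuous_intros simp: radial_field_eq_0\<close>)
  have i2: "integrable lborel (\<lambda>x. H x * (radial_div R x * k x + k' x \<bullet> radial_field R x))"
    by (rule integrable_continuous_compact_support[where R = R])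
       (use k' ck cH R in \<open>auto intro!: continuous_intros simp: radial_field_eq_0 radial_div_def cutoff_eq_0\<close>)
  have "0 = (\<Sum>b\<in>Basis. \<integral>x. g b x \<bullet> b \<partial>lborel)" by (simp add: z)
  also have "\<dots> = (\<integral>x. (\<Sum>b\<in>Basis. g b x \<bullet> b) \<partial>lborel)" using int by simp
  also have "(\<lambda>x. \<Sum>b\<in>Basis. g b x \<bullet> b) = (\<lambda>x. (G x \<bullet> radial_field R x) * k x + H x * (radial_div R x * k x + k' x \<bullet> radial_field R x))"
  proof
    fix x
    have "(\<Sum>b\<in>Basis. g b x \<bullet> b) = (\<Sum>b\<in>Basis. k x * ((G x \<bullet> b) * (radial_field R x \<bullet> b)) + H x * ((k' x \<bullet> b) * (radial_field R x \<bullet> b))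
       + (H x * k x * (cutoff R x)\<^sup>2 - (H x * k x * (4 / R\<^sup>2 * cutoff R x)) * ((x \<bullet> b) * (x \<bullet> b))))"
      by (intro sum.cong refl) (simp add: g_def inner_add_left inner_diff_left inner_Basis algebra_simps)
    also have "\<dots> = k x * (G x \<bullet> radial_field R x) + H x * (k' x \<bullet> radial_field R x)
       + (real DIM('a) * (H x * k x * (cutoff R x)\<^sup>2) - (H x * k x * (4 / R\<^sup>2 * cutoff R x)) * (x \<bullet> x))"
      unfolding euclidean_inner[of "G x" "radial_field R x"] euclidean_inner[of "k' x" "radial_field R x"] euclidean_inner[of x x]
      by (simp add: sum.distrib sum_subtractf sum_distrib_left)
    also have "\<dots> = (G x \<bullet> radial_field R x) * k x + H x * (radial_div R x * k x + k' x \<bullet> radial_field R x)"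
      unfolding radial_div_def power_divide power2_norm_eq_inner using R by (simp add: field_simps)
    finally show "(\<Sum>b\<in>Basis. g b x \<bullet> b) = (G x \<bullet> radial_field R x) * k x + H x * (radial_div R x * k x + k' x \<bullet> radial_field R x)" .
  qed
  also have "(\<integral>x. (G x \<bullet> radial_field R x) * k x + H x * (radial_div R x * k x + k' x \<bullet> radial_field R x) \<partial>lborel)
     = (\<integral>x. (G x \<bullet> radial_field R x) * k x \<partial>lborel) + (\<integral>x. H x * (radial_div R x * k x + k' x \<bullet> radial_field R x) \<partial>lborel)"
    using i1 i2 by (rule Bochner_Integration.integral_add)
  finally show ?thesis by simp
qed

section \<open>Regularised power kernels\<close>

definition reg_kernel :: "real \<Rightarrow> real \<Rightarrow> 'a::euclidean_space \<Rightarrow> real" where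
  "reg_kernel a \<epsilon> z = (\<epsilon> + (norm z)\<^sup>2) powr (- a / 2)"

definition reg_kernel_grad :: "real \<Rightarrow> real \<Rightarrow> 'a::euclidean_space \<Rightarrow> 'a" where
  "reg_kernel_grad a \<epsilon> z = (- a * (\<epsilon> + (norm z)\<^sup>2) powr (- a / 2 - 1)) *\<^sub>R z"

text \<open>The squared norm is smooth and \<open>\<epsilon>\<close> keeps the base of the power
  positive, so the kernel is differentiable across the diagonal too.\<close>

lemma has_derivative_reg_kernel:
  assumes "\<epsilon> > 0"
  shows "((\<lambda>x. reg_kernel a \<epsilon> (x - y)) has_derivative (\<lambda>h. reg_kernel_grad a \<epsilon> (x - y) \<bullet> h)) (at x)"
proof -
  have p: "\<epsilon> + (x - y) \<bullet> (x - y) > 0" using assms by (simp add: add_pos_nonneg)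
  have d: "((\<lambda>x. \<epsilon> + (x - y) \<bullet> (x - y)) has_derivative (\<lambda>h. 2 * ((x - y) \<bullet> h))) (at x)"
    by (auto intro!: derivative_eq_intros simp: inner_commute)
  have "((\<lambda>t. t powr (- a / 2)) has_real_derivative (- a / 2) * (\<epsilon> + (x - y) \<bullet> (x - y)) powr (- a / 2 - 1)) (at (\<epsilon> + (x - y) \<bullet> (x - y)))"
    by (rule has_real_derivative_powr[OF p])
  from DERIV_compose_FDERIV[OF this d] show ?thesis
    by (simp add: reg_kernel_def reg_kernel_grad_def power2_norm_eq_inner mult_ac)
qed

lemma continuous_on_reg_kernel:
  assumes "\<epsilon> > 0"
  shows "continuous_on UNIV (\<lambda>x. reg_kernel a \<epsilon> (x - y))" "continuous_on UNIV (\<lambda>x. reg_kernel_grad a \<epsilon> (x - y))"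
proof -
  have "\<epsilon> + (norm (x - y))\<^sup>2 \<noteq> 0" for x using assms zero_le_power2[of "norm (x - y)"] by linarith
  then show "continuous_on UNIV (\<lambda>x. reg_kernel a \<epsilon> (x - y))" "continuous_on UNIV (\<lambda>x. reg_kernel_grad a \<epsilon> (x - y))"
    unfolding reg_kernel_def reg_kernel_grad_def by (auto intro!: continuous_intros)
qed

lemma borel_measurable_reg_kernel[measurable]: "reg_kernel a \<epsilon> \<in> borel_measurable borel" "reg_kernel_grad a \<epsilon> \<in> borel_measurable borel"
  unfolding reg_kernel_def reg_kernel_grad_def by measurable

lemma reg_kernel_nonneg: "0 \<le> reg_kernel a \<epsilon> z" by (simp add: reg_kernel_def)

text \<open>Domination by the singular kernel: integrability against the latter carries over to
  every \<open>\<epsilon>\<close> and supplies the majorants as \<open>\<epsilon>\<close> tends to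
  0.\<close>

lemma reg_kernel_le:
  assumes "\<epsilon> > 0" "a \<ge> 0" "z \<noteq> 0"
  shows "reg_kernel a \<epsilon> z \<le> norm z powr (- a)"
proof -
  have "reg_kernel a \<epsilon> z \<le> ((norm z)\<^sup>2) powr (- a / 2)"
    unfolding reg_kernel_def using assms by (intro powr_mono2') auto
  also have "((norm z)\<^sup>2) powr (- a / 2) = norm z powr (- a)"
    using assms by (simp flip: powr_numeral add: powr_powr)
  finally show ?thesis .
qed

lemma reg_kernel_minus: "reg_kernel a \<epsilon> (y - x) = reg_kernel a \<epsilon> (x - y)" "reg_kernel_grad a \<epsilon> (y - x) = - reg_kernel_grad a \<epsilon> (x - y)"
  by (simp_all add: reg_kernel_def reg_kernel_grad_def norm_minus_commute[of y x] flip: scaleR_minus_right)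

text \<open>The gradient is the kernel times -a z / (\<open>\<epsilon>\<close> + |z|^2), so it can
  be compared with the kernel itself.\<close>

lemma reg_kernel_grad_bound:
  assumes e: "\<epsilon> > 0" and a: "a \<ge> 0"
  shows "\<bar>reg_kernel_grad a \<epsilon> z \<bullet> h\<bar> \<le> a * (norm z * norm h / (\<epsilon> + (norm z)\<^sup>2)) * reg_kernel a \<epsilon> z"
proof -
  have p: "\<epsilon> + (norm z)\<^sup>2 > 0" using e by (simp add: add_pos_nonneg)
  have "\<bar>reg_kernel_grad a \<epsilon> z \<bullet> h\<bar> = a * (reg_kernel a \<epsilon> z / (\<epsilon> + (norm z)\<^sup>2)) * \<bar>z \<bullet> h\<bar>"
    using p a by (simp add: reg_kernel_grad_def reg_kernel_def powr_diff abs_mult)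
  also have "\<dots> \<le> a * (reg_kernel a \<epsilon> z / (\<epsilon> + (norm z)\<^sup>2)) * (norm z * norm h)"
    using p a by (intro mult_left_mono Cauchy_Schwarz_ineq2) (simp_all add: reg_kernel_nonneg)
  finally show ?thesis by (simp add: mult_ac)
qed

text \<open>A direction that is O(|z|) cancels the extra singularity, with a constant free of
  \<open>\<epsilon>\<close>. It is applied to increments of the radial field.\<close>

lemma reg_kernel_grad_bound_lipschitz:
  assumes e: "\<epsilon> > 0" and a: "a \<ge> 0" and h: "norm h \<le> L * norm z" "L \<ge> 0"
  shows "\<bar>reg_kernel_grad a \<epsilon> z \<bullet> h\<bar> \<le> a * L * reg_kernel a \<epsilon> z"
proof -
  have p: "\<epsilon> + (norm z)\<^sup>2 > 0" using e by (simp add: add_pos_nonneg)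
  have "norm z * norm h \<le> norm z * (L * norm z)" using h by (intro mult_left_mono) auto
  also have "\<dots> \<le> L * (\<epsilon> + (norm z)\<^sup>2)" using e h by (simp add: power2_eq_square algebra_simps)
  finally have "norm z * norm h / (\<epsilon> + (norm z)\<^sup>2) \<le> L" using p by (simp add: pos_divide_le_eq)
  then have "a * (norm z * norm h / (\<epsilon> + (norm z)\<^sup>2)) * reg_kernel a \<epsilon> z \<le> a * L * reg_kernel a \<epsilon> z"
    using a by (intro mult_right_mono mult_left_mono) (auto simp: reg_kernel_nonneg)
  then show ?thesis using reg_kernel_grad_bound[OF e a, of z h] by linarith
qed

text \<open>For directions that are merely bounded the constant blows up with
  1/\<open>\<epsilon>\<close>. This serves only for integrability at fixed
  \<open>\<epsilon>\<close>, before symmetrisation.\<close>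

lemma reg_kernel_grad_bound_const:
  assumes e: "\<epsilon> > 0" and a: "a \<ge> 0" and h: "norm h \<le> R"
  shows "\<bar>reg_kernel_grad a \<epsilon> z \<bullet> h\<bar> \<le> a * (R * (1 + 1 / \<epsilon>)) * reg_kernel a \<epsilon> z"
proof -
  have p: "\<epsilon> + (norm z)\<^sup>2 > 0" using e by (simp add: add_pos_nonneg)
  have R: "R \<ge> 0" using h norm_ge_zero order_trans by blast
  have "2 * norm z \<le> 1 + (norm z)\<^sup>2" using sum_squares_bound[of 1 "norm z"] by simp
  then have "norm z \<le> 1 + (norm z)\<^sup>2" using norm_ge_zero[of z] by linarith
  also have "\<dots> \<le> (1 + 1 / \<epsilon>) * (\<epsilon> + (norm z)\<^sup>2)" using e by (simp add: algebra_simps)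
  finally have "norm z / (\<epsilon> + (norm z)\<^sup>2) \<le> 1 + 1 / \<epsilon>" using p by (simp add: pos_divide_le_eq)
  then have "norm h * (norm z / (\<epsilon> + (norm z)\<^sup>2)) \<le> R * (1 + 1 / \<epsilon>)"
    using h R p by (intro mult_mono) auto
  then have "a * (norm z * norm h / (\<epsilon> + (norm z)\<^sup>2)) * reg_kernel a \<epsilon> z \<le> a * (R * (1 + 1 / \<epsilon>)) * reg_kernel a \<epsilon> z"
    using a by (intro mult_right_mono mult_left_mono) (auto simp: reg_kernel_nonneg mult_ac)
  then show ?thesis using reg_kernel_grad_bound[OF e a, of z h] by linarith
qed

lemma reg_kernel_tendsto:
  assumes "z \<noteq> 0"
  shows "(\<lambda>n. reg_kernel a (1 / real (Suc n)) z) \<longlonglongrightarrow> norm z powr (- a)"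
    and "(\<lambda>n. reg_kernel_grad a (1 / real (Suc n)) z \<bullet> h) \<longlonglongrightarrow> - a * norm z powr (- a) * (z \<bullet> h / (norm z)\<^sup>2)"
proof -
  have e: "((norm z)\<^sup>2) powr b = norm z powr (2 * b)" for b
    using assms by (simp flip: powr_numeral add: powr_powr)
  have "(\<lambda>n. (1 / real (Suc n) + (norm z)\<^sup>2) powr b) \<longlonglongrightarrow> (0 + (norm z)\<^sup>2) powr b" for b
    using assms by (intro tendsto_intros LIMSEQ_Suc lim_1_over_n) auto
  then have l: "(\<lambda>n. (1 / real (Suc n) + (norm z)\<^sup>2) powr b) \<longlonglongrightarrow> norm z powr (2 * b)" for b
    by (simp add: e)
  show "(\<lambda>n. reg_kernel a (1 / real (Suc n)) z) \<longlonglongrightarrow> norm z powr (- a)"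
    using l[of "- a / 2"] by (simp add: reg_kernel_def)
  have "(\<lambda>n. reg_kernel_grad a (1 / real (Suc n)) z \<bullet> h) \<longlonglongrightarrow> (- a * norm z powr (2 * (- a / 2 - 1))) *\<^sub>R z \<bullet> h"
    unfolding reg_kernel_grad_def by (intro tendsto_intros l)
  also have "norm z powr (2 * (- a / 2 - 1)) = norm z powr (- a) / (norm z)\<^sup>2"
    using assms by (simp add: powr_diff)
  finally show "(\<lambda>n. reg_kernel_grad a (1 / real (Suc n)) z \<bullet> h) \<longlonglongrightarrow> - a * norm z powr (- a) * (z \<bullet> h / (norm z)\<^sup>2)"
    by simp
qed

text \<open>Since \<open>0 powr (- a)\<close> is 0 while the regularised kernel is positive at 0,
  the pointwise comparisons fail on the diagonal. They hold off it, and the diagonal is a null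
  set.\<close>

lemma AE_lborel_pair_neq: "AE p in lborel2. fst p \<noteq> (snd p :: 'a::euclidean_space)"
proof -
  have "AE x in lborel. AE y in lborel. fst (x, y) \<noteq> (snd (x, y) :: 'a)"
  proof (rule AE_I2)
    fix x :: 'a
    show "AE y in lborel. fst (x, y) \<noteq> snd (x, y)" using AE_lborel_singleton[of x] by eventually_elim auto
  qed
  moreover have "{p \<in> space lborel2. fst p \<noteq> (snd p :: 'a)} \<in> sets lborel2"
  proof -
    have "{p \<in> space lborel2. norm (fst p - (snd p :: 'a)) \<noteq> 0} \<in> sets lborel2"
      by measurable
    then show ?thesis by simp
  qed
  ultimately show ?thesis by (intro lborel_pair.AE_pair_measure)
qed

section \<open>Integration by parts in symmetric double integrals\<close>

text \<open>
  Integration by parts in \<open>x\<close> for the regularised kernel, symmetrised in \<open>(x, y)\<close>: the difference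
  \<open>X x - X y\<close> compensates the singularity of the gradient of the kernel, so that the regularisation can be removed.
\<close>

lemma double_integration_by_parts:
  fixes F :: "'a::euclidean_space \<Rightarrow> 'a \<Rightarrow> real" and \<Gamma> :: "'a \<Rightarrow> 'a \<Rightarrow> 'a"
  assumes R: "R > 0" and a: "a \<ge> 0"
    and sym: "\<And>x y. F x y = F y x"
    and Fm[measurable]: "case_prod F \<in> borel_measurable lborel2"
    and Gm[measurable]: "case_prod \<Gamma> \<in> borel_measurable lborel2"
    and der: "\<And>x y. ((\<lambda>x. F x y) has_derivative (\<lambda>h. \<Gamma> x y \<bullet> h)) (at x)"
    and cont: "\<And>y. continuous_on UNIV (\<lambda>x. \<Gamma> x y)"
    and Fint: "integrable lborel2 (\<lambda>(x, y). F x y * norm (x - y) powr (- a))"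
    and Gint: "\<And>\<epsilon>. \<epsilon> > 0 \<Longrightarrow> integrable lborel2 (\<lambda>(x, y). (\<Gamma> x y \<bullet> radial_field R x) * reg_kernel a \<epsilon> (x - y))"
    and Tint: "integrable lborel2 (\<lambda>(x, y). (\<Gamma> x y \<bullet> radial_field R x + \<Gamma> y x \<bullet> radial_field R y) * norm (x - y) powr (- a))"
  shows "(\<integral>(x, y). (\<Gamma> x y \<bullet> radial_field R x + \<Gamma> y x \<bullet> radial_field R y) * norm (x - y) powr (- a) \<partial>lborel2)
    = - (\<integral>(x, y). F x y * norm (x - y) powr (- a) *
        (radial_div R x + radial_div R y - a * ((x - y) \<bullet> (radial_field R x - radial_field R y) / (norm (x - y))\<^sup>2)) \<partial>lborel2)"
proof -
  let ?M = "lborel2 :: ('a \<times> 'a) measure"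
  define N where "N = real DIM('a) + 4"
  \<comment> \<open>\<open>q\<close> is what integration by parts in \<open>x\<close> alone
    produces; \<open>Q\<close> is its symmetrisation, so that
    \<open>Q \<epsilon> x y = q \<epsilon> x y + q \<epsilon> y x\<close>.\<close>
  define q where "q \<epsilon> x y = radial_div R x * reg_kernel a \<epsilon> (x - y) + reg_kernel_grad a \<epsilon> (x - y) \<bullet> radial_field R x" for \<epsilon> and x y :: 'a
  define Q where "Q \<epsilon> x y = (radial_div R x + radial_div R y) * reg_kernel a \<epsilon> (x - y) + reg_kernel_grad a \<epsilon> (x - y) \<bullet> (radial_field R x - radial_field R y)" for \<epsilon> and x y :: 'a
  have field_R: "norm (radial_field R x) \<le> R" for x :: 'a
  proof (cases "norm x \<le> R")
    case True
    then show ?thesis using norm_radial_field_le[of R x] by linarith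
  qed (use R in \<open>simp add: radial_field_eq_0\<close>)
  have swapm[measurable]: "(\<lambda>(x, y). F y x) \<in> borel_measurable ?M" "(\<lambda>(x, y). \<Gamma> y x) \<in> borel_measurable ?M"
    using measurable_pair_swap[OF Fm] measurable_pair_swap[OF Gm] by (simp_all add: case_prod_unfold)
  have Fq: "integrable ?M (\<lambda>(x, y). F x y * q \<epsilon> x y)" if e: "\<epsilon> > 0" for \<epsilon>
  proof (rule Bochner_Integration.integrable_bound[OF integrable_mult_right[OF Fint, of "N + a * (R * (1 + 1 / \<epsilon>))"]])
    show "(\<lambda>(x, y). F x y * q \<epsilon> x y) \<in> borel_measurable ?M" unfolding q_def case_prod_unfold by measurable
    show "AE p in ?M. norm (case p of (x, y) \<Rightarrow> F x y * q \<epsilon> x y)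
        \<le> norm ((N + a * (R * (1 + 1 / \<epsilon>))) * (case p of (x, y) \<Rightarrow> F x y * norm (x - y) powr (- a)))"
      using AE_lborel_pair_neq
    proof eventually_elim
      case (elim p)
      obtain x y where p: "p = (x, y)" by (cases p)
      have "\<bar>radial_div R x * reg_kernel a \<epsilon> (x - y)\<bar> \<le> N * reg_kernel a \<epsilon> (x - y)"
        using radial_div_bound[of R x] by (simp add: abs_mult reg_kernel_nonneg N_def mult_right_mono)
      moreover have "\<bar>reg_kernel_grad a \<epsilon> (x - y) \<bullet> radial_field R x\<bar> \<le> a * (R * (1 + 1 / \<epsilon>)) * reg_kernel a \<epsilon> (x - y)"
        by (rule reg_kernel_grad_bound_const[OF e a field_R])
      ultimately have "\<bar>q \<epsilon> x y\<bar> \<le> (N + a * (R * (1 + 1 / \<epsilon>))) * reg_kernel a \<epsilon> (x - y)"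
        unfolding q_def distrib_right by linarith
      also have "\<dots> \<le> (N + a * (R * (1 + 1 / \<epsilon>))) * norm (x - y) powr (- a)"
        using elim p a R e by (intro mult_left_mono reg_kernel_le) (auto simp: N_def)
      finally have "\<bar>F x y\<bar> * \<bar>q \<epsilon> x y\<bar> \<le> \<bar>F x y\<bar> * ((N + a * (R * (1 + 1 / \<epsilon>))) * norm (x - y) powr (- a))"
        by (intro mult_left_mono) auto
      moreover have "N + a * (R * (1 + 1 / \<epsilon>)) \<ge> 0" using a R e by (simp add: N_def)
      ultimately show ?case by (simp add: p abs_mult mult_ac)
    qed
  qed
  \<comment> \<open>The two halves are split, exchanged and recombined at fixed
    \<open>\<epsilon>\<close>, where each is integrable by itself. Against the singular kernel only
    their sum is assumed integrable.\<close>
  have eps: "(\<integral>(x, y). (\<Gamma> x y \<bullet> radial_field R x + \<Gamma> y x \<bullet> radial_field R y) * reg_kernel a \<epsilon> (x - y) \<partial>?M) = - (\<integral>(x, y). F x y * Q \<epsilon> x y \<partial>?M)"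
    if e: "\<epsilon> > 0" for \<epsilon>
  proof -
    have A: "(\<integral>(x, y). (\<Gamma> x y \<bullet> radial_field R x) * reg_kernel a \<epsilon> (x - y) \<partial>?M) = - (\<integral>(x, y). F x y * q \<epsilon> x y \<partial>?M)"
    proof -
      have "(\<integral>(x, y). (\<Gamma> x y \<bullet> radial_field R x) * reg_kernel a \<epsilon> (x - y) \<partial>?M) = (\<integral>y. \<integral>x. (\<Gamma> x y \<bullet> radial_field R x) * reg_kernel a \<epsilon> (x - y) \<partial>lborel \<partial>lborel)"
        by (rule lborel_pair.integral_snd[OF Gint[OF e], symmetric])
      also have "\<dots> = (\<integral>y. - (\<integral>x. F x y * q \<epsilon> x y \<partial>lborel) \<partial>lborel)"
        unfolding q_def
        by (intro Bochner_Integration.integral_cong refl integration_by_parts_radial_field R der cont has_derivative_reg_kernel e continuous_on_reg_kernel)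
      also have "\<dots> = - (\<integral>(x, y). F x y * q \<epsilon> x y \<partial>?M)"
        using lborel_pair.integral_snd[OF Fq[OF e]] by simp
      finally show ?thesis .
    qed
    have B: "(\<integral>(x, y). (\<Gamma> y x \<bullet> radial_field R y) * reg_kernel a \<epsilon> (x - y) \<partial>?M) = (\<integral>(x, y). (\<Gamma> x y \<bullet> radial_field R x) * reg_kernel a \<epsilon> (x - y) \<partial>?M)"
      using lborel_pair.integral_product_swap[OF borel_measurable_integrable[OF Gint[OF e]]]
      by (simp add: case_prod_unfold reg_kernel_minus(1)[of a \<epsilon> "snd _" "fst _"])
    have Bi: "integrable ?M (\<lambda>(x, y). (\<Gamma> y x \<bullet> radial_field R y) * reg_kernel a \<epsilon> (x - y))"
      using lborel_pair.integrable_product_swap[OF Gint[OF e]]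
      by (simp add: case_prod_unfold reg_kernel_minus(1)[of a \<epsilon> "snd _" "fst _"])
    have C: "(\<integral>(x, y). F x y * q \<epsilon> y x \<partial>?M) = (\<integral>(x, y). F x y * q \<epsilon> x y \<partial>?M)"
      using lborel_pair.integral_product_swap[OF borel_measurable_integrable[OF Fq[OF e]]]
      by (simp add: case_prod_unfold sym[of "snd _" "fst _"])
    have Ci: "integrable ?M (\<lambda>(x, y). F x y * q \<epsilon> y x)"
      using lborel_pair.integrable_product_swap[OF Fq[OF e]]
      by (simp add: case_prod_unfold sym[of "snd _" "fst _"])
    have "(\<integral>(x, y). (\<Gamma> x y \<bullet> radial_field R x + \<Gamma> y x \<bullet> radial_field R y) * reg_kernel a \<epsilon> (x - y) \<partial>?M)
       = (\<integral>p. (case p of (x, y) \<Rightarrow> (\<Gamma> x y \<bullet> radial_field R x) * reg_kernel a \<epsilon> (x - y)) + (case p of (x, y) \<Rightarrow> (\<Gamma> y x \<bullet> radial_field R y) * reg_kernel a \<epsilon> (x - y)) \<partial>?M)"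
      by (simp add: case_prod_unfold distrib_right)
    also have "\<dots> = - (\<integral>(x, y). F x y * q \<epsilon> x y \<partial>?M) - (\<integral>(x, y). F x y * q \<epsilon> y x \<partial>?M)"
      by (subst Bochner_Integration.integral_add[OF Gint[OF e] Bi]) (simp add: A B C)
    also have "\<dots> = - (\<integral>p. (case p of (x, y) \<Rightarrow> F x y * q \<epsilon> x y) + (case p of (x, y) \<Rightarrow> F x y * q \<epsilon> y x) \<partial>?M)"
      by (subst Bochner_Integration.integral_add[OF Fq[OF e] Ci]) simp
    also have "(\<lambda>p. (case p of (x, y) \<Rightarrow> F x y * q \<epsilon> x y) + (case p of (x, y) \<Rightarrow> F x y * q \<epsilon> y x)) = (\<lambda>(x, y). F x y * Q \<epsilon> x y)"
    proof (intro ext)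
      fix p :: "'a \<times> 'a"
      obtain x y where p: "p = (x, y)" by (cases p)
      have "q \<epsilon> x y + q \<epsilon> y x = Q \<epsilon> x y"
        by (simp add: q_def Q_def reg_kernel_minus[of a \<epsilon> y x] inner_diff_right algebra_simps)
      then show "(case p of (x, y) \<Rightarrow> F x y * q \<epsilon> x y) + (case p of (x, y) \<Rightarrow> F x y * q \<epsilon> y x) = (case p of (x, y) \<Rightarrow> F x y * Q \<epsilon> x y)"
        by (simp add: p flip: distrib_left)
    qed
    finally show ?thesis .
  qed
  define e where "e n = 1 / real (Suc n)" for n
  have e: "e n > 0" for n by (simp add: e_def)
  have L1: "(\<lambda>n. \<integral>(x, y). (\<Gamma> x y \<bullet> radial_field R x + \<Gamma> y x \<bullet> radial_field R y) * reg_kernel a (e n) (x - y) \<partial>?M)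
     \<longlonglongrightarrow> (\<integral>(x, y). (\<Gamma> x y \<bullet> radial_field R x + \<Gamma> y x \<bullet> radial_field R y) * norm (x - y) powr (- a) \<partial>?M)"
  proof (rule integral_dominated_convergence[OF _ _ integrable_norm[OF Tint]])
    show "(\<lambda>(x, y). (\<Gamma> x y \<bullet> radial_field R x + \<Gamma> y x \<bullet> radial_field R y) * reg_kernel a (e n) (x - y)) \<in> borel_measurable ?M" for n
      by measurable
    show "(\<lambda>(x, y). (\<Gamma> x y \<bullet> radial_field R x + \<Gamma> y x \<bullet> radial_field R y) * norm (x - y) powr (- a)) \<in> borel_measurable ?M"
      by measurable
    show "AE p in ?M. norm (case p of (x, y) \<Rightarrow> (\<Gamma> x y \<bullet> radial_field R x + \<Gamma> y x \<bullet> radial_field R y) * reg_kernel a (e n) (x - y))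
       \<le> norm (case p of (x, y) \<Rightarrow> (\<Gamma> x y \<bullet> radial_field R x + \<Gamma> y x \<bullet> radial_field R y) * norm (x - y) powr (- a))" for n
      using AE_lborel_pair_neq
      by eventually_elim (auto simp: abs_mult reg_kernel_nonneg intro!: mult_left_mono reg_kernel_le e a)
    show "AE p in ?M. (\<lambda>n. case p of (x, y) \<Rightarrow> (\<Gamma> x y \<bullet> radial_field R x + \<Gamma> y x \<bullet> radial_field R y) * reg_kernel a (e n) (x - y))
       \<longlonglongrightarrow> (case p of (x, y) \<Rightarrow> (\<Gamma> x y \<bullet> radial_field R x + \<Gamma> y x \<bullet> radial_field R y) * norm (x - y) powr (- a))"
      using AE_lborel_pair_neq
      by eventually_elim (auto simp: e_def simp del: of_nat_Suc intro!: tendsto_mult_left reg_kernel_tendsto)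
  qed
  \<comment> \<open>The majorant constant is uniform in \<open>\<epsilon>\<close>: 2N bounds the two
    divergences, and 5 is the Lipschitz constant of the field.\<close>
  have L2: "(\<lambda>n. \<integral>(x, y). F x y * Q (e n) x y \<partial>?M) \<longlonglongrightarrow> (\<integral>(x, y). F x y * norm (x - y) powr (- a) *
        (radial_div R x + radial_div R y - a * ((x - y) \<bullet> (radial_field R x - radial_field R y) / (norm (x - y))\<^sup>2)) \<partial>?M)"
  proof (rule integral_dominated_convergence[OF _ _ integrable_norm[OF integrable_mult_right[OF Fint, of "2 * N + a * 5"]]])
    show "(\<lambda>(x, y). F x y * Q (e n) x y) \<in> borel_measurable ?M" for n unfolding Q_def case_prod_unfold by measurable
    show "(\<lambda>(x, y). F x y * norm (x - y) powr (- a) *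
        (radial_div R x + radial_div R y - a * ((x - y) \<bullet> (radial_field R x - radial_field R y) / (norm (x - y))\<^sup>2))) \<in> borel_measurable ?M" by measurable
    show "AE p in ?M. norm (case p of (x, y) \<Rightarrow> F x y * Q (e n) x y)
        \<le> norm ((2 * N + a * 5) * (case p of (x, y) \<Rightarrow> F x y * norm (x - y) powr (- a)))" for n
      using AE_lborel_pair_neq
    proof eventually_elim
      case (elim p)
      obtain x y where p: "p = (x, y)" by (cases p)
      have gen: "\<bar>s + t\<bar> \<le> 2 * N" if "\<bar>s\<bar> \<le> N" "\<bar>t\<bar> \<le> N" for s t :: real
        using that by linarith
      have "\<bar>radial_div R x + radial_div R y\<bar> \<le> 2 * N"
        using gen radial_div_bound[of R x] radial_div_bound[of R y] unfolding N_def by blast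
      then have "\<bar>(radial_div R x + radial_div R y) * reg_kernel a (e n) (x - y)\<bar> \<le> 2 * N * reg_kernel a (e n) (x - y)"
        by (simp add: abs_mult reg_kernel_nonneg mult_right_mono)
      moreover have "\<bar>reg_kernel_grad a (e n) (x - y) \<bullet> (radial_field R x - radial_field R y)\<bar> \<le> a * 5 * reg_kernel a (e n) (x - y)"
        by (rule reg_kernel_grad_bound_lipschitz[OF e a radial_field_lipschitz[OF R]]) simp
      ultimately have "\<bar>Q (e n) x y\<bar> \<le> (2 * N + a * 5) * reg_kernel a (e n) (x - y)"
        unfolding Q_def distrib_right by linarith
      also have "\<dots> \<le> (2 * N + a * 5) * norm (x - y) powr (- a)"
        using elim p a e by (intro mult_left_mono reg_kernel_le) (auto simp: N_def)
      finally have "\<bar>F x y\<bar> * \<bar>Q (e n) x y\<bar> \<le> \<bar>F x y\<bar> * ((2 * N + a * 5) * norm (x - y) powr (- a))"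
        by (intro mult_left_mono) auto
      moreover have "2 * N + a * 5 \<ge> 0" using a by (simp add: N_def)
      ultimately show ?case by (simp add: p abs_mult mult_ac)
    qed
    show "AE p in ?M. (\<lambda>n. case p of (x, y) \<Rightarrow> F x y * Q (e n) x y) \<longlonglongrightarrow> (case p of (x, y) \<Rightarrow> F x y * norm (x - y) powr (- a) *
        (radial_div R x + radial_div R y - a * ((x - y) \<bullet> (radial_field R x - radial_field R y) / (norm (x - y))\<^sup>2)))"
      using AE_lborel_pair_neq
    proof eventually_elim
      case (elim p)
      obtain x y where p: "p = (x, y)" by (cases p)
      have z: "x - y \<noteq> 0" using elim p by simp
      have "(\<lambda>n. F x y * Q (e n) x y) \<longlonglongrightarrow> F x y * ((radial_div R x + radial_div R y) * norm (x - y) powr (- a)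
         + - a * norm (x - y) powr (- a) * ((x - y) \<bullet> (radial_field R x - radial_field R y) / (norm (x - y))\<^sup>2))"
        unfolding Q_def e_def by (intro tendsto_intros reg_kernel_tendsto[OF z])
      moreover have "A * ((f + g) * w + - a * w * D) = A * w * (f + g - a * D)" for A f g w D :: real
        by (simp add: algebra_simps)
      ultimately show ?case by (simp only: p prod.case)
    qed
  qed
  show ?thesis
    using LIMSEQ_unique[OF L1] tendsto_minus[OF L2] e unfolding eps[OF e] by blast
qed

text \<open>As the radius grows, each divergence tends to the dimension and the increment of the
  field tends to x - y, so the bracket tends to 2 DIM - a. It is bounded uniformly in the radius, so
  integrability of \<open>F\<close> against the singular kernel suffices for dominated
  convergence.\<close>

lemma double_integration_by_parts_limit:
  fixes F :: "'a::euclidean_space \<Rightarrow> 'a \<Rightarrow> real" and \<Gamma> :: "'a \<Rightarrow> 'a \<Rightarrow> 'a"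
  assumes a: "a \<ge> 0"
    and sym: "\<And>x y. F x y = F y x"
    and Fm[measurable]: "case_prod F \<in> borel_measurable lborel2"
    and Gm[measurable]: "case_prod \<Gamma> \<in> borel_measurable lborel2"
    and der: "\<And>x y. ((\<lambda>x. F x y) has_derivative (\<lambda>h. \<Gamma> x y \<bullet> h)) (at x)"
    and cont: "\<And>y. continuous_on UNIV (\<lambda>x. \<Gamma> x y)"
    and Fint: "integrable lborel2 (\<lambda>(x, y). F x y * norm (x - y) powr (- a))"
    and Gint: "\<And>R \<epsilon>. R > 0 \<Longrightarrow> \<epsilon> > 0 \<Longrightarrow> integrable lborel2 (\<lambda>(x, y). (\<Gamma> x y \<bullet> radial_field R x) * reg_kernel a \<epsilon> (x - y))"
    and Tint: "\<And>R. R > 0 \<Longrightarrow> integrable lborel2 (\<lambda>(x, y). (\<Gamma> x y \<bullet> radial_field R x + \<Gamma> y x \<bullet> radial_field R y) * norm (x - y) powr (- a))"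
  shows "(\<lambda>n. \<integral>(x, y). (\<Gamma> x y \<bullet> radial_field (real (Suc n)) x + \<Gamma> y x \<bullet> radial_field (real (Suc n)) y) * norm (x - y) powr (- a) \<partial>lborel2)
    \<longlonglongrightarrow> - ((2 * real DIM('a) - a) * (\<integral>(x, y). F x y * norm (x - y) powr (- a) \<partial>lborel2))"
proof -
  let ?M = "lborel2 :: ('a \<times> 'a) measure"
  define N where "N = real DIM('a) + 4"
  define Q where "Q R x y = radial_div R x + radial_div R y - a * ((x - y) \<bullet> (radial_field R x - radial_field R y) / (norm (x - y))\<^sup>2)" for R and x y :: 'a
  have "(\<lambda>n. \<integral>(x, y). F x y * norm (x - y) powr (- a) * Q (real (Suc n)) x y \<partial>?M)
    \<longlonglongrightarrow> (\<integral>(x, y). F x y * norm (x - y) powr (- a) * (2 * real DIM('a) - a) \<partial>?M)"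
  proof (rule integral_dominated_convergence[OF _ _ integrable_norm[OF integrable_mult_right[OF Fint, of "2 * N + a * 5"]]])
    show "(\<lambda>(x, y). F x y * norm (x - y) powr (- a) * Q (real (Suc n)) x y) \<in> borel_measurable ?M" for n
      unfolding Q_def case_prod_unfold by measurable
    show "(\<lambda>(x, y). F x y * norm (x - y) powr (- a) * (2 * real DIM('a) - a)) \<in> borel_measurable ?M" by measurable
    show "AE p in ?M. norm (case p of (x, y) \<Rightarrow> F x y * norm (x - y) powr (- a) * Q (real (Suc n)) x y)
        \<le> norm ((2 * N + a * 5) * (case p of (x, y) \<Rightarrow> F x y * norm (x - y) powr (- a)))" for n
    proof (intro AE_I2)
      fix p :: "'a \<times> 'a"
      obtain x y where p: "p = (x, y)" by (cases p)
      let ?R = "real (Suc n)"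
      have R: "?R > 0" by simp
      have "\<bar>(x - y) \<bullet> (radial_field ?R x - radial_field ?R y)\<bar> \<le> norm (x - y) * norm (radial_field ?R x - radial_field ?R y)"
        by (rule Cauchy_Schwarz_ineq2)
      also have "\<dots> \<le> norm (x - y) * (5 * norm (x - y))"
        by (intro mult_left_mono radial_field_lipschitz R) auto
      finally have "\<bar>(x - y) \<bullet> (radial_field ?R x - radial_field ?R y)\<bar> \<le> 5 * (norm (x - y))\<^sup>2"
        by (simp add: power2_eq_square)
      then have "\<bar>(x - y) \<bullet> (radial_field ?R x - radial_field ?R y) / (norm (x - y))\<^sup>2\<bar> \<le> 5"
        by (cases "x = y") (simp_all add: abs_divide pos_divide_le_eq)
      then have "\<bar>a * ((x - y) \<bullet> (radial_field ?R x - radial_field ?R y) / (norm (x - y))\<^sup>2)\<bar> \<le> a * 5"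
        using a unfolding abs_mult by (intro mult_mono) auto
      moreover have "\<bar>s + t - r\<bar> \<le> 2 * N + a * 5" if "\<bar>s\<bar> \<le> N" "\<bar>t\<bar> \<le> N" "\<bar>r\<bar> \<le> a * 5" for s t r :: real
        using that by linarith
      ultimately have "\<bar>Q ?R x y\<bar> \<le> 2 * N + a * 5"
        using radial_div_bound[of ?R x] radial_div_bound[of ?R y] unfolding Q_def N_def by blast
      then have "\<bar>F x y * norm (x - y) powr (- a)\<bar> * \<bar>Q ?R x y\<bar> \<le> \<bar>F x y * norm (x - y) powr (- a)\<bar> * (2 * N + a * 5)"
        by (intro mult_left_mono) auto
      moreover have "2 * N + a * 5 \<ge> 0" using a by (simp add: N_def)
      ultimately show "norm (case p of (x, y) \<Rightarrow> F x y * norm (x - y) powr (- a) * Q ?R x y)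
        \<le> norm ((2 * N + a * 5) * (case p of (x, y) \<Rightarrow> F x y * norm (x - y) powr (- a)))"
        by (simp add: p abs_mult mult_ac del: of_nat_Suc)
    qed
    show "AE p in ?M. (\<lambda>n. case p of (x, y) \<Rightarrow> F x y * norm (x - y) powr (- a) * Q (real (Suc n)) x y)
       \<longlonglongrightarrow> (case p of (x, y) \<Rightarrow> F x y * norm (x - y) powr (- a) * (2 * real DIM('a) - a))"
      using AE_lborel_pair_neq
    proof eventually_elim
      case (elim p)
      obtain x y where p: "p = (x, y)" by (cases p)
      have z: "norm (x - y) \<noteq> 0" using elim p by simp
      have "(\<lambda>n. F x y * norm (x - y) powr (- a) * Q (real (Suc n)) x y)
         \<longlonglongrightarrow> F x y * norm (x - y) powr (- a) * (real DIM('a) + real DIM('a) - a * ((x - y) \<bullet> (x - y) / (norm (x - y))\<^sup>2))"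
        unfolding Q_def using z by (intro tendsto_intros radial_div_tendsto radial_field_tendsto) auto
      then show ?case using z by (simp add: p dot_square_norm del: of_nat_Suc)
    qed
  qed
  moreover have "(\<integral>(x, y). (\<Gamma> x y \<bullet> radial_field R x + \<Gamma> y x \<bullet> radial_field R y) * norm (x - y) powr (- a) \<partial>?M)
     = - (\<integral>(x, y). F x y * norm (x - y) powr (- a) * Q R x y \<partial>?M)" if "R > 0" for R
    unfolding Q_def by (rule double_integration_by_parts[OF that a sym Fm Gm der cont Fint Gint[OF that] Tint[OF that]])
  ultimately have "(\<lambda>n. \<integral>(x, y). (\<Gamma> x y \<bullet> radial_field (real (Suc n)) x + \<Gamma> y x \<bullet> radial_field (real (Suc n)) y) * norm (x - y) powr (- a) \<partial>?M)
    \<longlonglongrightarrow> - (\<integral>(x, y). F x y * norm (x - y) powr (- a) * (2 * real DIM('a) - a) \<partial>?M)"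
    by (simp add: tendsto_minus del: of_nat_Suc)
  also have "(\<integral>(x, y). F x y * norm (x - y) powr (- a) * (2 * real DIM('a) - a) \<partial>?M)
     = (2 * real DIM('a) - a) * (\<integral>(x, y). F x y * norm (x - y) powr (- a) \<partial>?M)"
    by (simp add: case_prod_unfold mult.commute)
  finally show ?thesis .
qed

section \<open>The Pohozaev identity\<close>

text \<open>The form in which \<open>C2\<close> enters: a gradient vector field, continuous and
  Lipschitz on balls. The Lipschitz constant is a bound of the second derivative on the compact
  convex ball.\<close>

lemma C2_gradient:
  fixes u :: "real^'n \<Rightarrow> real"
  assumes "C2 u"
  obtains G where "\<And>x. (u has_derivative (\<lambda>h. G x \<bullet> h)) (at x)" "continuous_on UNIV G"
    "\<And>R. \<exists>L\<ge>0. \<forall>x\<in>cball 0 R. \<forall>y\<in>cball 0 R. norm (G x - G y) \<le> L * norm (x - y)"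
proof -
  obtain D :: "real^'n \<Rightarrow> (real^'n) \<Rightarrow>\<^sub>L real" and H
    where D: "\<And>x. (u has_derivative blinfun_apply (D x)) (at x)"
      and H: "\<And>x. (D has_derivative blinfun_apply (H x)) (at x)" and cH: "continuous_on UNIV H"
    using assms by (auto simp: C2_def)
  define G where "G x = (\<Sum>b\<in>Basis. blinfun_apply (D x) b *\<^sub>R b)" for x
  have G: "G x \<bullet> h = blinfun_apply (D x) h" for x h
  proof -
    have "blinfun_apply (D x) h = blinfun_apply (D x) (\<Sum>b\<in>Basis. (h \<bullet> b) *\<^sub>R b)"
      by (simp only: euclidean_representation)
    also have "\<dots> = (\<Sum>b\<in>Basis. (h \<bullet> b) * blinfun_apply (D x) b)"
      by (simp add: blinfun.sum_right blinfun.scaleR_right)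
    also have "\<dots> = G x \<bullet> h" unfolding G_def inner_sum_left by (simp add: inner_commute mult.commute)
    finally show ?thesis by simp
  qed
  \<comment> \<open>The identification of functionals with vectors is isometric: the difference of
    functionals is evaluated at the difference of the vectors.\<close>
  have GD: "norm (G x - G y) \<le> norm (D x - D y)" for x y
  proof -
    have "(norm (G x - G y))\<^sup>2 = blinfun_apply (D x - D y) (G x - G y)"
      by (simp add: power2_norm_eq_inner inner_diff_left G blinfun.diff_left)
    also have "\<dots> \<le> norm (D x - D y) * norm (G x - G y)"
      using norm_blinfun[of "D x - D y" "G x - G y"] by simp
    finally show ?thesis by (cases "G x = G y") (simp_all add: power2_eq_square)
  qed
  have lip: "\<exists>L\<ge>0. \<forall>x\<in>cball 0 R. \<forall>y\<in>cball 0 R. norm (G x - G y) \<le> L * norm (x - y)" for R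
  proof -
    have "compact (H ` cball 0 R)"
      using cH by (intro compact_continuous_image) (auto intro: continuous_on_subset)
    then obtain B where B: "\<And>x. x \<in> cball 0 R \<Longrightarrow> norm (H x) \<le> B"
      by (meson bounded_iff compact_imp_bounded imageI)
    have "norm (D x - D y) \<le> max 0 B * norm (x - y)" if "x \<in> cball 0 R" "y \<in> cball 0 R" for x y
    proof (rule differentiable_bound[of "cball 0 R" D "\<lambda>x. blinfun_apply (H x)"])
      show "(D has_derivative blinfun_apply (H x)) (at x within cball 0 R)" for x
        using H by (rule has_derivative_at_withinI)
      show "onorm (blinfun_apply (H x)) \<le> max 0 B" if "x \<in> cball 0 R" for x
        using B[OF that] by (simp add: norm_blinfun.rep_eq[symmetric])
    qed (use that in auto)
    then show ?thesis using order_trans[OF GD] by (intro exI[of _ "max 0 B"]) simp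
  qed
  have "continuous_on UNIV D" using H by (meson continuous_at_imp_continuous_on has_derivative_continuous)
  then have "continuous_on UNIV G" unfolding G_def by (intro continuous_intros)
  moreover have "(u has_derivative (\<lambda>h. G x \<bullet> h)) (at x)" for x using D[of x] by (simp add: G)
  ultimately show ?thesis using that lip by blast
qed

text \<open>A product estimate. \<open>G\<close> is controlled only on the ball, but the field
  vanishes outside, so it is enough that one of the two points lies in the ball.\<close>

lemma gradient_radial_field_lipschitz:
  fixes G :: "'a::euclidean_space \<Rightarrow> 'a"
  assumes R: "R > 0" and G: "continuous_on UNIV G"
    and L: "L \<ge> 0" "\<And>x y. x \<in> cball 0 R \<Longrightarrow> y \<in> cball 0 R \<Longrightarrow> norm (G x - G y) \<le> L * norm (x - y)"
  obtains K where "\<And>x y. \<bar>G x \<bullet> radial_field R x - G y \<bullet> radial_field R y\<bar> \<le> K * norm (x - y)"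
proof -
  have "compact (G ` cball 0 R)"
    using G by (intro compact_continuous_image) (auto intro: continuous_on_subset)
  then obtain B where B: "\<And>x. x \<in> cball 0 R \<Longrightarrow> norm (G x) \<le> B"
    by (meson bounded_iff compact_imp_bounded imageI)
  have B0: "B \<ge> 0" using B[of 0] R norm_ge_zero[of "G 0"] by (simp del: norm_ge_zero)
  have half: "\<bar>G x \<bullet> radial_field R x - G y \<bullet> radial_field R y\<bar> \<le> (5 * B + R * L) * norm (x - y)" if x: "norm x \<le> R" for x y
  proof -
    have 1: "\<bar>G x \<bullet> (radial_field R x - radial_field R y)\<bar> \<le> B * (5 * norm (x - y))"
      using x by (intro order_trans[OF Cauchy_Schwarz_ineq2] mult_mono B radial_field_lipschitz R B0) auto
    have 2: "\<bar>(G x - G y) \<bullet> radial_field R y\<bar> \<le> (L * norm (x - y)) * R"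
    proof (cases "norm y \<le> R")
      case True
      then have "norm (radial_field R y) \<le> R" using norm_radial_field_le[of R y] by linarith
      then show ?thesis
        using x True L R by (intro order_trans[OF Cauchy_Schwarz_ineq2] mult_mono L(2)) auto
    qed (use L R in \<open>simp add: radial_field_eq_0\<close>)
    have "G x \<bullet> radial_field R x - G y \<bullet> radial_field R y = G x \<bullet> (radial_field R x - radial_field R y) + (G x - G y) \<bullet> radial_field R y"
      by (simp add: inner_diff_left inner_diff_right)
    then have "\<bar>G x \<bullet> radial_field R x - G y \<bullet> radial_field R y\<bar> \<le> B * (5 * norm (x - y)) + (L * norm (x - y)) * R"
      using 1 2 by linarith
    then show ?thesis by (simp add: algebra_simps)
  qed
  show ?thesis
  proof (rule that)
    fix x y
    show "\<bar>G x \<bullet> radial_field R x - G y \<bullet> radial_field R y\<bar> \<le> (5 * B + R * L) * norm (x - y)"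
    proof (cases "norm x \<le> R \<or> norm y \<le> R")
      case True
      then show ?thesis using half[of x y] half[of y x] by (auto simp: norm_minus_commute abs_minus_commute)
    next
      case False
      then show ?thesis using R B0 L by (simp add: radial_field_eq_0)
    qed
  qed
qed

section \<open>The power nonlinearity and the Riesz potential\<close>

lemma abs_powr_mult:
  assumes "p > (1::real)"
  shows "\<bar>t\<bar> powr (p - 2) * t = max 0 t powr (p - 1) - max 0 (- t) powr (p - 1)"
proof (cases t "0::real" rule: linorder_cases)
  case less
  have "\<bar>t\<bar> powr (p - 2) * \<bar>t\<bar> = \<bar>t\<bar> powr (p - 1)"
    using powr_mult_base[of "\<bar>t\<bar>" "p - 2"] by (simp add: mult.commute)
  then show ?thesis using less by (simp add: max_def)
next
  case greater
  have "\<bar>t\<bar> powr (p - 2) * \<bar>t\<bar> = \<bar>t\<bar> powr (p - 1)"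
    using powr_mult_base[of "\<bar>t\<bar>" "p - 2"] by (simp add: mult.commute)
  then show ?thesis using greater by (simp add: max_def)
qed simp

text \<open>For p < 2 the factor |t|^(p-2) is unbounded near 0. Splitting into positive and negative
  parts leaves only the positive exponent p - 1, where continuity is visible.\<close>

lemma continuous_on_abs_powr_mult:
  assumes "p > (1::real)" "continuous_on S f"
  shows "continuous_on S (\<lambda>x. \<bar>f x\<bar> powr (p - 2) * f x)"
  unfolding abs_powr_mult[OF assms(1)] using assms by (intro continuous_intros continuous_on_powr') auto

lemma DERIV_abs_powr:
  assumes p: "p > (1::real)"
  shows "((\<lambda>t. \<bar>t\<bar> powr p) has_real_derivative p * (\<bar>t\<bar> powr (p - 2) * t)) (at t)"
proof (cases t "0::real" rule: linorder_cases)
  case less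
  have "((\<lambda>t. (- t) powr p) has_real_derivative (p * (- t) powr (p - 1) * (- 1))) (at t)"
    using less by (auto intro!: derivative_eq_intros)
  moreover have "p * (- t) powr (p - 1) * (- 1) = p * (\<bar>t\<bar> powr (p - 2) * t)"
    using less unfolding abs_powr_mult[OF p] by simp
  ultimately have "((\<lambda>t. (- t) powr p) has_real_derivative p * (\<bar>t\<bar> powr (p - 2) * t)) (at t)" by simp
  then show ?thesis
    by (rule has_field_derivative_transform_within_open[of _ _ _ "{..<0}"]) (use less in auto)
next
  case greater
  have "((\<lambda>t. t powr p) has_real_derivative (p * t powr (p - 1))) (at t)"
    using greater by (auto intro!: derivative_eq_intros)
  moreover have "p * t powr (p - 1) = p * (\<bar>t\<bar> powr (p - 2) * t)"
    using greater unfolding abs_powr_mult[OF p] by simp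
  ultimately have "((\<lambda>t. t powr p) has_real_derivative p * (\<bar>t\<bar> powr (p - 2) * t)) (at t)" by simp
  then show ?thesis
    by (rule has_field_derivative_transform_within_open[of _ _ _ "{0<..}"]) (use greater in auto)
next
  case equal
  have "((\<lambda>h. \<bar>h\<bar> powr p / h) \<longlongrightarrow> 0) (at (0::real))"
  proof (rule Lim_null_comparison)
    show "eventually (\<lambda>h. norm (\<bar>h\<bar> powr p / h) \<le> \<bar>h\<bar> powr (p - 1)) (at (0::real))"
      by (intro always_eventually) (auto simp: powr_diff)
    have "((\<lambda>h. \<bar>h\<bar> powr (p - 1)) \<longlongrightarrow> \<bar>0\<bar> powr (p - 1)) (at (0::real))"
      using p by (intro tendsto_powr' tendsto_intros) auto
    then show "((\<lambda>h. \<bar>h\<bar> powr (p - 1)) \<longlongrightarrow> 0) (at (0::real))" by simp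
  qed
  then show ?thesis using equal by (simp add: DERIV_def)
qed

text \<open>By Tonelli's theorem the finiteness clause of \<open>weak_solution\<close> is absolute
  integrability of a double integral against |x - y|^(-a). This brings the Choquard term into the
  shape of the Gagliardo term.\<close>

lemma riesz_conv_pair:
  fixes f w :: "real^'n \<Rightarrow> real"
  assumes f: "\<And>x. f x \<ge> 0" and [measurable]: "f \<in> borel_measurable borel" "w \<in> borel_measurable borel"
    and fin: "(\<integral>\<^sup>+x. riesz_conv \<alpha> f x * ennreal \<bar>w x\<bar> \<partial>lborel) < \<infinity>"
  defines "a \<equiv> real CARD('n) - \<alpha>"
  shows "integrable lborel2 (\<lambda>(x, y). f y * w x * norm (x - y) powr (- a))"
    and "(\<integral>(x, y). f y * w x * norm (x - y) powr (- a) \<partial>lborel2) = (\<integral>x. enn2real (riesz_conv \<alpha> f x) * w x \<partial>lborel)"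
proof -
  have k: "riesz_kernel \<alpha> (x - y) = norm (x - y) powr (- a)" for x y :: "real^'n"
    by (simp add: riesz_kernel_def a_def)
  have conv: "riesz_conv \<alpha> f x = (\<integral>\<^sup>+y. ennreal (norm (x - y) powr (- a) * f y) \<partial>lborel)" for x
    by (simp add: riesz_conv_def k)
  show int: "integrable lborel2 (\<lambda>(x, y). f y * w x * norm (x - y) powr (- a))"
  proof (rule lborel_pair_integrableI)
    have "(\<integral>\<^sup>+x. \<integral>\<^sup>+y. ennreal (norm (f y * w x * norm (x - y) powr (- a))) \<partial>lborel \<partial>lborel)
       = (\<integral>\<^sup>+x. riesz_conv \<alpha> f x * ennreal \<bar>w x\<bar> \<partial>lborel)"
    proof (rule nn_integral_cong)
      fix x
      have "(\<integral>\<^sup>+y. ennreal (norm (f y * w x * norm (x - y) powr (- a))) \<partial>lborel)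
         = (\<integral>\<^sup>+y. ennreal (norm (x - y) powr (- a) * f y) * ennreal \<bar>w x\<bar> \<partial>lborel)"
        using f by (intro nn_integral_cong) (simp add: abs_mult mult_ac flip: ennreal_mult)
      also have "\<dots> = riesz_conv \<alpha> f x * ennreal \<bar>w x\<bar>"
        unfolding conv by (rule nn_integral_multc) measurable
      finally show "(\<integral>\<^sup>+y. ennreal (norm (f y * w x * norm (x - y) powr (- a))) \<partial>lborel) = riesz_conv \<alpha> f x * ennreal \<bar>w x\<bar>" .
    qed
    then show "(\<integral>\<^sup>+x. \<integral>\<^sup>+y. ennreal (norm (f y * w x * norm (x - y) powr (- a))) \<partial>lborel \<partial>lborel) < \<infinity>"
      using fin by simp
  qed measurable
  have "(\<integral>(x, y). f y * w x * norm (x - y) powr (- a) \<partial>lborel2) = (\<integral>x. \<integral>y. f y * w x * norm (x - y) powr (- a) \<partial>lborel \<partial>lborel)"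
    by (rule lborel_pair.integral_fst[OF int, symmetric])
  also have "\<dots> = (\<integral>x. (\<integral>y. norm (x - y) powr (- a) * f y \<partial>lborel) * w x \<partial>lborel)"
  proof (rule Bochner_Integration.integral_cong[OF refl])
    fix x
    have "(\<integral>y. f y * w x * norm (x - y) powr (- a) \<partial>lborel) = (\<integral>y. (norm (x - y) powr (- a) * f y) * w x \<partial>lborel)"
      by (intro Bochner_Integration.integral_cong refl) (simp add: mult_ac)
    also have "\<dots> = (\<integral>y. norm (x - y) powr (- a) * f y \<partial>lborel) * w x"
      by (rule integral_mult_left_zero)
    finally show "(\<integral>y. f y * w x * norm (x - y) powr (- a) \<partial>lborel) = (\<integral>y. norm (x - y) powr (- a) * f y \<partial>lborel) * w x" .
  qed
  \<comment> \<open>Where the convolution is infinite, the Bochner integral and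
    \<open>enn2real\<close> both take the value 0, so the equality holds at every
    \<open>x\<close>.\<close>
  also have "\<dots> = (\<integral>x. enn2real (riesz_conv \<alpha> f x) * w x \<partial>lborel)"
    unfolding conv using f by (intro Bochner_Integration.integral_cong refl arg_cong2[where f = "(*)"] integral_eq_nn_integral) auto
  finally show "(\<integral>(x, y). f y * w x * norm (x - y) powr (- a) \<partial>lborel2) = (\<integral>x. enn2real (riesz_conv \<alpha> f x) * w x \<partial>lborel)" .
qed

text \<open>Bounded on the unit ball; outside it dominated by the radial weight, with m = t + 1 as
  one admissible exponent above t.\<close>

lemma nn_integral_reg_kernel_finite:
  assumes e: "\<epsilon> > 0" and t: "t > 0"
  shows "(\<integral>\<^sup>+(z::'a::euclidean_space). ennreal (reg_kernel (real DIM('a) + t) \<epsilon> z) \<partial>lborel) < \<infinity>"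
proof -
  define a where "a = real DIM('a) + t"
  have a: "a > 0" using t by (simp add: a_def)
  have "(\<integral>\<^sup>+(z::'a). ennreal (reg_kernel a \<epsilon> z) \<partial>lborel)
     \<le> (\<integral>\<^sup>+(z::'a). ennreal (\<epsilon> powr (- a / 2) * indicator (cball 0 1) z) + ennreal (min 1 (norm z powr (t + 1)) * norm z powr (- a)) \<partial>lborel)"
  proof (rule nn_integral_mono)
    fix z :: 'a
    have "reg_kernel a \<epsilon> z \<le> \<epsilon> powr (- a / 2) * indicator (cball 0 1) z + min 1 (norm z powr (t + 1)) * norm z powr (- a)"
    proof (cases "norm z \<le> 1")
      case True
      have "reg_kernel a \<epsilon> z \<le> \<epsilon> powr (- a / 2)" unfolding reg_kernel_def using e a by (intro powr_mono2') auto
      then show ?thesis using True by (simp add: add_increasing2)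
    next
      case False
      have "reg_kernel a \<epsilon> z \<le> norm z powr (- a)" using False e a by (intro reg_kernel_le) auto
      then show ?thesis using False t by (simp add: min_absorb1 ge_one_powr_ge_zero)
    qed
    from ennreal_leI[OF this] show "ennreal (reg_kernel a \<epsilon> z) \<le> ennreal (\<epsilon> powr (- a / 2) * indicator (cball 0 1) z) + ennreal (min 1 (norm z powr (t + 1)) * norm z powr (- a))"
      by (subst (asm) ennreal_plus) simp_all
  qed
  also have "\<dots> = (\<integral>\<^sup>+(z::'a). ennreal (\<epsilon> powr (- a / 2) * indicator (cball 0 1) z) \<partial>lborel)
     + (\<integral>\<^sup>+(z::'a). ennreal (min 1 (norm z powr (t + 1)) * norm z powr (- a)) \<partial>lborel)"
  proof (rule nn_integral_add)
    show "(\<lambda>z::'a. ennreal (\<epsilon> powr (- a / 2) * indicator (cball 0 1) z)) \<in> borel_measurable lborel"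
      using borel_measurable_integrable[OF integrable_mult_right[OF integrable_indicator_cball[of "0::'a" 1], of "\<epsilon> powr (- a / 2)"]]
      by measurable
  qed measurable
  also have "\<dots> < \<infinity>"
  proof -
    have "integrable lborel (\<lambda>z::'a. \<epsilon> powr (- a / 2) * indicator (cball 0 1) z)"
      by (intro integrable_mult_right integrable_indicator_cball)
    then have "(\<integral>\<^sup>+(z::'a). ennreal (\<epsilon> powr (- a / 2) * indicator (cball 0 1) z) \<partial>lborel) < \<infinity>"
      by (subst nn_integral_eq_integral) auto
    moreover have "(\<integral>\<^sup>+(z::'a). ennreal (min 1 (norm z powr (t + 1)) * norm z powr (- a)) \<partial>lborel) < \<infinity>"
      unfolding a_def by (rule nn_integral_radial_weight_finite) (use t in auto)
    ultimately show ?thesis by simp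
  qed
  finally show ?thesis unfolding a_def .
qed

section \<open>Positivity of the two norms of a nontrivial solution\<close>

lemma continuous_AE_eq_0:
  fixes u :: "'a::euclidean_space \<Rightarrow> real"
  assumes "continuous_on UNIV u" "AE x in lborel. u x = 0"
  shows "u x = 0"
proof -
  have "closed {x. u x = 0}" using assms(1) by (intro closed_Collect_eq continuous_intros)
  moreover have "AE x in lebesgue. x \<in> {x. u x = 0}" using assms(2) by (simp add: AE_completion)
  ultimately show ?thesis using mem_closed_if_AE_lebesgue by blast
qed

text \<open>The symbol vanishes at most at the origin, a null set, so a vanishing transform of
  \<open>g\<close> forces that of \<open>u\<close> to vanish; Plancherel's theorem is used in both
  directions.\<close>

lemma has_frac_laplacian_eq_0:
  fixes u :: "real^'n \<Rightarrow> real"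
  assumes "has_frac_laplacian t u g" "(\<integral>x. (g x)\<^sup>2 \<partial>lborel) = 0"
  shows "AE x in lborel. u x = 0"
proof -
  obtain U G where U: "has_L2_fourier u U" and G: "has_L2_fourier g G"
    and GU: "AE \<xi> in lborel. G \<xi> = of_real (norm \<xi> powr (2 * t)) * U \<xi>"
    using assms(1) by (auto simp: has_frac_laplacian_def)
  note [measurable] = has_L2_fourier_L2[OF U, THEN L2_measurable] has_L2_fourier_L2[OF G, THEN L2_measurable]
  have "(sq_integral lborel g) = 0"
    using L2_real_integrable[OF has_L2_fourier_L2(1)[OF G]] assms(2) by (simp add: nn_integral_eq_integral)
  then have "(sq_integral lborel G) = 0" using has_L2_fourier_plancherel[OF G] by simp
  then have "AE \<xi> in lborel. G \<xi> = 0" by (simp add: nn_integral_0_iff_AE)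
  moreover have "AE \<xi> in lborel. \<xi> \<noteq> (0 :: real^'n)" by (rule AE_lborel_singleton)
  ultimately have "AE \<xi> in lborel. U \<xi> = 0" using GU by eventually_elim auto
  then have "(sq_integral lborel U) = 0" by (simp add: nn_integral_0_iff_AE)
  then have "(sq_integral lborel u) = 0" using has_L2_fourier_plancherel[OF U] by simp
  then show ?thesis by (simp add: nn_integral_0_iff_AE)
qed

lemma sobolev_H_frac_laplacian:
  "v \<in> sobolev_H s \<Longrightarrow> has_frac_laplacian (s / 2) v (frac_laplacian (s / 2) v)"
  unfolding sobolev_H_def frac_laplacian_def using someI_ex[of "has_frac_laplacian (s / 2) v"] by auto

text \<open>With \<open>v R\<close> as test function and R -> infinity, the three terms tend to -(N
  - 2s)/2 A, -N/2 B and -(N + \<alpha>)/(2p) times the double integral \<open>I u\<close>. The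
  equation tested with \<open>u\<close> replaces \<open>I u\<close> by A + \<omega> B.\<close>

lemma pohozaev:
  fixes u :: "real^'n \<Rightarrow> real"
  assumes s: "0 < s" "s < 1" and \<alpha>: "0 < \<alpha>" "\<alpha> < real CARD('n)" and p: "p > 1"
    and u: "weak_solution s \<alpha> \<omega> p u" and C2: "C2 u"
  defines "A \<equiv> \<integral>x. (frac_laplacian (s / 2) u x)\<^sup>2 \<partial>lborel" and "B \<equiv> \<integral>x. (u x)\<^sup>2 \<partial>lborel"
  shows "(real CARD('n) - 2 * s) * A + real CARD('n) * (\<omega> * B) = (real CARD('n) + \<alpha>) / p * (A + \<omega> * B)"
proof -
  let ?M = "lborel2 :: ((real^'n) \<times> (real^'n)) measure"
  define N where "N = real CARD('n)"
  obtain G where G: "\<And>x. (u has_derivative (\<lambda>h. G x \<bullet> h)) (at x)" and cG: "continuous_on UNIV G"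
    and lipG: "\<And>R. \<exists>L\<ge>0. \<forall>x\<in>cball 0 R. \<forall>y\<in>cball 0 R. norm (G x - G y) \<le> L * norm (x - y)"
    using C2_gradient[OF C2] by blast
  have cu: "continuous_on UNIV u" using G by (meson continuous_at_imp_continuous_on has_derivative_continuous)
  then have [measurable]: "u \<in> borel_measurable borel" by (rule borel_measurable_continuous_onI)
  have [measurable]: "G \<in> borel_measurable borel" using cG by (rule borel_measurable_continuous_onI)
  have uH: "u \<in> sobolev_H s" using u by (simp add: weak_solution_def)
  define v where "v R x = G x \<bullet> radial_field R x" for R x
  have [measurable]: "v R \<in> borel_measurable borel" for R unfolding v_def by measurable
  have cv: "continuous_on UNIV (v R)" for R unfolding v_def by (intro continuous_intros cG)
  have v0: "v R x = 0" if "R > 0" "norm x \<ge> R" for R x using that by (simp add: v_def radial_field_eq_0)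
  have vH: "v R \<in> sobolev_H s" if R: "R > 0" for R
  proof -
    obtain L where L: "L \<ge> 0" "\<And>x y. x \<in> cball 0 R \<Longrightarrow> y \<in> cball 0 R \<Longrightarrow> norm (G x - G y) \<le> L * norm (x - y)"
      using lipG by blast
    obtain K where K: "\<And>x y. \<bar>G x \<bullet> radial_field R x - G y \<bullet> radial_field R y\<bar> \<le> K * norm (x - y)"
      using gradient_radial_field_lipschitz[OF R cG L] by blast
    show ?thesis
      by (rule sobolev_H_compact_lipschitz[OF s, of "v R" K R]) (use K R in \<open>auto simp: v_def radial_field_eq_0\<close>)
  qed
  define f where "f x = \<bar>u x\<bar> powr p" for x
  define w where "w z x = \<bar>u x\<bar> powr (p - 2) * u x * z x" for z :: "real^'n \<Rightarrow> real" and x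
  define I where "I z = (\<integral>x. enn2real (riesz_conv \<alpha> f x) * w z x \<partial>lborel)" for z
  have f0: "f x \<ge> 0" for x by (simp add: f_def)
  have [measurable]: "f \<in> borel_measurable borel" unfolding f_def by measurable
  have wm[measurable]: "w z \<in> borel_measurable borel" if "z \<in> borel_measurable borel" for z
    unfolding w_def using that by measurable
  have fin: "(\<integral>\<^sup>+x. riesz_conv \<alpha> f x * ennreal \<bar>w z x\<bar> \<partial>lborel) < \<infinity>"
    and eq: "(\<integral>x. frac_laplacian (s / 2) u x * frac_laplacian (s / 2) z x \<partial>lborel) + \<omega> * (\<integral>x. u x * z x \<partial>lborel) = I z"
    if "z \<in> sobolev_H s" for z
    using u that unfolding weak_solution_def f_def[abs_def] w_def I_def by auto
  have wu: "w u x = f x" for x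
  proof -
    have "\<bar>u x\<bar> powr (p - 2) * u x * u x = \<bar>u x\<bar> powr (p - 2) * \<bar>u x\<bar> powr 2" by (simp add: power2_eq_square)
    also have "\<dots> = \<bar>u x\<bar> powr p" by (simp only: powr_add[symmetric]) simp
    finally show ?thesis by (simp add: w_def f_def)
  qed
  define b where "b = N - \<alpha>"
  have b: "b \<ge> 0" using \<alpha> by (simp add: b_def N_def)
  note pair = riesz_conv_pair[OF f0 _ wm fin, folded N_def, folded b_def, folded I_def]
  note pairu = pair[OF _ _ uH, unfolded wu, simplified]
  define k where "k = 2 * levy_const TYPE('n) (2 * s)"
  have k: "k > 0" unfolding k_def using levy_const_pos[of "2 * s", where 'n = 'n] s by simp
  note hu = sobolev_H_frac_laplacian[OF uH]
  define E where "E z = (\<integral>x. frac_laplacian (s / 2) u x * frac_laplacian (s / 2) z x \<partial>lborel)" for z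
  note gag = gagliardo_inner[OF s hu sobolev_H_frac_laplacian, folded k_def, folded E_def]
  have EA: "E u = A" by (simp add: E_def A_def power2_eq_square)
  define a where "a = N + 2 * s"
  have a: "a \<ge> 0" using s by (simp add: a_def N_def)
  have gag_eq: "gagliardo s u z = (\<lambda>(x, y). (u x - u y) * (z x - z y) * norm (x - y) powr (- a))" for z
    by (simp add: gagliardo_def a_def N_def)
  have L_E: "(\<lambda>n. E (v (real (Suc n)))) \<longlonglongrightarrow> - ((N - 2 * s) / 2 * A)"
  proof -
    \<comment> \<open>?\<Gamma> is the gradient of (u x - u y)^2 in \<open>x\<close>. Symmetrised
      and applied to the field it is twice the Gagliardo integrand of \<open>u\<close> and
      \<open>v R\<close>, so half of 2N - a = N - 2s remains.\<close>
    let ?F = "\<lambda>x y. (u x - u y)\<^sup>2" and ?\<Gamma> = "\<lambda>x y. (2 * (u x - u y)) *\<^sub>R G x"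
    have T: "(?\<Gamma> x y \<bullet> radial_field R x + ?\<Gamma> y x \<bullet> radial_field R y) * norm (x - y) powr (- a) = 2 * gagliardo s u (v R) (x, y)" for R x y
      by (simp add: gag_eq v_def algebra_simps)
    have "(\<lambda>n. \<integral>(x, y). (?\<Gamma> x y \<bullet> radial_field (real (Suc n)) x + ?\<Gamma> y x \<bullet> radial_field (real (Suc n)) y) * norm (x - y) powr (- a) \<partial>?M)
      \<longlonglongrightarrow> - ((2 * real DIM(real^'n) - a) * (\<integral>(x, y). ?F x y * norm (x - y) powr (- a) \<partial>?M))"
    proof (rule double_integration_by_parts_limit[OF a])
      show "?F x y = ?F y x" for x y by (rule power2_commute)
      show "case_prod ?F \<in> borel_measurable ?M" "case_prod ?\<Gamma> \<in> borel_measurable ?M" by measurable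
      show "((\<lambda>x. ?F x y) has_derivative (\<lambda>h. ?\<Gamma> x y \<bullet> h)) (at x)" for x y
        by (auto intro!: derivative_eq_intros G)
      show "continuous_on UNIV (\<lambda>x. ?\<Gamma> x y)" for y by (intro continuous_intros cu cG)
      show "integrable ?M (\<lambda>(x, y). ?F x y * norm (x - y) powr (- a))"
        using gag(1)[OF uH] by (simp add: gag_eq power2_eq_square)
      show "integrable ?M (\<lambda>(x, y). (?\<Gamma> x y \<bullet> radial_field R x + ?\<Gamma> y x \<bullet> radial_field R y) * norm (x - y) powr (- a))" if "R > 0" for R
        unfolding T using integrable_mult_right[OF gag(1)[OF vH[OF that]], of 2] by (simp add: case_prod_unfold)
      show "integrable ?M (\<lambda>(x, y). (?\<Gamma> x y \<bullet> radial_field R x) * reg_kernel a \<epsilon> (x - y))" if R: "R > 0" and e: "\<epsilon> > 0" for R \<epsilon>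
      proof -
        \<comment> \<open>By 2 |a b| \<le> a^2 + b^2 the integrand splits: the increment of
          \<open>u\<close> is integrable even against the singular kernel, and \<open>v R\<close>
          has compact support while the regularised kernel is integrable.\<close>
        have i1: "integrable ?M (\<lambda>(x, y). (u x - u y)\<^sup>2 * norm (x - y) powr (- a))"
          using gag(1)[OF uH] by (simp add: gag_eq power2_eq_square)
        have i2: "integrable ?M (\<lambda>(x, y). (v R x)\<^sup>2 * reg_kernel a \<epsilon> (x - y))"
        proof (rule lborel_pair_integrableI)
          have "(\<integral>\<^sup>+x. \<integral>\<^sup>+y. ennreal (norm ((v R x)\<^sup>2 * reg_kernel a \<epsilon> (x - y))) \<partial>lborel \<partial>lborel)
             = (\<integral>\<^sup>+x. ennreal ((v R x)\<^sup>2) * (\<integral>\<^sup>+z. ennreal (reg_kernel a \<epsilon> (z :: real^'n)) \<partial>lborel) \<partial>lborel)"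
          proof (rule nn_integral_cong)
            fix x
            have "(\<integral>\<^sup>+y. ennreal (norm ((v R x)\<^sup>2 * reg_kernel a \<epsilon> (x - y))) \<partial>lborel) = (\<integral>\<^sup>+y. ennreal ((v R x)\<^sup>2) * ennreal (reg_kernel a \<epsilon> (x - y)) \<partial>lborel)"
              by (intro nn_integral_cong) (simp add: reg_kernel_nonneg ennreal_mult abs_mult)
            also have "\<dots> = ennreal ((v R x)\<^sup>2) * (\<integral>\<^sup>+y. ennreal (reg_kernel a \<epsilon> (x - y)) \<partial>lborel)"
              by (rule nn_integral_cmult) measurable
            also have "(\<integral>\<^sup>+y. ennreal (reg_kernel a \<epsilon> (x - y)) \<partial>lborel) = (\<integral>\<^sup>+z. ennreal (reg_kernel a \<epsilon> (z :: real^'n)) \<partial>lborel)"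
              by (rule nn_integral_lborel_reflect) measurable
            finally show "(\<integral>\<^sup>+y. ennreal (norm ((v R x)\<^sup>2 * reg_kernel a \<epsilon> (x - y))) \<partial>lborel) = ennreal ((v R x)\<^sup>2) * (\<integral>\<^sup>+z. ennreal (reg_kernel a \<epsilon> (z :: real^'n)) \<partial>lborel)" .
          qed
          also have "\<dots> = (\<integral>\<^sup>+x. ennreal ((v R x)\<^sup>2) \<partial>lborel) * (\<integral>\<^sup>+z. ennreal (reg_kernel a \<epsilon> (z :: real^'n)) \<partial>lborel)"
            by (rule nn_integral_multc) measurable
          also have "\<dots> < \<infinity>"
          proof -
            have "integrable lborel (\<lambda>x. (v R x)\<^sup>2)"
              by (rule integrable_continuous_compact_support[where R = R]) (use v0 R cv in \<open>auto intro!: continuous_intros\<close>)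
            then have "(\<integral>\<^sup>+x. ennreal ((v R x)\<^sup>2) \<partial>lborel) < \<infinity>" by (subst nn_integral_eq_integral) auto
            then show ?thesis
              using nn_integral_reg_kernel_finite[OF e, of "2 * s", where 'a = "real^'n"] s by (simp add: a_def N_def ennreal_mult_less_top)
          qed
          finally show "(\<integral>\<^sup>+x. \<integral>\<^sup>+y. ennreal (norm ((v R x)\<^sup>2 * reg_kernel a \<epsilon> (x - y))) \<partial>lborel \<partial>lborel) < \<infinity>" .
        qed measurable
        show ?thesis
        proof (rule Bochner_Integration.integrable_bound[OF Bochner_Integration.integrable_add[OF i1 i2]])
          show "AE q in ?M. norm (case q of (x, y) \<Rightarrow> (?\<Gamma> x y \<bullet> radial_field R x) * reg_kernel a \<epsilon> (x - y))
             \<le> norm ((case q of (x, y) \<Rightarrow> (u x - u y)\<^sup>2 * norm (x - y) powr (- a)) + (case q of (x, y) \<Rightarrow> (v R x)\<^sup>2 * reg_kernel a \<epsilon> (x - y)))"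
            using AE_lborel_pair_neq
          proof eventually_elim
            case (elim q)
            obtain x y where q: "q = (x, y)" by (cases q)
            have "\<bar>?\<Gamma> x y \<bullet> radial_field R x\<bar> = 2 * \<bar>u x - u y\<bar> * \<bar>v R x\<bar>"
              unfolding v_def inner_scaleR_left abs_mult by simp
            also have "\<dots> \<le> \<bar>u x - u y\<bar>\<^sup>2 + \<bar>v R x\<bar>\<^sup>2" by (rule sum_squares_bound)
            finally have "\<bar>?\<Gamma> x y \<bullet> radial_field R x\<bar> * reg_kernel a \<epsilon> (x - y) \<le> ((u x - u y)\<^sup>2 + (v R x)\<^sup>2) * reg_kernel a \<epsilon> (x - y)"
              by (intro mult_right_mono) (simp_all add: reg_kernel_nonneg)
            also have "\<dots> \<le> (u x - u y)\<^sup>2 * norm (x - y) powr (- a) + (v R x)\<^sup>2 * reg_kernel a \<epsilon> (x - y)"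
              unfolding distrib_right using elim q a e by (intro add_right_mono mult_left_mono reg_kernel_le) auto
            finally have "\<bar>?\<Gamma> x y \<bullet> radial_field R x\<bar> * reg_kernel a \<epsilon> (x - y) \<le> (u x - u y)\<^sup>2 * norm (x - y) powr (- a) + (v R x)\<^sup>2 * reg_kernel a \<epsilon> (x - y)" .
            moreover have "\<bar>reg_kernel a \<epsilon> (x - y)\<bar> = reg_kernel a \<epsilon> (x - y)" by (simp add: reg_kernel_nonneg)
            ultimately show ?case unfolding q prod.case real_norm_def abs_mult by linarith
          qed
        qed measurable
      qed
    qed
    then have "(\<lambda>n. 2 * (k * E (v (real (Suc n))))) \<longlonglongrightarrow> - ((2 * N - a) * (k * E u))"
    proof -
      have l: "(\<integral>(x, y). (?\<Gamma> x y \<bullet> radial_field R x + ?\<Gamma> y x \<bullet> radial_field R y) * norm (x - y) powr (- a) \<partial>?M) = 2 * (k * E (v R))" if "R > 0" for R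
        unfolding T using gag(2)[OF vH[OF that]] by (simp add: case_prod_unfold)
      have r: "(\<integral>(x, y). ?F x y * norm (x - y) powr (- a) \<partial>?M) = k * E u"
        using gag(2)[OF uH] by (simp add: gag_eq power2_eq_square)
      assume "(\<lambda>n. \<integral>(x, y). (?\<Gamma> x y \<bullet> radial_field (real (Suc n)) x + ?\<Gamma> y x \<bullet> radial_field (real (Suc n)) y) * norm (x - y) powr (- a) \<partial>?M)
      \<longlonglongrightarrow> - ((2 * real DIM(real^'n) - a) * (\<integral>(x, y). ?F x y * norm (x - y) powr (- a) \<partial>?M))"
      then show ?thesis unfolding r using l by (simp add: N_def del: of_nat_Suc)
    qed
    then have "(\<lambda>n. (1 / (2 * k)) * (2 * (k * E (v (real (Suc n)))))) \<longlonglongrightarrow> (1 / (2 * k)) * (- ((2 * N - a) * (k * E u)))"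
      by (intro tendsto_intros)
    moreover have "(1 / (2 * k)) * (- ((2 * N - a) * (k * E u))) = - ((N - 2 * s) / 2 * A)"
      using k by (simp add: EA a_def field_simps)
    ultimately show ?thesis using k by (simp del: of_nat_Suc)
  qed
  have L_B: "(\<lambda>n. \<integral>x. u x * v (real (Suc n)) x \<partial>lborel) \<longlonglongrightarrow> - (N / 2 * B)"
  proof -
    have u2: "integrable lborel (\<lambda>x. (u x)\<^sup>2)"
      using uH by (auto simp: sobolev_H_def intro: L2_real_integrable)
    have *: "(\<integral>x. u x * v R x \<partial>lborel) = - (1 / 2) * (\<integral>x. (u x)\<^sup>2 * radial_div R x \<partial>lborel)" if R: "R > 0" for R
    proof -
      \<comment> \<open>The mass term carries no kernel: H = u^2, k = 1, k' = 0.\<close>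
      have "(\<integral>x. (((2 * u x) *\<^sub>R G x) \<bullet> radial_field R x) * 1 \<partial>lborel) = - (\<integral>x. (u x)\<^sup>2 * (radial_div R x * 1 + 0 \<bullet> radial_field R x) \<partial>lborel)"
        by (rule integration_by_parts_radial_field[OF R]) (auto intro!: derivative_eq_intros G continuous_intros cu cG)
      then have "2 * (\<integral>x. u x * v R x \<partial>lborel) = - (\<integral>x. (u x)\<^sup>2 * radial_div R x \<partial>lborel)"
        by (simp add: v_def mult.assoc)
      then show ?thesis by simp
    qed
    have "(\<lambda>n. \<integral>x. (u x)\<^sup>2 * radial_div (real (Suc n)) x \<partial>lborel) \<longlonglongrightarrow> (\<integral>x. (u x)\<^sup>2 * real DIM(real^'n) \<partial>lborel)"
    proof (rule integral_dominated_convergence)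
      show "integrable lborel (\<lambda>x. (u x)\<^sup>2 * (real DIM(real^'n) + 4))" using u2 by simp
      show "AE x in lborel. (\<lambda>n. (u x)\<^sup>2 * radial_div (real (Suc n)) x) \<longlonglongrightarrow> (u x)\<^sup>2 * real DIM(real^'n)"
        by (intro AE_I2 tendsto_intros radial_div_tendsto)
      show "AE x in lborel. norm ((u x)\<^sup>2 * radial_div (real (Suc n)) x) \<le> (u x)\<^sup>2 * (real DIM(real^'n) + 4)" for n
        unfolding norm_mult by (intro AE_I2 mult_mono) (use radial_div_bound[where 'a = "real^'n"] in auto)
    qed measurable
    then have "(\<lambda>n. - (1 / 2) * (\<integral>x. (u x)\<^sup>2 * radial_div (real (Suc n)) x \<partial>lborel)) \<longlonglongrightarrow> - (1 / 2) * (\<integral>x. (u x)\<^sup>2 * real DIM(real^'n) \<partial>lborel)"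
      by (intro tendsto_intros)
    then show ?thesis using * by (simp add: N_def B_def mult.commute del: of_nat_Suc)
  qed
  have L_I: "(\<lambda>n. I (v (real (Suc n)))) \<longlonglongrightarrow> - ((N + \<alpha>) / (2 * p) * I u)"
  proof -
    \<comment> \<open>Here each half is integrable by itself, by the finiteness clause with test
      function \<open>v R\<close>. The chain rule contributes p and the symmetrisation 2, which
      explains the divisor 2p.\<close>
    let ?F = "\<lambda>x y. f x * f y" and ?\<Gamma> = "\<lambda>x y. (f y * (p * (\<bar>u x\<bar> powr (p - 2) * u x))) *\<^sub>R G x"
    have T: "?\<Gamma> x y \<bullet> radial_field R x = p * (f y * w (v R) x)" for R x y by (simp add: w_def v_def)
    have i1: "integrable ?M (\<lambda>(x, y). f y * w (v R) x * norm (x - y) powr (- b))" if "R > 0" for R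
      by (rule pair(1)[OF _ _ vH[OF that]]) measurable
    have i2: "integrable ?M (\<lambda>(x, y). f x * w (v R) y * norm (x - y) powr (- b))" if "R > 0" for R
      using lborel_pair.integrable_product_swap[OF i1[OF that]] by (simp add: case_prod_unfold norm_minus_commute)
    have e1: "(\<integral>(x, y). f y * w (v R) x * norm (x - y) powr (- b) \<partial>?M) = I (v R)" if "R > 0" for R
      by (rule pair(2)[OF _ _ vH[OF that]]) measurable
    have e2: "(\<integral>(x, y). f x * w (v R) y * norm (x - y) powr (- b) \<partial>?M) = I (v R)" if "R > 0" for R
      using lborel_pair.integral_product_swap[OF borel_measurable_integrable[OF i1[OF that]]] e1[OF that]
      by (simp add: case_prod_unfold norm_minus_commute)
    have T': "(\<lambda>(x, y). (?\<Gamma> x y \<bullet> radial_field R x + ?\<Gamma> y x \<bullet> radial_field R y) * norm (x - y) powr (- b))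
       = (\<lambda>q. p * ((case q of (x, y) \<Rightarrow> f y * w (v R) x * norm (x - y) powr (- b)) + (case q of (x, y) \<Rightarrow> f x * w (v R) y * norm (x - y) powr (- b))))" for R
      unfolding T by (auto simp: fun_eq_iff algebra_simps)
    have "(\<lambda>n. \<integral>(x, y). (?\<Gamma> x y \<bullet> radial_field (real (Suc n)) x + ?\<Gamma> y x \<bullet> radial_field (real (Suc n)) y) * norm (x - y) powr (- b) \<partial>?M)
      \<longlonglongrightarrow> - ((2 * real DIM(real^'n) - b) * (\<integral>(x, y). ?F x y * norm (x - y) powr (- b) \<partial>?M))"
    proof (rule double_integration_by_parts_limit[OF b])
      show "?F x y = ?F y x" for x y by (rule mult.commute)
      show "case_prod ?F \<in> borel_measurable ?M" "case_prod ?\<Gamma> \<in> borel_measurable ?M" by measurable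
      show "((\<lambda>x. ?F x y) has_derivative (\<lambda>h. ?\<Gamma> x y \<bullet> h)) (at x)" for x y
      proof -
        have "(f has_derivative (\<lambda>h. (p * (\<bar>u x\<bar> powr (p - 2) * u x)) * (G x \<bullet> h))) (at x)"
          using DERIV_compose_FDERIV[OF DERIV_abs_powr[OF p] G, of x] unfolding f_def[abs_def] by (simp add: mult_ac)
        then show ?thesis by (auto intro!: derivative_eq_intros)
      qed
      show "continuous_on UNIV (\<lambda>x. ?\<Gamma> x y)" for y
        by (intro continuous_intros cu cG continuous_on_abs_powr_mult p)
      show "integrable ?M (\<lambda>(x, y). ?F x y * norm (x - y) powr (- b))"
        using pairu(1) by (simp add: mult.commute[of "f _" "f _"])
      show "integrable ?M (\<lambda>(x, y). (?\<Gamma> x y \<bullet> radial_field R x + ?\<Gamma> y x \<bullet> radial_field R y) * norm (x - y) powr (- b))" if "R > 0" for R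
        unfolding T' using i1[OF that] i2[OF that] by (intro integrable_mult_right Bochner_Integration.integrable_add)
      show "integrable ?M (\<lambda>(x, y). (?\<Gamma> x y \<bullet> radial_field R x) * reg_kernel b \<epsilon> (x - y))" if R: "R > 0" and e: "\<epsilon> > 0" for R \<epsilon>
      proof (rule Bochner_Integration.integrable_bound[OF integrable_mult_right[OF i1[OF R], of p]])
        show "AE q in ?M. norm (case q of (x, y) \<Rightarrow> (?\<Gamma> x y \<bullet> radial_field R x) * reg_kernel b \<epsilon> (x - y))
          \<le> norm (p * (case q of (x, y) \<Rightarrow> f y * w (v R) x * norm (x - y) powr (- b)))"
          using AE_lborel_pair_neq
        proof eventually_elim
          case (elim q)
          obtain x y where q: "q = (x, y)" by (cases q)
          have "\<bar>p * (f y * w (v R) x)\<bar> * reg_kernel b \<epsilon> (x - y) \<le> \<bar>p * (f y * w (v R) x)\<bar> * norm (x - y) powr (- b)"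
            using elim q b e by (intro mult_left_mono reg_kernel_le) auto
          then show ?case unfolding q prod.case T by (simp add: abs_mult reg_kernel_nonneg mult_ac)
        qed
      qed measurable
    qed
    moreover have "(\<integral>(x, y). (?\<Gamma> x y \<bullet> radial_field R x + ?\<Gamma> y x \<bullet> radial_field R y) * norm (x - y) powr (- b) \<partial>?M) = 2 * p * I (v R)" if "R > 0" for R
      unfolding T' using i1[OF that] i2[OF that] by (simp add: e1[OF that] e2[OF that])
    moreover have "(\<integral>(x, y). ?F x y * norm (x - y) powr (- b) \<partial>?M) = I u"
      using pairu(2) by (simp add: mult.commute[of "f _" "f _"])
    ultimately have "(\<lambda>n. 2 * p * I (v (real (Suc n)))) \<longlonglongrightarrow> - ((2 * N - b) * I u)"
      by (simp add: N_def del: of_nat_Suc)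
    then have "(\<lambda>n. (1 / (2 * p)) * (2 * p * I (v (real (Suc n))))) \<longlonglongrightarrow> (1 / (2 * p)) * (- ((2 * N - b) * I u))"
      by (intro tendsto_intros)
    also have "(\<lambda>n. (1 / (2 * p)) * (2 * p * I (v (real (Suc n))))) = (\<lambda>n. I (v (real (Suc n))))"
      using p by (simp del: of_nat_Suc)
    also have "(1 / (2 * p)) * (- ((2 * N - b) * I u)) = - ((N + \<alpha>) / (2 * p) * I u)"
      using p by (simp add: b_def field_simps)
    finally show ?thesis .
  qed
  have "(\<lambda>n. I (v (real (Suc n)))) = (\<lambda>n. E (v (real (Suc n))) + \<omega> * (\<integral>x. u x * v (real (Suc n)) x \<partial>lborel))"
    using eq[OF vH] by (simp add: E_def fun_eq_iff del: of_nat_Suc)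
  then have "(\<lambda>n. I (v (real (Suc n)))) \<longlonglongrightarrow> - ((N - 2 * s) / 2 * A) + \<omega> * (- (N / 2 * B))"
    by (simp only:) (intro tendsto_intros L_E L_B)
  from LIMSEQ_unique[OF L_I this]
  have "(N + \<alpha>) / p * I u = (N - 2 * s) * A + N * (\<omega> * B)" using p by (simp add: field_simps)
  moreover have "I u = A + \<omega> * B" using eq[OF uH] by (simp add: A_def B_def power2_eq_square)
  ultimately show ?thesis by (simp add: N_def)
qed

theorem theorem1p3:
  fixes s \<alpha> \<omega> p :: real
  assumes "CARD('n::finite) \<ge> 3"
    and "0 < s" and "s < 1"
    and "0 < \<alpha>" and "\<alpha> < real CARD('n)"
    and "\<omega> > 0"
    and "p > 1"
    and "p \<le> 1 + \<alpha> / real CARD('n) \<or>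
         p \<ge> (real CARD('n) + \<alpha>) / (real CARD('n) - 2 * s)"
  shows "\<not> (\<exists>u :: real ^ 'n \<Rightarrow> real. weak_solution s \<alpha> \<omega> p u \<and> C2 u \<and> (\<exists>x. u x \<noteq> 0))"
proof
  assume "\<exists>u :: real ^ 'n \<Rightarrow> real. weak_solution s \<alpha> \<omega> p u \<and> C2 u \<and> (\<exists>x. u x \<noteq> 0)"
  then obtain u :: "real^'n \<Rightarrow> real" and x0 where u: "weak_solution s \<alpha> \<omega> p u" and C2: "C2 u" and x0: "u x0 \<noteq> 0" by blast
  define N A B where "N = real CARD('n)" and "A = (\<integral>x. (frac_laplacian (s / 2) u x)\<^sup>2 \<partial>lborel)" and "B = (\<integral>x. (u x)\<^sup>2 \<partial>lborel)"
  have N: "N \<ge> 3" using assms(1) by (simp add: N_def)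
  have uH: "u \<in> sobolev_H s" using u by (simp add: weak_solution_def)
  have id: "(N - 2 * s) * A + N * (\<omega> * B) = (N + \<alpha>) / p * (A + \<omega> * B)"
    using pohozaev[OF assms(2-5,7) u C2] by (simp only: N_def A_def B_def)
  have "continuous_on UNIV u"
    using C2_gradient[OF C2] by (metis continuous_at_imp_continuous_on has_derivative_continuous)
  then have not0: "\<not> (AE x in lborel. u x = 0)" using continuous_AE_eq_0 x0 by blast
  have A: "A > 0"
    using has_frac_laplacian_eq_0[OF sobolev_H_frac_laplacian[OF uH]] not0
    by (auto simp: A_def less_le)
  have u2: "integrable lborel (\<lambda>x. (u x)\<^sup>2)"
    using uH by (auto simp: sobolev_H_def intro: L2_real_integrable)
  have B: "B > 0"
    using not0 integral_nonneg_eq_0_iff_AE[OF u2] by (auto simp: B_def less_le)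
  have wB: "\<omega> * B > 0" using assms(6) B by simp
  from assms(8) show False
  proof
    \<comment> \<open>This range means (N + \<alpha>)/p \<ge> N. In the identity the multiples of
      \<omega> B cancel and a nonpositive multiple of A has to be nonnegative.\<close>
    assume "p \<le> 1 + \<alpha> / real CARD('n)"
    then have "p * N \<le> N + \<alpha>" using N unfolding N_def[symmetric] by (simp add: field_simps)
    then have "N \<le> (N + \<alpha>) / p" using assms(7) by (simp add: field_simps)
    then have "N * (A + \<omega> * B) \<le> (N + \<alpha>) / p * (A + \<omega> * B)" using A wB by (intro mult_right_mono) auto
    then have "2 * s * A \<le> 0" using id by (simp add: algebra_simps)
    then show False using A assms(2) by (simp add: mult_le_0_iff)
  next
    assume "p \<ge> (real CARD('n) + \<alpha>) / (real CARD('n) - 2 * s)"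
    \<comment> \<open>N \<ge> 3 and s < 1 make N - 2s positive, so the denominator can be cleared.
      Now (N + \<alpha>)/p \<le> N - 2s, and it is the B-term that gives the contradiction.\<close>
    then have "N + \<alpha> \<le> p * (N - 2 * s)" using N assms(3) unfolding N_def[symmetric] by (simp add: field_simps)
    then have "(N + \<alpha>) / p \<le> N - 2 * s" using assms(7) by (simp add: pos_divide_le_eq mult.commute)
    then have "(N + \<alpha>) / p * (A + \<omega> * B) \<le> (N - 2 * s) * (A + \<omega> * B)" using A wB by (intro mult_right_mono) auto
    then have "2 * s * (\<omega> * B) \<le> 0" using id by (simp add: algebra_simps)
    moreover have "2 * s * (\<omega> * B) > 0" using assms(2,6) B by simp
    ultimately show False by linarith
  qed
qed

end
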